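(* Let $X$ be an Asplund space, let $A,B\subset X$ be closed, and let $a\in A$ and $b\in B$. (i) If points $\hat a\in A$, $\hat b\in B$ and $u,v\in X$ satisfy $$(A-\hat a-u)\cap(B-\hat b-v)\cap(\rho\mathbb{B})=\emptyset\quad\text{and}\quad\max\{\|u\|,\|v\|\}<\varepsilon\rho$$ with some $\varepsilon>0$ and $\rho>0$, then for any $\delta>\max\{\|\hat a-a\|,\|\hat b-b\|\}+\rho(\varepsilon+1)$ there exist points $a'\in A\cap\mathbb{B}_\delta(a)$, $b'\in B\cap\mathbb{B}_\delta(b)$, $a^*\in N_A(a')$ and $b^*\in N_B(b')$ such that $$\|a^*\|+\|b^*\|=1\quad\text{and}\quad\|a^*+b^*\|<\varepsilon.$$ (ii) If $a^*\in N_A(a)$ and $b^*\in N_B(b)$ satisfy $\|a^*\|+\|b^*\|=1$ and $\|a^*+b^*\|<\varepsilon$ for some $\varepsilon>0$, then for any $\delta>0$ there exist $\rho\in(0,\delta)$ and points $u,v\in X$ such that $$(A-a-u)\cap(B-b-v)\cap(\rho\mathbb{B})=\emptyset\quad\text{and}\quad\max\{\|u\|,\|v\|\}<\varepsilon\rho.$$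
   Context: A Banach space is Asplund if every continuous convex function defined on an open convex set $D$ is Fréchet differentiable at each point of some dense subset of $D$; equivalently, the dual of each of its separable subspaces is separable. $X^*$ is the topological dual of $X$ with the dual norm. $\mathbb{B}$ is the closed unit ball of $X$, $\rho\mathbb{B}$ is the closed ball of radius $\rho$ centered at $0$, and $\mathbb{B}_\delta(x)$ is the open ball of radius $\delta$ centered at $x$. For $A\subset X$ and $a\in A$, the Fréchet normal cone to $A$ at $a$ is $$N_A(a)=\Big\{x^*\in X^*\;\Big|\;\limsup_{x\to a,\;x\in A\setminus\{a\}}\frac{\langle x^*,x-a\rangle}{\|x-a\|}\le0\Big\},$$ i.e. $x^*\in N_A(a)$ iff for every $\eta>0$ there is $\delta>0$ with $\langle x^*,x-a\rangle\le\eta\|x-a\|$ for all $x\in A\cap\mathbb{B}_\delta(a)$. *)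

theory Defs
  imports "HOL-Analysis.Analysis"
begin

text \<open>For real-valued \<open>f\<close>, \<^term>\<open>f differentiable (at x)\<close> is Frechet differentiability;
  the ambient completeness is carried by the type class.\<close>

definition asplund_space :: "'a::banach itself \<Rightarrow> bool" where
  "asplund_space (_ :: 'a itself) \<longleftrightarrow>
     (\<forall>(D :: 'a set) (f :: 'a \<Rightarrow> real).
        open D \<and> convex D \<and> convex_on D f \<and> continuous_on D f \<longrightarrow>
        (\<exists>S \<subseteq> D. D \<subseteq> closure S \<and> (\<forall>x\<in>S. f differentiable (at x))))"

text \<open>The topological dual with the dual norm is the type \<^typ>\<open>'a \<Rightarrow>\<^sub>L real\<close> with the operator norm.
  At an isolated point the filter \<^term>\<open>at a within A\<close> is trivial and the upper limit
  is \<open>-\<infinity>\<close>, so the cone is then the whole dual.\<close>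

definition frechet_normal_cone :: "'a::real_normed_vector set \<Rightarrow> 'a \<Rightarrow> ('a \<Rightarrow>\<^sub>L real) set" where
  "frechet_normal_cone A a =
     {x'. Limsup (at a within A) (\<lambda>x. ereal (blinfun_apply x' (x - a) / norm (x - a))) \<le> 0}"

lemma mem_frechet_normal_cone_iff:
  "x' \<in> frechet_normal_cone A a \<longleftrightarrow>
     (\<forall>\<eta>>0. \<exists>\<delta>>0. \<forall>x \<in> A \<inter> ball a \<delta>. blinfun_apply x' (x - a) \<le> \<eta> * norm (x - a))"
    (is "?L \<longleftrightarrow> ?R")
proof -
  have "?L \<longleftrightarrow> (\<forall>y>0. \<forall>\<^sub>F x in at a within A.
          ereal (blinfun_apply x' (x - a) / norm (x - a)) < y)"
    unfolding frechet_normal_cone_def mem_Collect_eq Limsup_le_iff ..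
  also have "\<dots> \<longleftrightarrow> (\<forall>\<eta>>0. \<forall>\<^sub>F x in at a within A. blinfun_apply x' (x - a) \<le> \<eta> * norm (x - a))"
    (is "?P \<longleftrightarrow> ?Q")
  proof
    assume P: ?P
    show ?Q
    proof (intro allI impI)
      fix \<eta> :: real assume "\<eta> > 0"
      then have "\<forall>\<^sub>F x in at a within A. ereal (blinfun_apply x' (x - a) / norm (x - a)) < ereal \<eta>"
        using P[rule_format, of "ereal \<eta>"] by (simp only: ereal_less)
      moreover have "\<forall>\<^sub>F x in at a within A. x \<noteq> a"
        by (simp add: eventually_at_filter)
      ultimately show "\<forall>\<^sub>F x in at a within A. blinfun_apply x' (x - a) \<le> \<eta> * norm (x - a)"
        by eventually_elim (simp add: divide_less_eq)
    qed
  next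
    assume Q: ?Q
    show ?P
    proof (intro allI impI)
      fix y :: ereal assume "0 < y"
      then obtain \<eta> :: real where \<eta>: "0 < ereal \<eta>" "ereal \<eta> < y"
        using ereal_dense2 by blast
      then have "\<forall>\<^sub>F x in at a within A. blinfun_apply x' (x - a) \<le> \<eta> * norm (x - a)"
        using Q by simp
      moreover have "\<forall>\<^sub>F x in at a within A. x \<noteq> a"
        by (simp add: eventually_at_filter)
      ultimately show "\<forall>\<^sub>F x in at a within A.
          ereal (blinfun_apply x' (x - a) / norm (x - a)) < y"
      proof eventually_elim
        case (elim x)
        then have "blinfun_apply x' (x - a) / norm (x - a) \<le> \<eta>"
          by (simp add: divide_le_eq)
        then show ?case
          using \<eta>(2) by (meson ereal_less_eq(3) le_less_trans)
      qed
    qed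
  qed
  also have "\<dots> \<longleftrightarrow> ?R"
    unfolding eventually_at by (force simp: dist_commute)
  finally show ?thesis .
qed

end

theory Submission
  imports Defs
begin

text \<open>
  Part (ii) is elementary: moving \<open>A\<close> and \<open>B\<close> along vectors on which the two normals are almost
  norming separates them near the reference points (\<open>normals_imp_separation\<close>).

  Part (i) is an extremal principle (\<open>approximate_normals\<close>). Put
  \<open>gap (x, y, z) = max \<parallel>x - z\<parallel> \<parallel>y - z\<parallel>\<close> on \<open>X \<times> X \<times> X\<close>. The empty intersection says that
  \<open>gap (w - c)\<close>, with \<open>c = (ahat + u, bhat + v, 0)\<close>, does not vanish on \<open>A \<times> B \<times> \<rho>\<B>\<close>, while its
  value at \<open>(ahat, bhat, 0)\<close> is below \<open>\<epsilon>\<rho>\<close>. Ekeland's principle gives a point that minimizes \<open>gap\<close> up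
  to a multiple of a distance and whose third component is interior to the ball.
  If \<open>gap\<close> and the distance were Frechet differentiable at
  a minimizer, the first two components of minus the gradient would be normals to \<open>A\<close> and \<open>B\<close>. A
  functional below \<open>gap\<close> vanishes on the diagonal, and stationarity in the third variable therefore
  makes the two normals almost opposite; they are not small because \<open>gap\<close> is positive. The
  radius \<open>\<rho> (\<epsilon> + 1)\<close> comes from measuring the first two variables with the weight
  \<open>1 / (1 + \<epsilon>)\<close>, which costs nothing in the ratio \<open>\<parallel>a* + b*\<parallel> / (\<parallel>a*\<parallel> + \<parallel>b*\<parallel>)\<close>
  (\<open>balanced_pair_functional\<close>).

  Differentiability is available only along separable subspaces, and four facts make this enough.

  \<^item> On an Asplund space \<open>X\<close> every ball of the dual is separable for uniform convergence on the
    bounded subsets of a separable subspace (\<open>asplund_dual_cover\<close>). Otherwise a Cantor scheme of weak*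
    neighbourhoods produces a dyadic tree of functionals with separated siblings, and the supremum
    of the tree is a continuous convex function that is nowhere Frechet differentiable.
  \<^item> If \<open>Y\<close> is a subspace with this separability, every bounded sublinear \<open>p\<close> is a uniform limit
    of functions that are Frechet differentiable from above along \<open>Y\<close> (\<open>smooth_approximation\<close>):
    subtract from the functionals below \<open>p\<close> a small weighted sum of squared distances to a dense
    sequence and take the supremum. The penalty makes maximizing families converge in norm, which is
    Smulian's criterion.
  \<^item> The argument of Borwein and Preiss goes through with perturbations that are only uniformly close
    to the norm (\<open>borwein_preiss\<close>), so smooth functions attain minima after smooth perturbations.
  \<^item> Normals along \<open>Y\<close> extend to normals in \<open>X\<close> when \<open>Y\<close> is rich enough
    (\<open>extend_normal_functional\<close>). By the theorem of Mazur and Orlicz, the absence of an extension has a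
    finite witness, and a countable closing-off argument builds a separable \<open>Y\<close> that contains a witness
    whenever the whole space does (\<open>ex_reflecting_subspace\<close>).
\<close>

section \<open>Sublinear functions and the Mazur-Orlicz theorem\<close>

text \<open>
  The inequality for positive scalars already forces equality and the value \<open>0\<close> at \<open>0\<close>, and it is
  easier to check for infima.
\<close>

definition sublinear :: "('z::real_vector \<Rightarrow> real) \<Rightarrow> bool" where
  "sublinear p \<longleftrightarrow> (\<forall>x y. p (x + y) \<le> p x + p y) \<and> (\<forall>c>0. \<forall>x. p (c *\<^sub>R x) \<le> c * p x)"

lemma sublinearI:
  "(\<And>x y. p (x + y) \<le> p x + p y) \<Longrightarrow> (\<And>c x. c > 0 \<Longrightarrow> p (c *\<^sub>R x) \<le> c * p x) \<Longrightarrow> sublinear p"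
  by (simp add: sublinear_def)

lemma sublinear_add: "sublinear p \<Longrightarrow> p (x + y) \<le> p x + p y"
  by (simp add: sublinear_def)

lemma sublinear_zero:
  assumes "sublinear p" shows "p 0 = 0"
proof -
  have "p (2 *\<^sub>R 0) \<le> 2 * p 0" "p ((1/2) *\<^sub>R 0) \<le> (1/2) * p 0"
    using assms unfolding sublinear_def by (metis zero_less_numeral, metis half_gt_zero zero_less_one)
  then show ?thesis by simp
qed

lemma sublinear_scale:
  assumes "sublinear p" "c \<ge> 0" shows "p (c *\<^sub>R x) = c * p x"
proof (cases "c = 0")
  case False
  then have "c > 0" using assms by simp
  moreover have "p ((1/c) *\<^sub>R (c *\<^sub>R x)) \<le> (1/c) * p (c *\<^sub>R x)" "p (c *\<^sub>R x) \<le> c * p x"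
    using assms \<open>c > 0\<close> unfolding sublinear_def by (metis divide_pos_pos zero_less_one, blast)
  ultimately show ?thesis by (simp add: field_simps)
qed (simp add: sublinear_zero[OF assms(1)])

lemma sublinear_minus: "sublinear p \<Longrightarrow> - p (- x) \<le> p x"
  using sublinear_add[of p x "- x"] sublinear_zero[of p] by simp

lemma sublinear_diff: "sublinear p \<Longrightarrow> p x - p y \<le> p (x - y)"
  using sublinear_add[of p "x - y" y] by simp

lemma sublinear_norm: "sublinear (norm :: 'z::real_normed_vector \<Rightarrow> real)"
  by (rule sublinearI) (auto simp: norm_triangle_ineq)

lemma sublinear_imp_linear:
  assumes q: "sublinear q" and super: "\<And>x y. q x + q y \<le> q (x + y)"
  shows "linear q"
proof (rule linearI)
  fix x y show add: "q (x + y) = q x + q y"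
    using sublinear_add[OF q, of x y] super[of x y] by simp
next
  fix c :: real and x
  have neg: "q (- z) = - q z" for z
    using sublinear_add[OF q, of z "- z"] super[of z "- z"] sublinear_zero[OF q] by simp
  show "q (c *\<^sub>R x) = c *\<^sub>R q x"
  proof (cases "c \<ge> 0")
    case False
    then have "q ((- c) *\<^sub>R x) = (- c) * q x" by (intro sublinear_scale[OF q]) simp
    then show ?thesis using neg[of "c *\<^sub>R x"] by simp
  qed (simp add: sublinear_scale[OF q])
qed

text \<open>
  The function \<open>q'\<close> is \<open>z \<mapsto> inf {q (z + y) - c | (y, c) \<in> \<Gamma>}\<close>; a linear function below it
  lies below \<open>q\<close> and, evaluated at \<open>- y\<close>, satisfies the lower bounds \<open>c \<le> f y\<close> encoded in \<open>\<Gamma>\<close>.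
  The same construction proves the Hahn-Banach theorem (with a ray for \<open>\<Gamma>\<close>) and the
  theorem of Mazur and Orlicz (with any convex cone).
\<close>

lemma sublinear_cone_infimum:
  assumes q: "sublinear q"
    and zero: "(0, 0) \<in> \<Gamma>"
    and add: "\<And>y c y' c'. (y, c) \<in> \<Gamma> \<Longrightarrow> (y', c') \<in> \<Gamma> \<Longrightarrow> (y + y', c + c') \<in> \<Gamma>"
    and scale: "\<And>t y c. t > 0 \<Longrightarrow> (y, c) \<in> \<Gamma> \<Longrightarrow> (t *\<^sub>R y, t * c) \<in> \<Gamma>"
    and le: "\<And>y c. (y, c) \<in> \<Gamma> \<Longrightarrow> c \<le> q y"
  obtains q' where "sublinear q'" "\<And>z y c. (y, c) \<in> \<Gamma> \<Longrightarrow> q' z \<le> q (z + y) - c"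
proof -
  define I where "I z = (\<lambda>(y, c). q (z + y) - c) ` \<Gamma>" for z
  define q' where "q' z = Inf (I z)" for z
  have ne: "I z \<noteq> {}" for z using zero by (auto simp: I_def)
  have bdd: "bdd_below (I z)" for z
  proof (rule bdd_belowI[where m = "- q (- z)"])
    fix r assume "r \<in> I z"
    then obtain y c where "(y, c) \<in> \<Gamma>" "r = q (z + y) - c" by (auto simp: I_def)
    then show "- q (- z) \<le> r"
      using le[of y c] sublinear_add[OF q, of "z + y" "- z"] by simp
  qed
  have upper: "q' z \<le> q (z + y) - c" if "(y, c) \<in> \<Gamma>" for z y c
    unfolding q'_def by (rule cInf_lower[OF _ bdd]) (use that in \<open>force simp: I_def\<close>)
  have "sublinear q'"
  proof (rule sublinearI)
    fix x z
    have *: "q' (x + z) \<le> r + s" if r: "r \<in> I x" and s: "s \<in> I z" for r s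
    proof -
      from r obtain y c where 1: "(y, c) \<in> \<Gamma>" "r = q (x + y) - c" by (auto simp: I_def)
      from s obtain y' c' where 2: "(y', c') \<in> \<Gamma>" "s = q (z + y') - c'" by (auto simp: I_def)
      have "q' (x + z) \<le> q (x + z + (y + y')) - (c + c')"
        by (rule upper) (rule add[OF 1(1) 2(1)])
      also have "\<dots> \<le> r + s"
        using sublinear_add[OF q, of "x + y" "z + y'"] 1 2 by (simp add: algebra_simps)
      finally show ?thesis .
    qed
    have "q' (x + z) - s \<le> q' x" if "s \<in> I z" for s
      unfolding q'_def[of x] by (rule cInf_greatest[OF ne]) (use *[OF _ that] in fastforce)
    then have "q' (x + z) - q' x \<le> q' z"
      unfolding q'_def[of z] by (intro cInf_greatest[OF ne]) fastforce
    then show "q' (x + z) \<le> q' x + q' z" by simp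
  next
    fix t :: real and z assume t: "t > 0"
    have "q' (t *\<^sub>R z) / t \<le> r" if r: "r \<in> I z" for r
    proof -
      from r obtain y c where 1: "(y, c) \<in> \<Gamma>" "r = q (z + y) - c" by (auto simp: I_def)
      have "q' (t *\<^sub>R z) \<le> q (t *\<^sub>R z + t *\<^sub>R y) - t * c"
        by (rule upper) (rule scale[OF t 1(1)])
      also have "\<dots> = t * r"
        using sublinear_scale[OF q, of t "z + y"] t 1 by (simp add: scaleR_add_right right_diff_distrib)
      finally show ?thesis using t by (simp add: field_simps)
    qed
    then have "q' (t *\<^sub>R z) / t \<le> q' z"
      unfolding q'_def[of z] by (intro cInf_greatest[OF ne])
    then show "q' (t *\<^sub>R z) \<le> t * q' z" using t by (simp add: field_simps)
  qed
  then show ?thesis using that upper by blast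
qed

lemma ray_cone:
  fixes y :: "'z::real_vector" and c :: real
  shows "(0, 0) \<in> (\<lambda>t. (t *\<^sub>R y, t * c)) ` {0..}"
    and "(v, a) \<in> (\<lambda>t. (t *\<^sub>R y, t * c)) ` {0..} \<Longrightarrow> (v', a') \<in> (\<lambda>t. (t *\<^sub>R y, t * c)) ` {0..} \<Longrightarrow>
      (v + v', a + a') \<in> (\<lambda>t. (t *\<^sub>R y, t * c)) ` {0..}"
    and "s > 0 \<Longrightarrow> (v, a) \<in> (\<lambda>t. (t *\<^sub>R y, t * c)) ` {0..} \<Longrightarrow>
      (s *\<^sub>R v, s * a) \<in> (\<lambda>t. (t *\<^sub>R y, t * c)) ` {0..}"
proof -
  let ?\<Gamma> = "(\<lambda>t. (t *\<^sub>R y, t * c)) ` {0..}"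
  have mem: "(t *\<^sub>R y, t * c) \<in> ?\<Gamma>" if "t \<ge> 0" for t using that by blast
  show "(0, 0) \<in> ?\<Gamma>" using mem[of 0] by simp
  show "(v + v', a + a') \<in> ?\<Gamma>" if va: "(v, a) \<in> ?\<Gamma>" "(v', a') \<in> ?\<Gamma>"
  proof -
    from va obtain t t' where "t \<ge> 0" "t' \<ge> 0" "v = t *\<^sub>R y" "a = t * c" "v' = t' *\<^sub>R y" "a' = t' * c"
      by auto
    then show ?thesis using mem[of "t + t'"] by (simp add: scaleR_add_left distrib_right)
  qed
  show "(s *\<^sub>R v, s * a) \<in> ?\<Gamma>" if s: "s > 0" "(v, a) \<in> ?\<Gamma>"
  proof -
    from s obtain t where "t \<ge> 0" "v = t *\<^sub>R y" "a = t * c" by auto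
    then show ?thesis using mem[of "s * t"] s(1) by (simp add: mult.assoc)
  qed
qed

text \<open>
  By Zorn's lemma there is a minimal sublinear function below \<open>p\<close>. The infimum construction along the
  ray through \<open>(y, q y)\<close> cannot decrease it, and this says that it is superadditive, hence linear.
\<close>

theorem hahn_banach_sublinear:
  fixes p :: "'z::real_vector \<Rightarrow> real"
  assumes p: "sublinear p"
  obtains f where "linear f" "\<And>x. f x \<le> p x"
proof -
  define A where "A = {q. sublinear q \<and> (\<forall>x. q x \<le> p x)}"
  define P where "P q r \<longleftrightarrow> (\<forall>x. r x \<le> q x)" for q r :: "'z \<Rightarrow> real"
  have low: "- p (- x) \<le> q x" if "q \<in> A" for q x
  proof -
    have "- q (- x) \<le> q x" "q (- x) \<le> p (- x)"
      using that sublinear_minus[of q x] by (auto simp: A_def)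
    then show ?thesis by simp
  qed
  have "\<exists>m\<in>A. \<forall>a\<in>A. P m a \<longrightarrow> a = m"
  proof (rule predicate_Zorn)
    show "partial_order_on A (relation_of P A)"
    proof (rule partial_order_on_relation_ofI)
      show "P q r" if "P q s" "P s r" for q r s
        using that unfolding P_def by (meson order_trans)
      show "q = r" if "P q r" "P r q" for q r
        using that unfolding P_def by (simp add: antisym ext)
    qed (simp add: P_def)
  next
    fix C assume C: "C \<in> Chains (relation_of P A)"
    have CA: "C \<subseteq> A" using C by (auto simp: Chains_def relation_of_def)
    show "\<exists>u\<in>A. \<forall>a\<in>C. P a u"
    proof (cases "C = {}")
      case True
      then show ?thesis using p by (auto simp: A_def)
    next
      case False
      define u where "u x = (INF q\<in>C. q x)" for x
      have bdd: "bdd_below ((\<lambda>q. q x) ` C)" for x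
        using low CA by (intro bdd_belowI[where m = "- p (- x)"]) auto
      have u_le: "u x \<le> q x" if "q \<in> C" for q x
        unfolding u_def using that by (intro cINF_lower[OF bdd])
      have "sublinear u"
      proof (rule sublinearI)
        fix x y
        have *: "u (x + y) \<le> q x + r y" if qr: "q \<in> C" "r \<in> C" for q r
        proof -
          obtain s where s: "s \<in> C" "s x \<le> q x" "s y \<le> r y"
            using C qr unfolding Chains_def relation_of_def P_def by blast
          then have "u (x + y) \<le> s (x + y)" using u_le by blast
          also have "\<dots> \<le> s x + s y" using s CA by (auto simp: A_def sublinear_add)
          finally show ?thesis using s by linarith
        qed
        have "u (x + y) - r y \<le> u x" if "r \<in> C" for r
          unfolding u_def[of x] by (rule cINF_greatest[OF False]) (use *[OF _ that] in fastforce)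
        then have "u (x + y) - u x \<le> u y"
          unfolding u_def[of y] by (intro cINF_greatest[OF False]) fastforce
        then show "u (x + y) \<le> u x + u y" by simp
      next
        fix c :: real and x assume c: "c > 0"
        have "u (c *\<^sub>R x) / c \<le> q x" if "q \<in> C" for q
        proof -
          have "u (c *\<^sub>R x) \<le> q (c *\<^sub>R x)" using u_le that by blast
          also have "\<dots> = c * q x" using that CA c by (intro sublinear_scale) (auto simp: A_def)
          finally show ?thesis using c by (simp add: field_simps)
        qed
        then have "u (c *\<^sub>R x) / c \<le> u x"
          unfolding u_def[of x] by (intro cINF_greatest[OF False])
        then show "u (c *\<^sub>R x) \<le> c * u x" using c by (simp add: field_simps)
      qed
      moreover obtain q0 where "q0 \<in> C" using False by blast
      have "u x \<le> p x" for x
      proof -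
        have "q0 \<in> A" using \<open>q0 \<in> C\<close> CA by blast
        then have "q0 x \<le> p x" by (simp add: A_def)
        then show ?thesis using u_le[OF \<open>q0 \<in> C\<close>, of x] by simp
      qed
      ultimately have "u \<in> A" by (simp add: A_def)
      then show ?thesis using u_le by (auto simp: P_def)
    qed
  qed
  then obtain q where q: "q \<in> A" and minimal: "\<And>r. r \<in> A \<Longrightarrow> (\<And>x. r x \<le> q x) \<Longrightarrow> r = q"
    unfolding P_def by blast
  have sq: "sublinear q" using q by (simp add: A_def)
  have "linear q"
  proof (rule sublinear_imp_linear[OF sq])
    fix x y
    define \<Gamma> where "\<Gamma> = (\<lambda>t. (t *\<^sub>R y, t * q y)) ` {0..}"
    have le: "c \<le> q v" if "(v, c) \<in> \<Gamma>" for v c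
      using that sublinear_scale[OF sq] by (auto simp: \<Gamma>_def)
    obtain r where r: "sublinear r"
      and r_le: "\<And>z v c. (v, c) \<in> \<Gamma> \<Longrightarrow> r z \<le> q (z + v) - c"
      using sublinear_cone_infimum[OF sq ray_cone[where y = y and c = "q y", folded \<Gamma>_def] le]
      by blast
    have mem: "(t *\<^sub>R y, t * q y) \<in> \<Gamma>" if "t \<ge> 0" for t
      using that unfolding \<Gamma>_def by blast
    have rq: "r z \<le> q z" for z
      using r_le[OF mem[of 0], of z] by simp
    have "r z \<le> p z" for z
      using order_trans[OF rq, of z "p z"] q by (simp add: A_def)
    then have "r \<in> A" using r by (simp add: A_def)
    then have "r = q" using rq by (rule minimal)
    moreover have "r x \<le> q (x + y) - q y"
      using r_le[OF mem[of 1], of x] by simp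
    ultimately show "q x + q y \<le> q (x + y)" by simp
  qed
  then show ?thesis using that[of q] q by (auto simp: A_def)
qed

text \<open>
  A system of lower bounds \<open>c \<le> f y\<close> is solvable by a linear function below \<open>q\<close> as soon as each
  consequence obtained by positive combination is consistent with \<open>q\<close>. Both norming functionals
  and extensions of normals are obtained from it.
\<close>

theorem mazur_orlicz:
  fixes q :: "'z::real_vector \<Rightarrow> real"
  assumes q: "sublinear q"
    and zero: "(0, 0) \<in> \<Gamma>"
    and add: "\<And>y c y' c'. (y, c) \<in> \<Gamma> \<Longrightarrow> (y', c') \<in> \<Gamma> \<Longrightarrow> (y + y', c + c') \<in> \<Gamma>"
    and scale: "\<And>t y c. t > 0 \<Longrightarrow> (y, c) \<in> \<Gamma> \<Longrightarrow> (t *\<^sub>R y, t * c) \<in> \<Gamma>"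
    and le: "\<And>y c. (y, c) \<in> \<Gamma> \<Longrightarrow> c \<le> q y"
  obtains f where "linear f" "\<And>x. f x \<le> q x" "\<And>y c. (y, c) \<in> \<Gamma> \<Longrightarrow> c \<le> f y"
proof -
  obtain q' where q': "sublinear q'" "\<And>z y c. (y, c) \<in> \<Gamma> \<Longrightarrow> q' z \<le> q (z + y) - c"
    using sublinear_cone_infimum[OF assms] by blast
  obtain f where f: "linear f" "\<And>x. f x \<le> q' x" using hahn_banach_sublinear[OF q'(1)] by blast
  have "f x \<le> q x" for x using f(2)[of x] q'(2)[OF zero, of x] by simp
  moreover have "c \<le> f y" if "(y, c) \<in> \<Gamma>" for y c
    using f(2)[of "- y"] q'(2)[OF that, of "- y"] linear_neg[OF f(1), of y] sublinear_zero[OF q]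
    by simp
  ultimately show ?thesis using that f(1) by blast
qed

corollary hahn_banach_attained:
  fixes p :: "'z::real_vector \<Rightarrow> real"
  assumes p: "sublinear p"
  obtains f where "linear f" "\<And>z. f z \<le> p z" "f x = p x"
proof -
  define \<Gamma> where "\<Gamma> = (\<lambda>t. (t *\<^sub>R x, t * p x)) ` {0..}"
  have le: "c \<le> p y" if "(y, c) \<in> \<Gamma>" for y c
    using that sublinear_scale[OF p] by (auto simp: \<Gamma>_def)
  obtain f where f: "linear f" "\<And>z. f z \<le> p z" "\<And>y c. (y, c) \<in> \<Gamma> \<Longrightarrow> c \<le> f y"
    using mazur_orlicz[OF p ray_cone[where y = x and c = "p x", folded \<Gamma>_def] le] by blast
  have "(x, p x) \<in> \<Gamma>" by (auto simp: \<Gamma>_def image_iff intro: bexI[of _ 1])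
  then show ?thesis using that f by (metis antisym)
qed

section \<open>Countable closure and pointwise cluster points\<close>

text \<open>
  The downward Loewenheim-Skolem argument: \<open>h\<close> lists the witnesses demanded by a finite tuple of
  parameters.
\<close>

lemma countable_closing_off:
  fixes h :: "'a list \<Rightarrow> 'a set"
  assumes h: "\<And>ps. countable (h ps)" and D0: "countable D0"
  shows "\<exists>D. countable D \<and> D0 \<subseteq> D \<and> (\<forall>ps. set ps \<subseteq> D \<longrightarrow> h ps \<subseteq> D)"
proof -
  define S where "S = rec_nat D0 (\<lambda>_ E. E \<union> (\<Union>ps\<in>lists E. h ps))"
  have S0: "S 0 = D0" and SS: "S (Suc n) = S n \<union> (\<Union>ps\<in>lists (S n). h ps)" for n
    by (auto simp: S_def)
  have c: "countable (S n)" for n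
    by (induction n) (use h D0 in \<open>auto simp: S0 SS\<close>)
  have mono: "m \<le> n \<Longrightarrow> S m \<subseteq> S n" for m n
    by (rule lift_Suc_mono_le[of S]) (auto simp: SS)
  show ?thesis
  proof (intro exI[of _ "\<Union>n. S n"] conjI allI impI)
    show "countable (\<Union>n. S n)" using c by blast
    show "D0 \<subseteq> (\<Union>n. S n)" using S0 by blast
    fix ps assume ps: "set ps \<subseteq> (\<Union>n. S n)"
    have "\<exists>n. set ps \<subseteq> S n" using ps
    proof (induction ps)
      case (Cons p ps)
      then obtain n m where "set ps \<subseteq> S n" "p \<in> S m" by auto
      then have "set (p # ps) \<subseteq> S (max n m)"
        using mono[of n "max n m"] mono[of m "max n m"] by auto
      then show ?case by blast
    qed simp
    then obtain n where "ps \<in> lists (S n)" by (auto simp: in_lists_conv_set)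
    then have "h ps \<subseteq> S (Suc n)" unfolding SS by blast
    then show "h ps \<subseteq> (\<Union>n. S n)" by blast
  qed
qed

text \<open>
  Tychonoff's theorem, in the form in which weak* compactness of dual balls is used. The filter
  \<open>F\<close> plays the part of a convergent subnet, and all coordinates converge along the same \<open>F\<close>.
\<close>

lemma bounded_functions_cluster:
  fixes u :: "nat \<Rightarrow> 'i \<Rightarrow> real"
  assumes u: "\<And>n i. \<bar>u n i\<bar> \<le> b i"
  shows "\<exists>F v. F \<noteq> bot \<and> F \<le> sequentially \<and> (\<forall>i. ((\<lambda>n. u n i) \<longlongrightarrow> v i) F)"
proof -
  define K where "K = PiE UNIV (\<lambda>i. {- b i .. b i})"
  have "compactin (product_topology (\<lambda>i. euclidean) UNIV) K"
    unfolding K_def by (subst compactin_PiE) auto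
  then have "compact K" by (simp add: euclidean_product_topology)
  have uK: "u n \<in> K" for n
    unfolding K_def using u[of n] by (auto simp: abs_le_iff PiE_def Pi_def) (metis minus_le_iff)
  have "eventually (\<lambda>f. f \<in> K) (filtermap u sequentially)" "filtermap u sequentially \<noteq> bot"
    using uK by (auto simp: eventually_filtermap filtermap_bot_iff)
  with compact_filter[THEN iffD1, OF \<open>compact K\<close>, rule_format, of "filtermap u sequentially"]
  obtain v where v: "inf (nhds v) (filtermap u sequentially) \<noteq> bot" by auto
  define F where "F = inf (filtercomap u (nhds v)) sequentially"
  have "F \<noteq> bot"
  proof
    assume "F = bot"
    then have "eventually (\<lambda>_. False) F" by simp
    then obtain P Q where PQ: "eventually P (filtercomap u (nhds v))" "eventually Q sequentially"
      "\<And>n. P n \<Longrightarrow> Q n \<Longrightarrow> False" unfolding F_def eventually_inf by auto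
    then obtain R where R: "eventually R (nhds v)" "\<And>n. R (u n) \<Longrightarrow> P n"
      unfolding eventually_filtercomap by blast
    have "eventually (\<lambda>w. \<not> R w) (filtermap u sequentially)"
      unfolding eventually_filtermap using PQ(2) by eventually_elim (use PQ(3) R(2) in blast)
    with R(1) have "eventually (\<lambda>_. False) (inf (nhds v) (filtermap u sequentially))"
      unfolding eventually_inf by blast
    with v show False by (simp add: trivial_limit_def)
  qed
  moreover have "filterlim u (nhds v) F"
    unfolding F_def filterlim_def filtermap_inf
    by (metis F_def filterlim_def filterlim_filtercomap filterlim_mono inf.cobounded1 order_refl)
  then have "((\<lambda>n. u n i) \<longlongrightarrow> v i) F" for i
  proof -
    have "continuous_on UNIV (\<lambda>f::'i \<Rightarrow> real. f i)"
      by (rule continuous_on_product_then_coordinatewise) (rule continuous_on_id)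
    then show ?thesis
      using continuous_on_tendsto_compose[OF _ \<open>filterlim u (nhds v) F\<close>, of UNIV "\<lambda>f. f i"] by simp
  qed
  moreover have "F \<le> sequentially" by (simp add: F_def)
  ultimately show ?thesis by (intro exI[of _ F] exI[of _ v] conjI allI)
qed

lemma linear_pointwise_limit:
  fixes f :: "nat \<Rightarrow> 'z::real_vector \<Rightarrow> real"
  assumes F: "F \<noteq> bot" and lim: "\<And>x. ((\<lambda>n. f n x) \<longlongrightarrow> g x) F" and lin: "\<And>n. linear (f n)"
  shows "linear g"
proof (rule linearI)
  fix x y
  have "((\<lambda>n. f n (x + y)) \<longlongrightarrow> g x + g y) F"
    using tendsto_add[OF lim lim, of x y] by (simp add: linear_add[OF lin])
  then show "g (x + y) = g x + g y" by (rule tendsto_unique[OF F lim])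
next
  fix c x
  have "((\<lambda>n. f n (c *\<^sub>R x)) \<longlongrightarrow> c * g x) F"
    using tendsto_mult[OF tendsto_const lim, of c x] by (simp add: linear_scale[OF lin])
  then show "g (c *\<^sub>R x) = c *\<^sub>R g x"
    unfolding real_scaleR_def by (rule tendsto_unique[OF F lim])
qed

section \<open>Separability of duals in Asplund spaces\<close>

text \<open>
  Starting from the values \<open>l\<close> at depth \<open>n\<close> below the node \<open>s\<close>, averages of siblings are taken back up
  to \<open>s\<close>. Nodes are bit lists with the most recent choice first.
\<close>

primrec dyadic_average :: "(bool list \<Rightarrow> 'a \<Rightarrow> real) \<Rightarrow> nat \<Rightarrow> bool list \<Rightarrow> 'a \<Rightarrow> real" where
  "dyadic_average l 0 s = l s"
| "dyadic_average l (Suc n) s =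
     (\<lambda>x. (dyadic_average l n (True # s) x + dyadic_average l n (False # s) x) / 2)"

text \<open>
  The supremum \<open>p\<close> of the tree is convex and Lipschitz, so it is differentiable somewhere. At such a
  point \<open>x\<close>, all members of the tree that almost attain \<open>p x\<close> are close in norm to the derivative
  (Smulian). But a parent that almost attains \<open>p x\<close> has a child that does so as well, because it
  is the mean of its children, and the distance between the two is at least half of the gap.
\<close>

lemma asplund_no_dyadic_tree:
  fixes w :: "bool list \<Rightarrow> 'a::banach \<Rightarrow> real" and d :: "bool list \<Rightarrow> 'a"
  assumes asplund: "asplund_space TYPE('a)"
    and lin: "\<And>s. linear (w s)" and bound: "\<And>s x. \<bar>w s x\<bar> \<le> R * norm x" and R: "R \<ge> 0"
    and mean: "\<And>s x. w s x = (w (True # s) x + w (False # s) x) / 2"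
    and \<epsilon>: "\<epsilon> > 0" and d: "\<And>s. d s \<noteq> 0"
    and gap: "\<And>s. w (True # s) (d s) - w (False # s) (d s) \<ge> \<epsilon> * norm (d s)"
  shows False
proof -
  define p where "p x = (SUP s. w s x)" for x
  have bdd: "bdd_above (range (\<lambda>s. w s x))" for x
    using bound by (intro bdd_aboveI[where M = "R * norm x"]) (auto simp: abs_le_iff)
  have upper: "w s x \<le> p x" for s x
    unfolding p_def by (rule cSUP_upper[OF _ bdd]) simp
  have add: "w s (x + y) = w s x + w s y" and scale: "w s (c *\<^sub>R x) = c * w s x" for s x y c
    using lin[of s] by (simp_all add: linear_add linear_scale)
  have p_lip: "p x \<le> p y + R * norm (x - y)" for x y
    unfolding p_def[of x]
  proof (rule cSUP_least)
    fix s
    have "w s x = w s y + w s (x - y)" using add[of s y "x - y"] by simp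
    also have "\<dots> \<le> p y + R * norm (x - y)"
      using upper[of s y] bound[of s "x - y"] by simp
    finally show "w s x \<le> p y + R * norm (x - y)" .
  qed simp
  have "R-lipschitz_on UNIV p"
  proof (rule lipschitz_onI)
    show "dist (p x) (p y) \<le> R * dist x y" for x y
      using p_lip[of x y] p_lip[of y x] by (simp add: dist_norm abs_le_iff norm_minus_commute)
  qed (rule R)
  then have cont: "continuous_on UNIV p" by (rule lipschitz_on_continuous_on)
  have convex: "convex_on UNIV p"
  proof (rule convex_onI)
    fix t :: real and x y :: 'a assume t: "0 < t" "t < 1"
    show "p ((1 - t) *\<^sub>R x + t *\<^sub>R y) \<le> (1 - t) * p x + t * p y"
      unfolding p_def[of "(1 - t) *\<^sub>R x + t *\<^sub>R y"]
    proof (rule cSUP_least)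
      show "w s ((1 - t) *\<^sub>R x + t *\<^sub>R y) \<le> (1 - t) * p x + t * p y" for s
        using t by (auto simp: add scale intro!: add_mono mult_left_mono upper)
    qed simp
  qed simp
  obtain S where "UNIV \<subseteq> closure S" and diff: "\<And>x. x \<in> S \<Longrightarrow> p differentiable (at x)"
    using asplund[unfolded asplund_space_def, rule_format, of UNIV p] convex cont by auto
  then have "S \<noteq> {}" by auto
  then obtain x p' where "(p has_derivative p') (at x)"
    using diff unfolding differentiable_def by blast
  then have p': "bounded_linear p'"
    and deriv: "\<And>e. e > 0 \<Longrightarrow> \<exists>r>0. \<forall>y. norm (y - x) < r \<longrightarrow>
                  norm (p y - p x - p' (y - x)) \<le> e * norm (y - x)"
    unfolding has_derivative_at_alt by auto
  \<comment> \<open>near-maximizers are within \<open>4 * \<eta>\<close> of each other, and \<open>4 * \<eta> = \<epsilon> / 4\<close> is below half of the gap\<close>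
  define \<eta> where "\<eta> = \<epsilon> / 16"
  have \<eta>: "\<eta> > 0" using \<epsilon> by (simp add: \<eta>_def)
  obtain r where r: "r > 0"
    and approx: "\<And>y. norm (y - x) < r \<Longrightarrow> norm (p y - p x - p' (y - x)) \<le> \<eta> * norm (y - x)"
    using deriv[OF \<eta>] by blast
  have near_upper: "w s h - p' h \<le> 2 * \<eta> * norm h" if s: "w s x > p x - \<eta> * r / 2" for s h
  proof (cases "h = 0")
    case True
    then show ?thesis using scale[of s 0 h] linear_0[OF bounded_linear.linear[OF p']] by simp
  next
    case False
    define c where "c = r / 2 / norm h"
    have c: "c > 0" "c * norm h = r / 2" using False r by (auto simp: c_def)
    have norm_ch: "norm (c *\<^sub>R h) = r / 2" using c by simp
    have "norm (x + c *\<^sub>R h - x) < r" using r norm_ch by (simp del: norm_scaleR)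
    from approx[OF this] have "norm (p (x + c *\<^sub>R h) - p x - p' (c *\<^sub>R h)) \<le> \<eta> * norm (c *\<^sub>R h)"
      by (simp only: add_diff_cancel_left')
    then have "p (x + c *\<^sub>R h) - p x - p' (c *\<^sub>R h) \<le> \<eta> * (r / 2)"
      unfolding norm_ch by (simp only: real_norm_def abs_le_iff)
    moreover have "w s x + c * w s h \<le> p (x + c *\<^sub>R h)"
      using upper[of s "x + c *\<^sub>R h"] by (simp add: add scale)
    moreover have "p' (c *\<^sub>R h) = c * p' h"
      using linear_scale[OF bounded_linear.linear[OF p']] by simp
    ultimately have "c * (w s h - p' h) \<le> \<eta> * r"
      using s by (simp add: right_diff_distrib)
    also have "\<eta> * r = c * (2 * \<eta> * norm h)" using c(2) by simp
    finally show ?thesis using c(1) by simp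
  qed
  have near: "\<bar>w s h - p' h\<bar> \<le> 2 * \<eta> * norm h" if s: "w s x > p x - \<eta> * r / 2" for s h
    using near_upper[OF s, of h] near_upper[OF s, of "- h"] scale[of s "-1" h]
      linear_neg[OF bounded_linear.linear[OF p'], of h] by (simp add: abs_le_iff)
  have "p x - \<eta> * r / 2 < (SUP s. w s x)"
    unfolding p_def[symmetric] using \<eta> r by simp
  then obtain s where s: "w s x > p x - \<eta> * r / 2"
    using less_cSUP_iff[OF _ bdd] by auto
  then have "w (True # s) x > p x - \<eta> * r / 2 \<or> w (False # s) x > p x - \<eta> * r / 2"
    using mean[of s x] by auto
  then obtain b where b: "w (b # s) x > p x - \<eta> * r / 2" by blast
  have "\<bar>w s (d s) - w (b # s) (d s)\<bar> \<le> 4 * \<eta> * norm (d s)"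
    using near[OF s, of "d s"] near[OF b, of "d s"] by (simp add: abs_le_iff)
  moreover have "\<bar>w s (d s) - w (b # s) (d s)\<bar> \<ge> \<epsilon> * norm (d s) / 2"
    using gap[of s] mean[of s "d s"] by (cases b) (auto simp: abs_if field_simps)
  moreover have "\<epsilon> * norm (d s) > 0" using \<epsilon> d[of s] by simp
  ultimately show False by (simp add: \<eta>_def)
qed

text \<open>
  Only finitely many rational bounds on the values at points of \<open>D\<close> are used to describe weak*
  neighbourhoods, so there are countably many of them, and discarding the members of \<open>C\<close> that have
  a neighbourhood meeting \<open>C\<close> in a countable set leaves an uncountable set. Inside each neighbourhood that meets \<open>C\<close> in an
  uncountable set, two separated members have disjoint such neighbourhoods, and iteration gives a Cantor scheme. The convex
  combinations over finite levels are taken before passing to the limit, so that the limit tree consists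
  of exact midpoints; the witnesses \<open>wt\<close> of separation depend on the node only and
  survive the limit.
\<close>

lemma asplund_separated_countable:
  fixes C :: "('a::banach \<Rightarrow> real) set" and D :: "'a set"
  assumes asplund: "asplund_space TYPE('a)" and D: "countable D"
    and lin: "\<And>f. f \<in> C \<Longrightarrow> linear f"
    and bound: "\<And>f x. f \<in> C \<Longrightarrow> \<bar>f x\<bar> \<le> R * norm x" and R: "R \<ge> 0" and \<epsilon>: "\<epsilon> > 0"
    and sep: "\<And>f g. f \<in> C \<Longrightarrow> g \<in> C \<Longrightarrow> f \<noteq> g \<Longrightarrow> \<exists>d\<in>D. \<bar>f d - g d\<bar> > \<epsilon> * norm d"
  shows "countable C"
proof (rule ccontr)
  assume unc: "uncountable C"
  define U where "U F = {f::'a \<Rightarrow> real. \<forall>(d, s, t)\<in>F. s < f d \<and> f d < t}" for F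
  define \<F> where "\<F> = {F. finite F \<and> F \<subseteq> D \<times> (\<rat>::real set) \<times> (\<rat>::real set)}"
  define good where "good F \<longleftrightarrow> F \<in> \<F> \<and> uncountable (U F \<inter> C)" for F
  have \<F>: "countable \<F>"
    unfolding \<F>_def by (intro countable_Collect_finite_subset countable_SIGMA D countable_rat)
  \<comment> \<open>the condensation points of \<open>C\<close>; \<open>removed\<close> is countable\<close>
  define C' where "C' = C - (\<Union>F\<in>{F\<in>\<F>. countable (U F \<inter> C)}. U F \<inter> C)"
  have removed: "countable (\<Union>F\<in>{F\<in>\<F>. countable (U F \<inter> C)}. U F \<inter> C)"
    using \<F> by (intro countable_UN countable_subset[OF _ \<F>]) auto
  have goodI: "good F" if "F \<in> \<F>" "f \<in> U F" "f \<in> C'" for F f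
    using that unfolding good_def C'_def by blast
  define splits where "splits F d F0 F1 \<longleftrightarrow> d \<noteq> 0 \<and> good F0 \<and> good F1 \<and> F \<subseteq> F0 \<and> F \<subseteq> F1 \<and>
      (\<forall>f\<in>U F0. \<forall>g\<in>U F1. f d - g d \<ge> \<epsilon> * norm d)" for F d F0 F1
  have split: "\<exists>d F0 F1. splits F d F0 F1" if F: "good F" for F
  proof -
    have "uncountable (U F \<inter> C - (\<Union>F\<in>{F\<in>\<F>. countable (U F \<inter> C)}. U F \<inter> C))"
      by (rule uncountable_minus_countable[OF _ removed]) (use F in \<open>simp add: good_def\<close>)
    moreover have "U F \<inter> C - (\<Union>F\<in>{F\<in>\<F>. countable (U F \<inter> C)}. U F \<inter> C) \<subseteq> U F \<inter> C'"
      by (auto simp: C'_def)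
    ultimately have unc': "uncountable (U F \<inter> C')" using countable_subset[of _ "U F \<inter> C'"] by auto
    then have "U F \<inter> C' \<noteq> {}" by (intro notI) simp
    then obtain f where f: "f \<in> U F \<inter> C'" by blast
    have "\<not> U F \<inter> C' \<subseteq> {f}" using unc' countable_subset[of "U F \<inter> C'" "{f}"] by auto
    then obtain g where g: "g \<in> U F \<inter> C'" "g \<noteq> f" by blast
    have fgC: "f \<in> C" "g \<in> C" using f g by (auto simp: C'_def)
    obtain d where d: "d \<in> D" "\<bar>f d - g d\<bar> > \<epsilon> * norm d" using sep[of f g] fgC g by blast
    define f1 where "f1 = (if f d > g d then f else g)"
    define g1 where "g1 = (if f d > g d then g else f)"
    have fg1: "f1 \<in> U F" "f1 \<in> C'" "g1 \<in> U F" "g1 \<in> C'" "f1 d - g1 d > \<epsilon> * norm d"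
      using f g d by (auto simp: f1_def g1_def split: if_splits)
    have "d \<noteq> 0"
      using d(2) linear_0[OF lin[OF fgC(1)]] linear_0[OF lin[OF fgC(2)]] by (intro notI) simp
    \<comment> \<open>two rational half-lines that separate the values at \<open>d\<close> by more than \<open>\<epsilon> * norm d\<close>\<close>
    obtain t where t: "t \<in> \<rat>" "g1 d < t" "t < f1 d - \<epsilon> * norm d"
      using Rats_dense_in_real[of "g1 d" "f1 d - \<epsilon> * norm d"] fg1 by auto
    obtain s where s: "s \<in> \<rat>" "t + \<epsilon> * norm d < s" "s < f1 d"
      using Rats_dense_in_real[of "t + \<epsilon> * norm d" "f1 d"] t by auto
    obtain s' where s': "s' \<in> \<rat>" "f1 d < s'" using Rats_dense_in_real[of "f1 d" "f1 d + 1"] by auto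
    obtain t' where t': "t' \<in> \<rat>" "t' < g1 d" using Rats_dense_in_real[of "g1 d - 1" "g1 d"] by auto
    have F\<F>: "F \<in> \<F>" using F by (simp add: good_def)
    have "good (insert (d, s, s') F)"
      by (rule goodI[of _ f1]) (use F\<F> fg1 d s s' in \<open>auto simp: \<F>_def U_def\<close>)
    moreover have "good (insert (d, t', t) F)"
      by (rule goodI[of _ g1]) (use F\<F> fg1 d t t' in \<open>auto simp: \<F>_def U_def\<close>)
    moreover have "f' d - g' d \<ge> \<epsilon> * norm d"
      if "f' \<in> U (insert (d, s, s') F)" "g' \<in> U (insert (d, t', t) F)" for f' g'
      using that s t by (auto simp: U_def)
    ultimately show ?thesis using \<open>d \<noteq> 0\<close> unfolding splits_def
      by (intro exI[of _ d] exI[of _ "insert (d, s, s') F"] exI[of _ "insert (d, t', t) F"] conjI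
          ballI subset_insertI)
  qed
  have "\<forall>F. \<exists>z. good F \<longrightarrow> splits F (fst z) (fst (snd z)) (snd (snd z))"
  proof
    fix F
    show "\<exists>z. good F \<longrightarrow> splits F (fst z) (fst (snd z)) (snd (snd z))"
    proof (cases "good F")
      case True
      from split[OF this] obtain d F0 F1 where "splits F d F0 F1" by (elim exE)
      then show ?thesis by (intro exI[of _ "(d, F0, F1)"]) simp
    qed simp
  qed
  from choice[OF this] obtain Z
    where Z: "\<forall>F. good F \<longrightarrow> splits F (fst (Z F)) (fst (snd (Z F))) (snd (snd (Z F)))"
    by (elim exE)
  define wt where "wt F = fst (Z F)" for F
  define L where "L F = fst (snd (Z F))" for F
  define R' where "R' F = snd (snd (Z F))" for F
  have step: "wt F \<noteq> 0" "good (L F)" "good (R' F)" "F \<subseteq> L F" "F \<subseteq> R' F"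
      "\<And>f g. f \<in> U (L F) \<Longrightarrow> g \<in> U (R' F) \<Longrightarrow> f (wt F) - g (wt F) \<ge> \<epsilon> * norm (wt F)" if "good F" for F
  proof -
    have "splits F (wt F) (L F) (R' F)"
      using spec[OF Z, of F] that unfolding wt_def L_def R'_def by (rule mp)
    note * = this[unfolded splits_def]
    show "wt F \<noteq> 0" "good (L F)" "good (R' F)" "F \<subseteq> L F" "F \<subseteq> R' F"
      using * by simp_all
    show "f (wt F) - g (wt F) \<ge> \<epsilon> * norm (wt F)" if "f \<in> U (L F)" "g \<in> U (R' F)" for f g
      using * that by simp
  qed
  define node where "node = rec_list {} (\<lambda>b s N. if b then L N else R' N)"
  have node: "node [] = {}" "node (True # s) = L (node s)" "node (False # s) = R' (node s)" for s
    by (simp_all add: node_def)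
  have good_node: "good (node s)" for s
  proof (induction s)
    case Nil
    show ?case using unc by (simp add: node good_def \<F>_def U_def)
  next
    case (Cons b s)
    then show ?case using step(2,3)[OF Cons.IH] by (cases b) (simp_all add: node)
  qed
  have U_mono: "U (node (b # s)) \<subseteq> U (node s)" for b s
  proof -
    have "node s \<subseteq> node (b # s)" using step(4,5)[OF good_node[of s]] by (cases b) (simp_all add: node)
    then show ?thesis unfolding U_def by blast
  qed
  have "\<forall>s. \<exists>f. f \<in> U (node s) \<inter> C"
  proof
    fix s have "U (node s) \<inter> C \<noteq> {}" using good_node[of s] by (intro notI) (simp add: good_def)
    then show "\<exists>f. f \<in> U (node s) \<inter> C" by blast
  qed
  from choice[OF this] obtain l where l: "\<And>s. l s \<in> U (node s) \<inter> C" by blast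
  have avg: "dyadic_average l n s \<in> U (node s) \<and> linear (dyadic_average l n s) \<and>
      (\<forall>x. \<bar>dyadic_average l n s x\<bar> \<le> R * norm x)" for n s
  proof (induction n arbitrary: s)
    case 0
    then show ?case using l[of s] lin bound by simp
  next
    case (Suc n)
    let ?f = "dyadic_average l n (True # s)" and ?g = "dyadic_average l n (False # s)"
    have fg: "?f \<in> U (node s)" "?g \<in> U (node s)" "linear ?f" "linear ?g"
      and b: "\<And>x. \<bar>?f x\<bar> \<le> R * norm x" "\<And>x. \<bar>?g x\<bar> \<le> R * norm x"
      using Suc[of "True # s"] Suc[of "False # s"] subsetD[OF U_mono[of True s]]
        subsetD[OF U_mono[of False s]] by simp_all
    have "s' < (?f d + ?g d) / 2 \<and> (?f d + ?g d) / 2 < t" if "(d, s', t) \<in> node s" for d s' t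
    proof -
      have "s' < ?f d" "?f d < t" "s' < ?g d" "?g d < t" using fg(1,2) that unfolding U_def by blast+
      then show ?thesis by simp
    qed
    then have "(\<lambda>x. (?f x + ?g x) / 2) \<in> U (node s)" unfolding U_def by blast
    moreover have "linear (\<lambda>x. (?f x + ?g x) / 2)"
      by (rule linearI)
        (simp_all add: linear_add[OF fg(3)] linear_add[OF fg(4)] linear_scale[OF fg(3)]
          linear_scale[OF fg(4)] field_simps)
    moreover have "\<bar>(?f x + ?g x) / 2\<bar> \<le> R * norm x" for x
      using b(1)[of x] b(2)[of x] by (simp add: abs_le_iff)
    ultimately show ?case by simp
  qed
  define u where "u n = (\<lambda>(s, x). dyadic_average l (n - length s) s x)" for n
  have u: "\<bar>u n i\<bar> \<le> R * norm (snd i)" for n i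
    using avg by (auto simp: u_def split: prod.split)
  from bounded_functions_cluster[of u "\<lambda>i. R * norm (snd i)", OF u]
  obtain F v where F: "F \<noteq> bot" "F \<le> sequentially" and v: "\<forall>i. ((\<lambda>n. u n i) \<longlongrightarrow> v i) F"
    by (elim exE conjE)
  define w where "w s x = v (s, x)" for s x
  have lim: "((\<lambda>n. dyadic_average l (n - length s) s x) \<longlongrightarrow> w s x) F" for s x
    using spec[OF v, of "(s, x)"] by (simp add: u_def w_def)
  show False
  proof (rule asplund_no_dyadic_tree[OF asplund, of w R \<epsilon> "\<lambda>s. wt (node s)"])
    fix s
    show "linear (w s)" by (rule linear_pointwise_limit[OF F(1) lim]) (use avg in blast)
    have dir: "dyadic_average l n (True # s) (wt (node s)) - dyadic_average l m (False # s) (wt (node s))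
        \<ge> \<epsilon> * norm (wt (node s))" for n m
    proof (rule step(6)[OF good_node[of s]])
      show "dyadic_average l n (True # s) \<in> U (L (node s))"
        using avg[of n "True # s"] by (simp add: node)
      show "dyadic_average l m (False # s) \<in> U (R' (node s))"
        using avg[of m "False # s"] by (simp add: node)
    qed
    show "w (True # s) (wt (node s)) - w (False # s) (wt (node s)) \<ge> \<epsilon> * norm (wt (node s))"
      by (rule tendsto_lowerbound[OF tendsto_diff[OF lim lim] _ F(1)]) (use dir in simp)
    show "wt (node s) \<noteq> 0" using step(1) good_node by blast
  next
    fix s x
    show "\<bar>w s x\<bar> \<le> R * norm x"
      by (rule tendsto_upperbound[OF tendsto_rabs[OF lim] _ F(1)]) (use avg in simp)
    have "eventually (\<lambda>n. n > length s) F"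
      using F(2) eventually_gt_at_top[of "length s"] by (rule filter_leD)
    then have "eventually (\<lambda>n. (dyadic_average l (n - length (True # s)) (True # s) x +
        dyadic_average l (n - length (False # s)) (False # s) x) / 2 =
        dyadic_average l (n - length s) s x) F"
    proof eventually_elim
      case (elim n)
      then have "n - length s = Suc (n - Suc (length s))" by simp
      then show ?case by simp
    qed
    moreover have "((\<lambda>n. (dyadic_average l (n - length (True # s)) (True # s) x +
        dyadic_average l (n - length (False # s)) (False # s) x) / 2) \<longlongrightarrow>
        (w (True # s) x + w (False # s) x) / 2) F"
      by (intro tendsto_intros lim) simp
    ultimately have "((\<lambda>n. dyadic_average l (n - length s) s x) \<longlongrightarrow>
        (w (True # s) x + w (False # s) x) / 2) F"
      by (rule Lim_transform_eventually[rotated])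
    then show "w s x = (w (True # s) x + w (False # s) x) / 2"
      by (rule tendsto_unique[OF F(1) lim])
  qed (use R \<epsilon> in auto)
qed

text \<open>
  Balls around a maximal separated set cover, and such a set is countable. Covers by countably
  many small sets are preferred to dense sequences because they can be multiplied and restricted.
\<close>

lemma asplund_dual_cover:
  fixes D :: "'a::banach set"
  assumes asplund: "asplund_space TYPE('a)" and D: "countable D" and R: "R \<ge> 0" and \<epsilon>: "\<epsilon> > 0"
  shows "\<exists>\<C>. countable \<C> \<and> {f. linear f \<and> (\<forall>x. \<bar>f x\<bar> \<le> R * norm x)} \<subseteq> \<Union>\<C> \<and>
    (\<forall>C\<in>\<C>. \<forall>f\<in>C. \<forall>g\<in>C. \<forall>d\<in>D. \<bar>f d - g d\<bar> \<le> \<epsilon> * norm d)"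
proof -
  define K where "K = {f::'a \<Rightarrow> real. linear f \<and> (\<forall>x. \<bar>f x\<bar> \<le> R * norm x)}"
  define far where "far f g \<longleftrightarrow> (\<exists>d\<in>D. \<bar>f d - g d\<bar> > \<epsilon> / 2 * norm d)" for f g :: "'a \<Rightarrow> real"
  define \<M> where "\<M> = {M. M \<subseteq> K \<and> (\<forall>f\<in>M. \<forall>g\<in>M. f \<noteq> g \<longrightarrow> far f g)}"
  have "\<exists>M\<in>\<M>. \<forall>X\<in>\<M>. M \<subseteq> X \<longrightarrow> X = M"
  proof (rule subset_Zorn')
    fix \<C> assume "subset.chain \<M> \<C>"
    then have c: "\<C> \<subseteq> \<M>" "\<And>X Y. X \<in> \<C> \<Longrightarrow> Y \<in> \<C> \<Longrightarrow> X \<subseteq> Y \<or> Y \<subseteq> X"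
      by (auto simp: subset_chain_def)
    have "far f g" if fg: "f \<in> \<Union>\<C>" "g \<in> \<Union>\<C>" "f \<noteq> g" for f g
    proof -
      obtain X Y where XY: "X \<in> \<C>" "f \<in> X" "Y \<in> \<C>" "g \<in> Y" using fg by blast
      then obtain Z where "Z \<in> \<C>" "f \<in> Z" "g \<in> Z" using c(2)[of X Y] by blast
      then show ?thesis using c(1) fg(3) unfolding \<M>_def by blast
    qed
    then show "\<Union>\<C> \<in> \<M>" using c(1) unfolding \<M>_def by blast
  qed
  then obtain M where M: "M \<in> \<M>" and max: "\<And>X. X \<in> \<M> \<Longrightarrow> M \<subseteq> X \<Longrightarrow> X = M" by blast
  have "countable M"
  proof (rule asplund_separated_countable[OF asplund D _ _ R])
    show "0 < \<epsilon> / 2" using \<epsilon> by simp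
  qed (use M in \<open>auto simp: \<M>_def K_def far_def\<close>)
  define B where "B g = {f\<in>K. \<forall>d\<in>D. \<bar>f d - g d\<bar> \<le> \<epsilon> / 2 * norm d}" for g
  show ?thesis
  proof (intro exI[of _ "B ` M"] conjI ballI)
    show "countable (B ` M)" using \<open>countable M\<close> by simp
    show "{f. linear f \<and> (\<forall>x. \<bar>f x\<bar> \<le> R * norm x)} \<subseteq> \<Union>(B ` M)"
      unfolding K_def[symmetric]
    proof
      fix f assume f: "f \<in> K"
      show "f \<in> \<Union>(B ` M)"
      proof (cases "f \<in> M")
        case True
        then show ?thesis using f \<epsilon> by (force simp: B_def)
      next
        case False
        then have "insert f M \<notin> \<M>" using max[of "insert f M"] by blast
        moreover have "far g f \<longleftrightarrow> far f g" for g
          unfolding far_def by (simp add: abs_minus_commute)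
        ultimately obtain g where "g \<in> M" "\<not> far f g" using M f unfolding \<M>_def by blast
        then have "f \<in> B g" using f by (auto simp: B_def far_def not_less)
        then show ?thesis using \<open>g \<in> M\<close> by blast
      qed
    qed
    fix C f g d assume "C \<in> B ` M" "f \<in> C" "g \<in> C" "d \<in> D"
    then obtain h where "\<bar>f d - h d\<bar> \<le> \<epsilon> / 2 * norm d" "\<bar>g d - h d\<bar> \<le> \<epsilon> / 2 * norm d"
      unfolding B_def by blast
    then show "\<bar>f d - g d\<bar> \<le> \<epsilon> * norm d" by linarith
  qed
qed

section \<open>Smooth approximation of sublinear functions along a subspace\<close>

text \<open>
  Only the upper half of Frechet differentiability is recorded: at a minimum of \<open>F\<close> over a set it
  already gives the lower bound for \<open>f\<close> on tangential directions, and it adds up over series.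
\<close>

definition upper_frechet ::
    "'z::real_normed_vector set \<Rightarrow> ('z \<Rightarrow> real) \<Rightarrow> 'z \<Rightarrow> ('z \<Rightarrow> real) \<Rightarrow> bool" where
  "upper_frechet Y F x f \<longleftrightarrow> linear f \<and>
     (\<forall>\<eta>>0. \<forall>\<^sub>F h in nhds 0. h \<in> Y \<longrightarrow> F (x + h) \<le> F x + f h + \<eta> * norm h)"

definition linear_minorants :: "('z::real_vector \<Rightarrow> real) \<Rightarrow> ('z \<Rightarrow> real) set" where
  "linear_minorants p = {f. linear f \<and> (\<forall>x. f x \<le> p x)}"

text \<open>
  Separability of \<open>K\<close> for the seminorm of uniform convergence on the unit ball of \<open>Y\<close>.
\<close>

definition seminorm_separable ::
    "'z::real_normed_vector set \<Rightarrow> ('z \<Rightarrow> real) set \<Rightarrow> bool" where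
  "seminorm_separable Y K \<longleftrightarrow> (\<forall>\<epsilon>>0. \<exists>\<C>. countable \<C> \<and> K \<subseteq> \<Union>\<C> \<and>
     (\<forall>C\<in>\<C>. \<forall>f\<in>C. \<forall>g\<in>C. \<forall>y\<in>Y. \<bar>f y - g y\<bar> \<le> \<epsilon> * norm y))"

lemma linear_minorant_abs_le:
  assumes "f \<in> linear_minorants p" "\<And>x. p x \<le> R * norm x"
  shows "\<bar>f x\<bar> \<le> R * norm x"
proof -
  have "f x \<le> R * norm x" "f (- x) \<le> R * norm (- x)"
    using assms unfolding linear_minorants_def by (blast intro: order_trans)+
  moreover have "f (- x) = - f x" using assms by (simp add: linear_minorants_def linear_neg)
  ultimately show ?thesis by (simp add: abs_le_iff)
qed

lemma seminorm_separable_dense_sequence: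
  assumes sep: "seminorm_separable Y K" and ne: "K \<noteq> {}"
  shows "\<exists>e::nat \<Rightarrow> _. range e \<subseteq> K \<and> (\<forall>f\<in>K. \<forall>\<epsilon>>0. \<exists>n. \<forall>y\<in>Y. \<bar>f y - e n y\<bar> \<le> \<epsilon> * norm y)"
proof -
  have "\<forall>k. \<exists>\<C>. countable \<C> \<and> K \<subseteq> \<Union>\<C> \<and>
     (\<forall>C\<in>\<C>. \<forall>f\<in>C. \<forall>g\<in>C. \<forall>y\<in>Y. \<bar>f y - g y\<bar> \<le> 1 / real (Suc k) * norm y)"
  proof
    fix k
    have "1 / real (Suc k) > 0" by simp
    with sep show "\<exists>\<C>. countable \<C> \<and> K \<subseteq> \<Union>\<C> \<and>
     (\<forall>C\<in>\<C>. \<forall>f\<in>C. \<forall>g\<in>C. \<forall>y\<in>Y. \<bar>f y - g y\<bar> \<le> 1 / real (Suc k) * norm y)"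
      unfolding seminorm_separable_def by blast
  qed
  from choice[OF this] obtain \<C> where cover: "\<forall>k. countable (\<C> k) \<and> K \<subseteq> \<Union>(\<C> k) \<and>
     (\<forall>C\<in>\<C> k. \<forall>f\<in>C. \<forall>g\<in>C. \<forall>y\<in>Y. \<bar>f y - g y\<bar> \<le> 1 / real (Suc k) * norm y)"
    by (elim exE)
  have \<C>: "countable (\<C> k)" "K \<subseteq> \<Union>(\<C> k)" for k using cover by blast+
  have small: "\<bar>f y - g y\<bar> \<le> 1 / real (Suc k) * norm y"
    if "C \<in> \<C> k" "f \<in> C" "g \<in> C" "y \<in> Y" for k C f g y
    using cover that by blast
  define E where "E = (\<Union>k. (\<lambda>C. SOME f. f \<in> C \<inter> K) ` {C \<in> \<C> k. C \<inter> K \<noteq> {}})"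
  have some: "(SOME f. f \<in> C \<inter> K) \<in> C \<inter> K" if "C \<inter> K \<noteq> {}" for C
  proof -
    have "\<exists>f. f \<in> C \<inter> K" using that by blast
    then show ?thesis by (rule someI_ex)
  qed
  have "countable E"
    unfolding E_def by (intro countable_UN countable_image) (auto intro: countable_subset[OF _ \<C>(1)])
  have EK: "E \<subseteq> K" using some by (auto simp: E_def)
  have dense: "\<exists>g\<in>E. \<forall>y\<in>Y. \<bar>f y - g y\<bar> \<le> \<epsilon> * norm y" if f: "f \<in> K" and \<epsilon>: "\<epsilon> > 0" for f \<epsilon>
  proof -
    obtain k where k: "1 / real (Suc k) < \<epsilon>" using nat_approx_posE[OF \<epsilon>] by auto
    obtain C where C: "C \<in> \<C> k" "f \<in> C" using \<C>(2)[of k] f by blast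
    define g where "g = (SOME f. f \<in> C \<inter> K)"
    have Cne: "C \<inter> K \<noteq> {}" using C f by blast
    then have g: "g \<in> C" "g \<in> E" using some[OF Cne] C by (auto simp: g_def E_def)
    have "\<bar>f y - g y\<bar> \<le> \<epsilon> * norm y" if "y \<in> Y" for y
    proof -
      have "\<bar>f y - g y\<bar> \<le> 1 / real (Suc k) * norm y" by (rule small[OF C g(1) that])
      also have "\<dots> \<le> \<epsilon> * norm y" using k by (intro mult_right_mono) auto
      finally show ?thesis .
    qed
    then show ?thesis using g(2) by blast
  qed
  obtain f0 where "f0 \<in> K" using ne by blast
  from dense[OF this zero_less_one] have "E \<noteq> {}" by blast
  then have r: "range (from_nat_into E) = E" using \<open>countable E\<close> by (rule range_from_nat_into)
  show ?thesis
  proof (intro exI[of _ "from_nat_into E"] conjI ballI allI impI)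
    fix f and \<epsilon> :: real assume "f \<in> K" "\<epsilon> > 0"
    from dense[OF this] obtain g where g: "g \<in> E" "\<forall>y\<in>Y. \<bar>f y - g y\<bar> \<le> \<epsilon> * norm y" by blast
    have "g \<in> range (from_nat_into E)" using g(1) by (simp only: r)
    then obtain n where "g = from_nat_into E n" by blast
    then show "\<exists>n. \<forall>y\<in>Y. \<bar>f y - from_nat_into E n y\<bar> \<le> \<epsilon> * norm y"
      using g(2) by (intro exI[of _ n]) simp
  qed (use r EK in blast)
qed

text \<open>
  The last clause gives, at every point, a derivative from above that is a functional below \<open>p\<close> and almost
  attains \<open>p x\<close>. In this way a gradient of the approximant stays as steep as one of \<open>p\<close>.
\<close>

definition smooth_approximant ::
    "'z::real_normed_vector set \<Rightarrow> ('z \<Rightarrow> real) \<Rightarrow> real \<Rightarrow> ('z \<Rightarrow> real) \<Rightarrow> bool" where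
  "smooth_approximant Y p \<kappa> \<theta> \<longleftrightarrow> (\<forall>x. p x - \<kappa> \<le> \<theta> x \<and> \<theta> x \<le> p x) \<and> (\<forall>x y. \<theta> x \<le> \<theta> y + p (x - y)) \<and>
    (\<forall>x. \<exists>f \<in> linear_minorants p. upper_frechet Y \<theta> x f \<and> f x \<ge> p x - \<kappa>)"

text \<open>
  Let \<open>q n f\<close> be the distance of \<open>f\<close> on the unit ball of \<open>Y\<close> to the \<open>n\<close>-th member \<open>e n\<close> of a dense
  sequence, and \<open>G f\<close> a weighted sum of the squares of these distances. Then \<open>\<theta> x\<close> is the supremum of \<open>f x - G f\<close>.
  By the parallelogram inequality for each square, near-maximizers \<open>f\<close> and \<open>g\<close> have almost the same
  distance to every \<open>e n\<close>. If \<open>f\<close> is an exact maximizer and \<open>e n\<close> is close to it, then \<open>g\<close> is close to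
  \<open>e n\<close>, hence to \<open>f\<close>. This stability of maximizers gives the derivative.
\<close>

theorem smooth_approximation:
  fixes p :: "'z::real_normed_vector \<Rightarrow> real"
  assumes p: "sublinear p" and pR: "\<And>x. p x \<le> R * norm x" and R: "R \<ge> 0"
    and Y: "subspace Y" and sep: "seminorm_separable Y (linear_minorants p)" and \<kappa>: "\<kappa> > 0"
  shows "\<exists>\<theta>. smooth_approximant Y p \<kappa> \<theta>"
proof -
  define K where "K = linear_minorants p"
  have Kne: "K \<noteq> {}" using hahn_banach_sublinear[OF p] by (auto simp: K_def linear_minorants_def)
  have KI: "f \<in> K" if "linear f" "\<And>x. f x \<le> p x" for f
    using that by (simp add: K_def linear_minorants_def)
  have Klin: "linear f" and Kp: "f x \<le> p x" if "f \<in> K" for f x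
    using that by (simp_all add: K_def linear_minorants_def)
  have KR: "\<bar>f x\<bar> \<le> R * norm x" if "f \<in> K" for f x
    using linear_minorant_abs_le[of f p R x] that pR by (simp add: K_def)
  obtain e :: "nat \<Rightarrow> 'z \<Rightarrow> real" where e: "range e \<subseteq> K"
    and e_dense: "\<forall>f\<in>K. \<forall>\<epsilon>>0. \<exists>n. \<forall>y\<in>Y. \<bar>f y - e n y\<bar> \<le> \<epsilon> * norm y"
    using seminorm_separable_dense_sequence[OF sep[folded K_def] Kne] by blast
  have eK: "e n \<in> K" for n using e by blast
  have dense: "\<exists>n. \<forall>y\<in>Y. \<bar>f y - e n y\<bar> \<le> \<epsilon> * norm y" if "f \<in> K" "\<epsilon> > 0" for f \<epsilon>
    using e_dense that by blast
  define Y1 where "Y1 = {y \<in> Y. norm y \<le> 1}"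
  have Y1ne: "0 \<in> Y1" using subspace_0[OF Y] by (simp add: Y1_def)
  define q where "q n f = (SUP y\<in>Y1. \<bar>f y - e n y\<bar>)" for n and f :: "'z \<Rightarrow> real"
  have diff_le: "\<bar>f y - e n y\<bar> \<le> 2 * R" if "f \<in> K" "y \<in> Y1" for f n y
  proof -
    have "R * norm y \<le> R" using that R by (simp add: Y1_def mult_left_le)
    then show ?thesis using KR[OF that(1), of y] KR[OF eK, of n y] by linarith
  qed
  have bdd: "bdd_above ((\<lambda>y. \<bar>f y - e n y\<bar>) ` Y1)" if "f \<in> K" for f n
    using diff_le[OF that] by (intro bdd_aboveI[where M = "2 * R"]) auto
  have q_upper: "\<bar>f y - e n y\<bar> \<le> q n f" if "f \<in> K" "y \<in> Y1" for f y n
    unfolding q_def by (rule cSUP_upper[OF that(2) bdd[OF that(1)]])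
  have q_least: "q n f \<le> M" if "\<And>y. y \<in> Y1 \<Longrightarrow> \<bar>f y - e n y\<bar> \<le> M" for n f M
    unfolding q_def using Y1ne that by (intro cSUP_least) auto
  have q_0: "0 \<le> q n f" and q_2R: "q n f \<le> 2 * R" if "f \<in> K" for n f
    using q_upper[OF that Y1ne, of n] q_least[of f n] diff_le[OF that] by fastforce+
  have q_scaled: "\<bar>f y - e n y\<bar> \<le> q n f * norm y" if f: "f \<in> K" and y: "y \<in> Y" for f n y
  proof (cases "y = 0")
    case True
    then show ?thesis using linear_0[OF Klin[OF f]] linear_0[OF Klin[OF eK]] by simp
  next
    case False
    have "(1 / norm y) *\<^sub>R y \<in> Y1" using subspace_scale[OF Y y] False by (simp add: Y1_def)
    from q_upper[OF f this, of n] have "\<bar>(1 / norm y) * (f y - e n y)\<bar> \<le> q n f"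
      using linear_scale[OF Klin[OF f]] linear_scale[OF Klin[OF eK]] by (simp add: right_diff_distrib)
    then show ?thesis using False by (simp add: abs_mult field_simps)
  qed
  \<comment> \<open>the distances are at most \<open>2 * R\<close>, so these weights give \<open>0 \<le> G f \<le> \<kappa>\<close>\<close>
  define c where "c n = \<kappa> / (1 + 4 * R\<^sup>2) * (1 / 2) ^ Suc n" for n
  have c_pos: "c n > 0" for n using \<kappa> by (simp add: c_def add_pos_nonneg)
  have c_sums: "(\<lambda>n. c n * (4 * R\<^sup>2)) sums (\<kappa> / (1 + 4 * R\<^sup>2) * (4 * R\<^sup>2))"
    using sums_mult2[OF sums_mult[OF power_half_series, of "\<kappa> / (1 + 4 * R\<^sup>2)"], of "4 * R\<^sup>2"]
    by (simp add: c_def)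
  have "\<kappa> * (4 * R\<^sup>2) \<le> \<kappa> * (1 + 4 * R\<^sup>2)" using \<kappa> by (intro mult_left_mono) auto
  then have c_total: "\<kappa> / (1 + 4 * R\<^sup>2) * (4 * R\<^sup>2) \<le> \<kappa>"
    by (simp add: divide_le_eq add_pos_nonneg)
  define G where "G f = (\<Sum>n. c n * (q n f)\<^sup>2)" for f
  have term_le: "c n * (q n f)\<^sup>2 \<le> c n * (4 * R\<^sup>2)" if "f \<in> K" for n f
  proof -
    have "(q n f)\<^sup>2 \<le> (2 * R)\<^sup>2" by (intro power_mono q_2R q_0 that)
    then show ?thesis using c_pos[of n] by (simp add: power_mult_distrib)
  qed
  have term_0: "0 \<le> c n * (q n f)\<^sup>2" for n f using c_pos[of n] by simp
  have summ: "summable (\<lambda>n. c n * (q n f)\<^sup>2)" if "f \<in> K" for f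
    by (rule summable_comparison_test'[OF sums_summable[OF c_sums]])
      (use term_le[OF that] term_0 in \<open>simp\<close>)
  have G_0: "0 \<le> G f" if "f \<in> K" for f
    unfolding G_def by (rule suminf_nonneg[OF summ[OF that]]) (rule term_0)
  have G_\<kappa>: "G f \<le> \<kappa>" if "f \<in> K" for f
  proof -
    have "G f \<le> (\<Sum>n. c n * (4 * R\<^sup>2))"
      unfolding G_def by (rule suminf_le[OF term_le[OF that] summ[OF that] sums_summable[OF c_sums]])
    then show ?thesis using c_total sums_unique[OF c_sums] by simp
  qed
  define J where "J x f = f x - G f" for x :: 'z and f
  define \<theta> where "\<theta> x = (SUP f\<in>K. J x f)" for x
  have J_p: "J x f \<le> p x" if "f \<in> K" for f x using Kp[OF that, of x] G_0[OF that] by (simp add: J_def)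
  have J_bdd: "bdd_above (J x ` K)" for x using J_p by (intro bdd_aboveI[where M = "p x"]) auto
  have J_le: "J x f \<le> \<theta> x" if "f \<in> K" for f x
    unfolding \<theta>_def by (rule cSUP_upper[OF that J_bdd])
  have \<theta>_least: "\<theta> x \<le> M" if "\<And>f. f \<in> K \<Longrightarrow> J x f \<le> M" for x M
    unfolding \<theta>_def using that by (rule cSUP_least[OF Kne])
  have \<theta>_lower: "p x - \<kappa> \<le> \<theta> x" for x
  proof -
    obtain f where "linear f" "\<And>z. f z \<le> p z" "f x = p x" using hahn_banach_attained[OF p, where x = x] by blast
    then have "f \<in> K" "f x = p x" using KI by auto
    then show ?thesis using J_le[of f x] G_\<kappa>[of f] by (simp add: J_def)
  qed
  have \<theta>_lip: "\<theta> x \<le> \<theta> y + p (x - y)" for x y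
  proof (rule \<theta>_least)
    fix f assume f: "f \<in> K"
    have "f x = f y + f (x - y)" using linear_diff[OF Klin[OF f], of x y] by simp
    then show "J x f \<le> \<theta> y + p (x - y)" using Kp[OF f, of "x - y"] J_le[OF f, of y] by (simp add: J_def)
  qed
  \<comment> \<open>weak* compactness of \<open>K\<close> and lower semicontinuity of \<open>G\<close>, a supremum of finite sums \<open>\<Sum>n<N. c n * (f (y n) - e n (y n))\<^sup>2\<close>\<close>
  have maximizer: "\<exists>f\<in>K. J x f = \<theta> x" for x
  proof -
    have "\<forall>k. \<exists>f\<in>K. J x f > \<theta> x - 1 / real (Suc k)"
    proof
      fix k
      have "\<theta> x - 1 / real (Suc k) < (SUP f\<in>K. J x f)" unfolding \<theta>_def by simp
      then show "\<exists>f\<in>K. J x f > \<theta> x - 1 / real (Suc k)" using less_cSUP_iff[OF Kne J_bdd] by blast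
    qed
    then have "\<forall>k. \<exists>f. f \<in> K \<and> J x f > \<theta> x - 1 / real (Suc k)" by blast
    from choice[OF this] obtain fs where "\<forall>k. fs k \<in> K \<and> J x (fs k) > \<theta> x - 1 / real (Suc k)"
      by (elim exE)
    then have fs: "fs k \<in> K" "J x (fs k) > \<theta> x - 1 / real (Suc k)" for k by simp_all
    have "\<bar>fs k i\<bar> \<le> R * norm i" for k i by (rule KR[OF fs(1)])
    from bounded_functions_cluster[of fs "\<lambda>i. R * norm i", OF this]
    obtain F f where F: "F \<noteq> bot" "F \<le> sequentially" and f_lim: "\<forall>i. ((\<lambda>k. fs k i) \<longlongrightarrow> f i) F"
      by (elim exE conjE)
    have lim: "((\<lambda>k. fs k i) \<longlongrightarrow> f i) F" for i using f_lim by simp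
    have fK: "f \<in> K"
    proof (rule KI)
      show "linear f" by (rule linear_pointwise_limit[OF F(1) lim Klin[OF fs(1)]])
      show "f i \<le> p i" for i
        by (rule tendsto_upperbound[OF lim _ F(1)]) (use Kp[OF fs(1)] in simp)
    qed
    have null: "((\<lambda>k. 1 / real (Suc k)) \<longlongrightarrow> 0) F"
      by (rule tendsto_mono[OF F(2)]) (rule LIMSEQ_Suc[OF lim_1_over_n])
    have partial: "(\<Sum>n<N. c n * (f (y n) - e n (y n))\<^sup>2) \<le> f x - \<theta> x" if y: "\<And>n. y n \<in> Y1" for N y
    proof (rule tendsto_le[OF F(1)])
      show "((\<lambda>k. \<Sum>n<N. c n * (fs k (y n) - e n (y n))\<^sup>2) \<longlongrightarrow> (\<Sum>n<N. c n * (f (y n) - e n (y n))\<^sup>2)) F"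
        by (intro tendsto_intros lim)
      show "((\<lambda>k. fs k x - \<theta> x + 1 / real (Suc k)) \<longlongrightarrow> f x - \<theta> x) F"
        using tendsto_add[OF tendsto_diff[OF lim tendsto_const] null, of x "\<theta> x"] by simp
      have "(\<Sum>n<N. c n * (fs k (y n) - e n (y n))\<^sup>2) \<le> fs k x - \<theta> x + 1 / real (Suc k)" for k
      proof -
        have "(\<Sum>n<N. c n * (fs k (y n) - e n (y n))\<^sup>2) \<le> (\<Sum>n<N. c n * (q n (fs k))\<^sup>2)"
        proof (intro sum_mono mult_left_mono)
          show "(fs k (y n) - e n (y n))\<^sup>2 \<le> (q n (fs k))\<^sup>2" for n
            using q_upper[OF fs(1) y, of k n n] by (intro abs_le_square_iff[THEN iffD1]) simp
        qed (use c_pos less_imp_le in blast)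
        also have "\<dots> \<le> G (fs k)"
          unfolding G_def by (rule sum_le_suminf[OF summ[OF fs(1)]]) (use term_0 in auto)
        finally show ?thesis using fs(2)[of k] by (simp add: J_def)
      qed
      then show "\<forall>\<^sub>F k in F. (\<Sum>n<N. c n * (fs k (y n) - e n (y n))\<^sup>2) \<le> fs k x - \<theta> x + 1 / real (Suc k)"
        by (rule always_eventually[OF allI])
    qed
    have "(\<Sum>n<N. c n * (q n f)\<^sup>2) \<le> f x - \<theta> x" for N
    proof (rule field_le_mult_one_interval)
      fix z :: real assume z: "0 < z" "z < 1"
      have "\<forall>n. \<exists>y. y \<in> Y1 \<and> z * (q n f)\<^sup>2 \<le> (f y - e n y)\<^sup>2"
      proof
        fix n
        show "\<exists>y. y \<in> Y1 \<and> z * (q n f)\<^sup>2 \<le> (f y - e n y)\<^sup>2"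
        proof (cases "q n f = 0")
          case True
          then show ?thesis using Y1ne by auto
        next
          case False
          then have "q n f > 0" using q_0[OF fK, of n] by simp
          then have "sqrt z * q n f < (SUP y\<in>Y1. \<bar>f y - e n y\<bar>)"
            using z by (simp add: q_def[symmetric] real_sqrt_lt_1_iff)
          then obtain y where y: "y \<in> Y1" "sqrt z * q n f < \<bar>f y - e n y\<bar>"
            using less_cSUP_iff[OF _ bdd[OF fK]] Y1ne by blast
          have "(sqrt z * q n f)\<^sup>2 \<le> \<bar>f y - e n y\<bar>\<^sup>2"
            using y(2) z q_0[OF fK, of n] by (intro power_mono) auto
          then show ?thesis using y(1) z by (auto simp: power_mult_distrib)
        qed
      qed
      from choice[OF this] obtain y where "\<forall>n. y n \<in> Y1 \<and> z * (q n f)\<^sup>2 \<le> (f (y n) - e n (y n))\<^sup>2"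
        by (elim exE)
      then have y: "y n \<in> Y1" "z * (q n f)\<^sup>2 \<le> (f (y n) - e n (y n))\<^sup>2" for n by simp_all
      have "z * (\<Sum>n<N. c n * (q n f)\<^sup>2) = (\<Sum>n<N. c n * (z * (q n f)\<^sup>2))"
        by (simp add: sum_distrib_left mult.left_commute)
      also have "\<dots> \<le> (\<Sum>n<N. c n * (f (y n) - e n (y n))\<^sup>2)"
        using y(2) c_pos by (intro sum_mono mult_left_mono) (auto intro: less_imp_le)
      also have "\<dots> \<le> f x - \<theta> x" by (rule partial[OF y(1)])
      finally show "z * (\<Sum>n<N. c n * (q n f)\<^sup>2) \<le> f x - \<theta> x" .
    qed
    then have "G f \<le> f x - \<theta> x" unfolding G_def by (rule suminf_le_const[OF summ[OF fK]])
    then have "J x f = \<theta> x" using J_le[OF fK, of x] by (simp add: J_def)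
    then show ?thesis using fK by blast
  qed
  have stable: "\<exists>\<nu>>0. \<forall>g\<in>K. J x g \<ge> \<theta> x - \<nu> \<longrightarrow> (\<forall>y\<in>Y. \<bar>g y - f y\<bar> \<le> \<eta> * norm y)"
    if f: "f \<in> K" "J x f = \<theta> x" and \<eta>: "\<eta> > 0" for x f \<eta>
  proof -
    obtain n where n: "\<forall>y\<in>Y. \<bar>f y - e n y\<bar> \<le> \<eta> / 4 * norm y" using dense[OF f(1), of "\<eta> / 4"] \<eta> by auto
    have qf: "q n f \<le> \<eta> / 4"
    proof (rule q_least)
      fix y assume "y \<in> Y1"
      then have "\<bar>f y - e n y\<bar> \<le> \<eta> / 4 * norm y" "\<eta> / 4 * norm y \<le> \<eta> / 4"
        using n \<eta> by (auto simp: Y1_def)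
      then show "\<bar>f y - e n y\<bar> \<le> \<eta> / 4" by linarith
    qed
    \<comment> \<open>the parallelogram inequality bounds \<open>c n * (q n f - q n g)\<^sup>2\<close> by \<open>2 * \<nu> = c n * (\<eta> / 4)\<^sup>2\<close>\<close>
    define \<nu> where "\<nu> = c n * \<eta>\<^sup>2 / 32"
    have \<nu>: "\<nu> > 0" using c_pos[of n] \<eta> by (simp add: \<nu>_def)
    have "\<bar>g y - f y\<bar> \<le> \<eta> * norm y" if g: "g \<in> K" "J x g \<ge> \<theta> x - \<nu>" and y: "y \<in> Y" for g y
    proof -
      define m where "m = (\<lambda>z. (f z + g z) / 2)"
      have lin: "linear f" "linear g" using Klin f(1) g(1) by auto
      have mK: "m \<in> K"
      proof (rule KI)
        show "linear m"
          unfolding m_def by (rule linearI)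
            (simp_all add: linear_add[OF lin(1)] linear_add[OF lin(2)] linear_scale[OF lin(1)]
              linear_scale[OF lin(2)] field_simps)
        show "m z \<le> p z" for z using Kp[OF f(1), of z] Kp[OF g(1), of z] by (simp add: m_def)
      qed
      define D where "D = c n / 4 * (q n f - q n g)\<^sup>2"
      have qm: "q k m \<le> (q k f + q k g) / 2" for k
      proof (rule q_least)
        fix z assume z: "z \<in> Y1"
        have "2 * (m z - e k z) = (f z - e k z) + (g z - e k z)" by (simp add: m_def field_simps)
        then show "\<bar>m z - e k z\<bar> \<le> (q k f + q k g) / 2"
          using q_upper[OF f(1) z, of k] q_upper[OF g(1) z, of k] unfolding abs_le_iff by argo
      qed
      have comp: "c k * (q k m)\<^sup>2 \<le> (c k * (q k f)\<^sup>2 + c k * (q k g)\<^sup>2) / 2 - (if k = n then D else 0)" for k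
      proof -
        have "(q k m)\<^sup>2 \<le> ((q k f + q k g) / 2)\<^sup>2" by (intro power_mono qm q_0 mK)
        also have "\<dots> = ((q k f)\<^sup>2 + (q k g)\<^sup>2) / 2 - (q k f - q k g)\<^sup>2 / 4"
          by (simp add: power2_eq_square field_simps)
        finally have "c k * (q k m)\<^sup>2 \<le> c k * (((q k f)\<^sup>2 + (q k g)\<^sup>2) / 2 - (q k f - q k g)\<^sup>2 / 4)"
          using c_pos[of k] by (intro mult_left_mono) auto
        also have "\<dots> = (c k * (q k f)\<^sup>2 + c k * (q k g)\<^sup>2) / 2 - c k / 4 * (q k f - q k g)\<^sup>2"
          by (simp add: field_simps)
        also have "\<dots> \<le> (c k * (q k f)\<^sup>2 + c k * (q k g)\<^sup>2) / 2 - (if k = n then D else 0)"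
          using c_pos[of k] by (simp add: D_def)
        finally show ?thesis .
      qed
      have S: "(\<lambda>k. (c k * (q k f)\<^sup>2 + c k * (q k g)\<^sup>2) / 2 - (if k = n then D else 0)) sums ((G f + G g) / 2 - D)"
        unfolding G_def
        by (intro sums_diff sums_divide sums_add summable_sums summ f(1) g(1)) (rule sums_single)
      have "G m \<le> (G f + G g) / 2 - D"
        unfolding G_def[of m] by (rule sums_le[OF comp summable_sums[OF summ[OF mK]] S])
      then have "2 * G m \<le> G f + G g - 2 * D" by (simp add: field_simps)
      moreover have "m x - G m \<le> \<theta> x" using J_le[OF mK, of x] by (simp add: J_def)
      moreover have "f x - G f = \<theta> x" "g x - G g \<ge> \<theta> x - \<nu>" using f(2) g(2) by (simp_all add: J_def)
      moreover have "2 * m x = f x + g x" by (simp add: m_def)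
      ultimately have "2 * D \<le> \<nu>" by linarith
      then have "c n * (q n f - q n g)\<^sup>2 \<le> c n * (\<eta> / 4)\<^sup>2"
        by (simp add: D_def \<nu>_def power_divide)
      then have "(q n f - q n g)\<^sup>2 \<le> (\<eta> / 4)\<^sup>2" using c_pos[of n] by simp
      then have "\<bar>q n f - q n g\<bar> \<le> \<eta> / 4" using \<eta> abs_le_square_iff[of "q n f - q n g" "\<eta> / 4"] by simp
      then have "q n g - q n f \<le> \<eta> / 4" unfolding abs_le_iff by simp
      then have "q n g \<le> \<eta> / 2" using qf by simp
      then have "q n g * norm y \<le> \<eta> / 2 * norm y" by (rule mult_right_mono) simp
      moreover have "q n f * norm y \<le> \<eta> / 4 * norm y" using qf by (rule mult_right_mono) simp
      moreover have "\<eta> / 2 * norm y + \<eta> / 4 * norm y \<le> \<eta> * norm y" using \<eta> by simp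
      ultimately show ?thesis using q_scaled[OF f(1) y, of n] q_scaled[OF g(1) y, of n] by linarith
    qed
    then show ?thesis using \<nu> by blast
  qed
  have "\<exists>f\<in>K. upper_frechet Y \<theta> x f \<and> f x \<ge> p x - \<kappa>" for x
  proof -
    obtain f where f: "f \<in> K" "J x f = \<theta> x" using maximizer by blast
    have "f x \<ge> p x - \<kappa>" using f G_0[OF f(1)] \<theta>_lower[of x] by (simp add: J_def)
    moreover have "\<forall>\<^sub>F h in nhds 0. h \<in> Y \<longrightarrow> \<theta> (x + h) \<le> \<theta> x + f h + \<eta> * norm h" if \<eta>: "\<eta> > 0" for \<eta>
    proof -
      obtain \<nu> where \<nu>: "\<nu> > 0"
        and st: "\<And>g y. g \<in> K \<Longrightarrow> J x g \<ge> \<theta> x - \<nu> \<Longrightarrow> y \<in> Y \<Longrightarrow> \<bar>g y - f y\<bar> \<le> \<eta> * norm y"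
        using stable[OF f \<eta>] by blast
      have "\<theta> (x + h) \<le> \<theta> x + f h + \<eta> * norm h" if h: "norm h < \<nu> / (2 * R + 1)" "h \<in> Y" for h
      proof -
        obtain g where g: "g \<in> K" "J (x + h) g = \<theta> (x + h)" using maximizer by blast
        have ghx: "J (x + h) g = J x g + g h" by (simp add: J_def linear_add[OF Klin[OF g(1)]])
        have "(2 * R + 1) * norm h < \<nu>" using h(1) R by (simp add: field_simps)
        then have "2 * (R * norm h) + norm h < \<nu>" by (simp add: algebra_simps)
        then have small: "2 * (R * norm h) \<le> \<nu>" using norm_ge_zero[of h] by linarith
        have "\<theta> x \<le> \<theta> (x + h) + R * norm h"
          using \<theta>_lip[of x "x + h"] pR[of "- h"] by simp
        moreover have "g h \<le> R * norm h" using KR[OF g(1), of h] by simp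
        ultimately have "J x g \<ge> \<theta> x - \<nu>" using small g(2) ghx by linarith
        then have "\<bar>g h - f h\<bar> \<le> \<eta> * norm h" using st g(1) h(2) by blast
        then show ?thesis using J_le[OF g(1), of x] g(2) ghx by linarith
      qed
      moreover have "\<nu> / (2 * R + 1) > 0" using \<nu> R by simp
      ultimately show ?thesis unfolding eventually_nhds_metric by (auto simp: dist_norm)
    qed
    then have "upper_frechet Y \<theta> x f" using Klin[OF f(1)] by (simp add: upper_frechet_def)
    ultimately show ?thesis using f(1) by blast
  qed
  moreover have "\<theta> x \<le> p x" for x using J_p by (rule \<theta>_least)
  ultimately show ?thesis
    unfolding smooth_approximant_def K_def[symmetric] using \<theta>_lower \<theta>_lip by (intro exI[of _ \<theta>] conjI allI)
qed

section \<open>The Borwein-Preiss variational principle\<close>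

text \<open>
  Finitely many terms are controlled by their own derivatives, and the tail by the common Lipschitz
  constant.
\<close>

lemma upper_frechet_sum:
  fixes p :: "'z::real_normed_vector \<Rightarrow> real"
  assumes pR: "\<And>x. p x \<le> R * norm x" and R: "R \<ge> 0"
    and \<mu>: "\<And>i. \<mu> i \<ge> 0" "summable \<mu>"
    and lip: "\<And>i x y. \<theta> i x \<le> \<theta> i y + p (x - y)"
    and summ: "\<And>x. summable (\<lambda>i. \<mu> i * \<theta> i (x - a i))"
    and f: "\<And>i. f i \<in> linear_minorants p" "\<And>i. upper_frechet Y (\<theta> i) (x - a i) (f i)"
  shows "upper_frechet Y (\<lambda>x. \<Sum>i. \<mu> i * \<theta> i (x - a i)) x (\<lambda>z. \<Sum>i. \<mu> i * f i z)"
    and "(\<Sum>i. \<mu> i * f i z) \<le> suminf \<mu> * p z"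
proof -
  have fR: "\<bar>f i z\<bar> \<le> R * norm z" for i z by (rule linear_minorant_abs_le[OF f(1) pR])
  have lin: "linear (f i)" and fp: "f i z \<le> p z" for i z using f(1) by (simp_all add: linear_minorants_def)
  have fsum: "summable (\<lambda>i. \<mu> i * f i z)" for z
  proof (rule summable_comparison_test'[OF summable_mult2[OF \<mu>(2), of "R * norm z"]])
    show "norm (\<mu> i * f i z) \<le> \<mu> i * (R * norm z)" for i
      using fR[of i z] \<mu>(1)[of i] by (simp add: abs_mult mult_left_mono)
  qed
  have "(\<Sum>i. \<mu> i * f i z) \<le> (\<Sum>i. \<mu> i * p z)" for z
    by (rule suminf_le[OF _ fsum summable_mult2[OF \<mu>(2)]]) (simp add: mult_left_mono fp \<mu>)
  then show "(\<Sum>i. \<mu> i * f i z) \<le> suminf \<mu> * p z" by (simp add: suminf_mult2[OF \<mu>(2)])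
  show "upper_frechet Y (\<lambda>x. \<Sum>i. \<mu> i * \<theta> i (x - a i)) x (\<lambda>z. \<Sum>i. \<mu> i * f i z)"
    unfolding upper_frechet_def
  proof (intro conjI allI impI)
    show "linear (\<lambda>z. \<Sum>i. \<mu> i * f i z)"
    proof (rule linearI)
      show "(\<Sum>i. \<mu> i * f i (u + v)) = (\<Sum>i. \<mu> i * f i u) + (\<Sum>i. \<mu> i * f i v)" for u v
        by (simp add: suminf_add[OF fsum fsum] linear_add[OF lin] distrib_left)
      show "(\<Sum>i. \<mu> i * f i (c *\<^sub>R u)) = c *\<^sub>R (\<Sum>i. \<mu> i * f i u)" for c u
        using suminf_mult[OF fsum, of c u] by (simp add: linear_scale[OF lin] mult.left_commute)
    qed
    fix \<eta> :: real assume \<eta>: "\<eta> > 0"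
    define M where "M = suminf \<mu>"
    have M: "M \<ge> 0" unfolding M_def by (rule suminf_nonneg[OF \<mu>(2,1)])
    define \<eta>' where "\<eta>' = \<eta> / (2 * (M + 1))"
    have \<eta>': "\<eta>' > 0" using \<eta> M by (simp add: \<eta>'_def)
    have M\<eta>': "M * \<eta>' \<le> \<eta> / 2" using \<eta> M by (simp add: \<eta>'_def field_simps)
    have "\<eta> / (4 * (R + 1)) > 0" using \<eta> R by simp
    then obtain N where N: "norm (\<Sum>i. \<mu> (i + N)) < \<eta> / (4 * (R + 1))"
      using suminf_exist_split[OF _ \<mu>(2)] by blast
    have "(\<Sum>i. \<mu> (i + N)) * (2 * R) \<le> \<eta> / (4 * (R + 1)) * (2 * R)"
      using N R by (intro mult_right_mono) auto
    also have "\<dots> \<le> \<eta> / 2" using \<eta> R by (simp add: field_simps)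
    finally have tail: "(\<Sum>i. \<mu> (i + N)) * (2 * R) \<le> \<eta> / 2" .
    have ev: "\<forall>\<^sub>F h in nhds 0. \<forall>i\<in>{..<N}. h \<in> Y \<longrightarrow>
        \<theta> i (x - a i + h) \<le> \<theta> i (x - a i) + f i h + \<eta>' * norm h"
      using f(2) \<eta>' unfolding upper_frechet_def by (intro eventually_ball_finite) auto
    then show "\<forall>\<^sub>F h in nhds 0. h \<in> Y \<longrightarrow> (\<Sum>i. \<mu> i * \<theta> i (x + h - a i))
        \<le> (\<Sum>i. \<mu> i * \<theta> i (x - a i)) + (\<Sum>i. \<mu> i * f i h) + \<eta> * norm h"
    proof eventually_elim
      case (elim h)
      show ?case
      proof
        assume h: "h \<in> Y"
        define t where "t i = \<mu> i * (\<theta> i (x + h - a i) - \<theta> i (x - a i) - f i h)" for i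
        have t_eq: "t = (\<lambda>i. \<mu> i * \<theta> i (x + h - a i) - \<mu> i * \<theta> i (x - a i) - \<mu> i * f i h)"
          unfolding t_def right_diff_distrib ..
        have t_sum: "summable t" unfolding t_eq by (intro summable_diff summ fsum)
        have "suminf t = (\<Sum>i. \<mu> i * \<theta> i (x + h - a i)) - (\<Sum>i. \<mu> i * \<theta> i (x - a i)) - (\<Sum>i. \<mu> i * f i h)"
          unfolding t_eq suminf_diff[OF summable_diff[OF summ summ] fsum, symmetric]
            suminf_diff[OF summ summ, symmetric] ..
        moreover have "suminf t \<le> \<eta> * norm h"
        proof -
          have "suminf t = (\<Sum>i. t (i + N)) + sum t {..<N}" by (rule suminf_split_initial_segment[OF t_sum])
          moreover have "sum t {..<N} \<le> (\<Sum>i<N. \<mu> i * (\<eta>' * norm h))"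
          proof (rule sum_mono)
            fix i assume "i \<in> {..<N}"
            then have "\<theta> i (x - a i + h) \<le> \<theta> i (x - a i) + f i h + \<eta>' * norm h" using elim h by blast
            then show "t i \<le> \<mu> i * (\<eta>' * norm h)"
              unfolding t_def using \<mu>(1)[of i] by (intro mult_left_mono) (simp_all add: algebra_simps)
          qed
          moreover have "(\<Sum>i<N. \<mu> i * (\<eta>' * norm h)) \<le> M * (\<eta>' * norm h)"
            unfolding sum_distrib_right[symmetric] M_def using \<eta>'
            by (intro mult_right_mono sum_le_suminf \<mu>) (auto simp: \<mu>)
          moreover have "(\<Sum>i. t (i + N)) \<le> (\<Sum>i. \<mu> (i + N) * (2 * R * norm h))"
          proof (rule suminf_le)
            show "summable (\<lambda>i. t (i + N))" using t_sum by (simp add: summable_iff_shift)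
            show "summable (\<lambda>i. \<mu> (i + N) * (2 * R * norm h))"
              by (intro summable_mult2) (use \<mu>(2) in \<open>simp add: summable_iff_shift\<close>)
            fix i
            have "\<theta> (i + N) (x + h - a (i + N)) - \<theta> (i + N) (x - a (i + N)) \<le> R * norm h"
              using lip[of "i + N" "x + h - a (i + N)" "x - a (i + N)"] pR[of h] by simp
            moreover have "- f (i + N) h \<le> R * norm h" using fR[of "i + N" h] by simp
            ultimately show "t (i + N) \<le> \<mu> (i + N) * (2 * R * norm h)"
              unfolding t_def using \<mu>(1)[of "i + N"] by (intro mult_left_mono) simp_all
          qed
          moreover have "(\<Sum>i. \<mu> (i + N) * (2 * R * norm h)) = (\<Sum>i. \<mu> (i + N)) * (2 * R) * norm h"
            using suminf_mult2[of "\<lambda>i. \<mu> (i + N)" "2 * R * norm h"] \<mu>(2)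
            by (simp add: summable_iff_shift mult.assoc)
          moreover have "(\<Sum>i. \<mu> (i + N)) * (2 * R) * norm h \<le> \<eta> / 2 * norm h"
            using tail by (rule mult_right_mono) simp
          moreover have "M * (\<eta>' * norm h) \<le> \<eta> / 2 * norm h"
            using mult_right_mono[OF M\<eta>', of "norm h"] by (simp add: mult.assoc)
          ultimately have "suminf t \<le> \<eta> / 2 * norm h + \<eta> / 2 * norm h" by linarith
          then show ?thesis by (simp add: field_simps)
        qed
        ultimately show "(\<Sum>i. \<mu> i * \<theta> i (x + h - a i))
          \<le> (\<Sum>i. \<mu> i * \<theta> i (x - a i)) + (\<Sum>i. \<mu> i * f i h) + \<eta> * norm h" by linarith
      qed
    qed
  qed
qed

lemma ex_approximate_minimizer:
  fixes g :: "'z \<Rightarrow> real"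
  assumes "S \<noteq> {}" "\<And>y. y \<in> S \<Longrightarrow> m \<le> g y" "e > 0"
  shows "\<exists>x\<in>S. \<forall>y\<in>S. g x \<le> g y + e"
proof -
  have bdd: "bdd_below (g ` S)" using assms(2) by (intro bdd_belowI[where m = m]) auto
  have "Inf (g ` S) < Inf (g ` S) + e" using assms(3) by simp
  then have "\<exists>z\<in>g ` S. z < Inf (g ` S) + e" using assms(1) by (intro cInf_lessD) auto
  then obtain x where x: "x \<in> S" "g x < Inf (g ` S) + e" by blast
  have "g x \<le> g y + e" if "y \<in> S" for y
  proof -
    have "Inf (g ` S) \<le> g y" using that bdd by (intro cInf_lower) auto
    then show ?thesis using x(2) by simp
  qed
  then show ?thesis using x(1) by blast
qed

text \<open>
  Each \<open>a (n + 1)\<close> almost minimizes \<open>f\<close> plus the first \<open>n + 1\<close> perturbations, and the errors are summable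
  relative to the weights \<open>\<mu>\<close>, so \<open>a\<close> is a Cauchy sequence. Its limit minimizes the full sum. Comparing
  the limit with \<open>x0\<close>, where the zeroth perturbation is at most \<open>0\<close>, gives the distance estimate: all
  later perturbations together weigh \<open>suminf \<mu> - \<mu> 0\<close>.
\<close>

theorem borwein_preiss:
  fixes p f :: "'z::banach \<Rightarrow> real" and S :: "'z set"
  assumes p: "sublinear p" and sym: "\<And>x. p (- x) = p x"
    and pR: "\<And>x. p x \<le> R * norm x" and pB: "\<And>x. norm x \<le> B * p x" and R: "R \<ge> 0" and B: "B \<ge> 0"
    and \<mu>: "\<And>i. \<mu> i > 0" "summable \<mu>" "decseq \<mu>"
    and \<kappa>: "\<And>i. \<kappa> i \<ge> 0" "summable \<kappa>"
    and \<theta>: "\<And>i x. p x - \<kappa> i \<le> \<theta> i x" "\<And>i x. \<theta> i x \<le> p x" "\<And>i x y. \<theta> i x \<le> \<theta> i y + p (x - y)"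
    and S: "closed S" "x0 \<in> S" and f: "continuous_on S f" "\<And>y. y \<in> S \<Longrightarrow> m \<le> f y"
  shows "\<exists>a xb. a 0 = x0 \<and> xb \<in> S \<and> (\<forall>x. summable (\<lambda>i. \<mu> i * \<theta> i (x - a i))) \<and>
    (\<forall>y\<in>S. f xb + (\<Sum>i. \<mu> i * \<theta> i (xb - a i)) \<le> f y + (\<Sum>i. \<mu> i * \<theta> i (y - a i))) \<and>
    (2 * \<mu> 0 - suminf \<mu>) * p (xb - x0) \<le> f x0 - f xb + \<mu> 0 * \<kappa> 0"
proof -
  have p0: "p 0 = 0" by (rule sublinear_zero[OF p])
  have p_nonneg: "0 \<le> p x" for x using sublinear_minus[OF p, of x] sym[of x] by simp
  \<comment> \<open>errors that remain summable after division by the weights\<close>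
  define e where "e n = \<mu> n * (1 / 2) ^ n" for n
  have e_pos: "e n > 0" for n using \<mu>(1) by (simp add: e_def)
  define g where "g \<equiv> \<lambda>(xs :: nat \<Rightarrow> 'z) n y. f y + (\<Sum>i<n. \<mu> i * \<theta> i (y - xs i))"
  define next_pt where "next_pt G n = (SOME x. x \<in> S \<and> (\<forall>y\<in>S. G x \<le> G y + e n))" for G :: "'z \<Rightarrow> real" and n
  \<comment> \<open>the state is the current point together with the function perturbed so far\<close>
  define st where "st = rec_nat (x0, f) (\<lambda>n z. let G = (\<lambda>y. snd z y + \<mu> n * \<theta> n (y - fst z))
     in (next_pt G (Suc n), G))"
  define a where "a n = fst (st n)" for n
  have a0: "a 0 = x0" by (simp add: a_def st_def)
  have st: "snd (st n) = g a n" for n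
  proof (induction n)
    case 0
    show ?case by (simp add: st_def g_def)
  next
    case (Suc n)
    have "snd (st (Suc n)) = (\<lambda>y. snd (st n) y + \<mu> n * \<theta> n (y - a n))"
      by (simp add: st_def a_def Let_def)
    then show ?case unfolding Suc by (simp add: g_def add.assoc)
  qed
  have a_Suc: "a (Suc n) = next_pt (g a (Suc n)) (Suc n)" for n
  proof -
    have "a (Suc n) = next_pt (snd (st (Suc n))) (Suc n)" by (simp add: st_def a_def Let_def)
    then show ?thesis by (simp only: st)
  qed
  have lower: "- \<kappa> i \<le> \<theta> i x" for i x using \<theta>(1)[of x i] p_nonneg[of x] by simp
  have a_min: "a (Suc n) \<in> S \<and> (\<forall>y\<in>S. g a (Suc n) (a (Suc n)) \<le> g a (Suc n) y + e (Suc n))" for n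
  proof -
    have "\<exists>x\<in>S. \<forall>y\<in>S. g a (Suc n) x \<le> g a (Suc n) y + e (Suc n)"
    proof (rule ex_approximate_minimizer[where m = "m + (\<Sum>i<Suc n. \<mu> i * (- \<kappa> i))"])
      fix y assume "y \<in> S"
      then show "m + (\<Sum>i<Suc n. \<mu> i * (- \<kappa> i)) \<le> g a (Suc n) y"
        unfolding g_def using f(2) \<mu>(1) lower by (intro add_mono sum_mono mult_left_mono) (auto intro: less_imp_le)
    qed (use S(2) e_pos in auto)
    then have "\<exists>x. x \<in> S \<and> (\<forall>y\<in>S. g a (Suc n) x \<le> g a (Suc n) y + e (Suc n))" by blast
    from someI_ex[OF this] show ?thesis unfolding a_Suc next_pt_def .
  qed
  have aS: "a n \<in> S" for n using S(2) a0 a_min by (cases n) auto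
  have near_min: "g a (Suc n) (a (Suc n)) \<le> g a (Suc n) y + e (Suc n)" if "y \<in> S" for n y
    using a_min that by blast
  have step: "p (a (Suc (Suc n)) - a (Suc n)) \<le> \<kappa> (Suc n) + 2 * (1 / 2) ^ Suc n" for n
  proof -
    let ?n = "Suc n"
    have "g a ?n (a ?n) \<le> g a ?n (a (Suc ?n)) + e ?n" by (rule near_min[OF aS])
    moreover have "g a (Suc ?n) (a (Suc ?n)) \<le> g a (Suc ?n) (a ?n) + e (Suc ?n)" by (rule near_min[OF aS])
    moreover have "g a (Suc ?n) y = g a ?n y + \<mu> ?n * \<theta> ?n (y - a ?n)" for y
      by (simp add: g_def add.assoc)
    ultimately have "\<mu> ?n * \<theta> ?n (a (Suc ?n) - a ?n) \<le> \<mu> ?n * \<theta> ?n 0 + e ?n + e (Suc ?n)" by simp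
    moreover have "\<mu> ?n * \<theta> ?n 0 \<le> 0" using \<theta>(2)[of ?n 0] p0 \<mu>(1)[of ?n] by (simp add: mult_le_0_iff)
    moreover have "e (Suc ?n) \<le> e ?n"
      unfolding e_def using decseqD[OF \<mu>(3), of ?n "Suc ?n"] \<mu>(1)[of ?n]
      by (intro mult_mono power_decreasing) auto
    ultimately have "\<mu> ?n * \<theta> ?n (a (Suc ?n) - a ?n) \<le> \<mu> ?n * (2 * (1 / 2) ^ ?n)"
      unfolding e_def by linarith
    then have "\<theta> ?n (a (Suc ?n) - a ?n) \<le> 2 * (1 / 2) ^ ?n" using \<mu>(1)[of ?n] by simp
    then show ?thesis using \<theta>(1)[of "a (Suc ?n) - a ?n" ?n] by simp
  qed
  have "summable (\<lambda>n. a (Suc (Suc n)) - a (Suc n))"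
  proof (rule summable_comparison_test'[where g = "\<lambda>n. B * (\<kappa> (Suc n) + 2 * (1 / 2) ^ Suc n)"])
    have "summable (\<lambda>n. \<kappa> (Suc n))" using \<kappa>(2) by (simp add: summable_Suc_iff)
    moreover have "summable (\<lambda>n. (1 / 2 :: real) ^ Suc n)" by (rule sums_summable[OF power_half_series])
    ultimately show "summable (\<lambda>n. B * (\<kappa> (Suc n) + 2 * (1 / 2) ^ Suc n))"
      by (intro summable_mult summable_add)
    show "norm (a (Suc (Suc n)) - a (Suc n)) \<le> B * (\<kappa> (Suc n) + 2 * (1 / 2) ^ Suc n)" for n
      using order_trans[OF pB mult_left_mono[OF step B]] .
  qed
  then obtain l where "(\<lambda>n. a (Suc (Suc n)) - a (Suc n)) sums l" by (auto simp: summable_def)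
  then have "(\<lambda>n. (\<Sum>i<n. a (Suc (Suc i)) - a (Suc i))) \<longlonglongrightarrow> l" by (simp add: sums_def)
  then have "(\<lambda>n. a (Suc n) - a (Suc 0)) \<longlonglongrightarrow> l"
    using sum_lessThan_telescope[of "\<lambda>n. a (Suc n)"] by simp
  from tendsto_add[OF this tendsto_const[of "a (Suc 0)"]]
  have "(\<lambda>n. a (Suc n)) \<longlonglongrightarrow> l + a (Suc 0)" by simp
  then obtain xb where lim1: "(\<lambda>n. a (Suc n)) \<longlonglongrightarrow> xb" by blast
  then have lim: "a \<longlonglongrightarrow> xb" by (rule LIMSEQ_imp_Suc)
  have xbS: "xb \<in> S" using closed_sequentially[OF S(1)] aS lim by blast
  have abd: "\<exists>M. \<forall>i. norm (a i) \<le> M" using Bseq_def convergent_imp_Bseq convergentI lim less_imp_le by metis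
  then obtain M where M: "\<And>i. norm (a i) \<le> M" by blast
  obtain M' where M': "\<And>i. norm (\<kappa> i) \<le> M'"
    using convergent_imp_Bseq[OF convergentI[OF summable_LIMSEQ_zero[OF \<kappa>(2)]]] unfolding Bseq_def by blast
  have summ: "summable (\<lambda>i. \<mu> i * \<theta> i (x - a i))" for x
  proof (rule summable_comparison_test'[OF summable_mult2[OF \<mu>(2), of "R * (norm x + M) + M'"]])
    fix i
    have "norm (x - a i) \<le> norm x + M" using norm_triangle_ineq4[of x "a i"] M[of i] by linarith
    then have "R * norm (x - a i) \<le> R * (norm x + M)" using R by (rule mult_left_mono)
    moreover have "0 \<le> R * (norm x + M)" using R norm_ge_zero[of x] order_trans[OF norm_ge_zero M[of 0]]
      by simp
    ultimately have "\<bar>\<theta> i (x - a i)\<bar> \<le> R * (norm x + M) + M'"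
      using \<theta>(2)[of i "x - a i"] lower[of i "x - a i"] pR[of "x - a i"] M'[of i] \<kappa>(1)[of i]
      by (simp add: abs_le_iff)
    then show "norm (\<mu> i * \<theta> i (x - a i)) \<le> \<mu> i * (R * (norm x + M) + M')"
      using \<mu>(1)[of i] by (simp add: abs_mult mult_left_mono)
  qed
  define \<Phi> where "\<Phi> x = (\<Sum>i. \<mu> i * \<theta> i (x - a i))" for x
  have partial: "(\<lambda>n. \<Sum>i<n. \<mu> i * \<theta> i (x - a i)) \<longlonglongrightarrow> \<Phi> x" for x
    unfolding \<Phi>_def by (rule summable_LIMSEQ[OF summ])
  have p_lim: "(\<lambda>n. p (xb - a n)) \<longlonglongrightarrow> 0"
  proof (rule tendsto_sandwich[OF _ _ tendsto_const])
    show "\<forall>\<^sub>F n in sequentially. 0 \<le> p (xb - a n)" using p_nonneg by simp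
    show "\<forall>\<^sub>F n in sequentially. p (xb - a n) \<le> R * norm (xb - a n)" using pR by simp
    have "(\<lambda>n. R * norm (xb - a n)) \<longlonglongrightarrow> R * norm (xb - xb)" by (intro tendsto_intros lim)
    then show "(\<lambda>n. R * norm (xb - a n)) \<longlonglongrightarrow> 0" by simp
  qed
  have minimal: "f xb + \<Phi> xb \<le> f y + \<Phi> y" if y: "y \<in> S" for y
  proof (rule LIMSEQ_le)
    have "(\<lambda>n. f (a n)) \<longlonglongrightarrow> f xb"
      using continuous_on_tendsto_compose[OF f(1) lim xbS] aS by simp
    then have "(\<lambda>n. f (a n) + (\<Sum>i<n. \<mu> i * \<theta> i (xb - a i)) - suminf \<mu> * p (xb - a n))
        \<longlonglongrightarrow> f xb + \<Phi> xb - suminf \<mu> * 0"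
      by (intro tendsto_intros partial p_lim)
    then show "(\<lambda>n. f (a n) + (\<Sum>i<n. \<mu> i * \<theta> i (xb - a i)) - suminf \<mu> * p (xb - a n))
        \<longlonglongrightarrow> f xb + \<Phi> xb" by simp
    have "e \<longlonglongrightarrow> 0 * 0"
      unfolding e_def by (intro tendsto_mult summable_LIMSEQ_zero[OF \<mu>(2)] LIMSEQ_power_zero) simp
    then have "(\<lambda>n. f y + (\<Sum>i<n. \<mu> i * \<theta> i (y - a i)) + e n) \<longlonglongrightarrow> f y + \<Phi> y + 0"
      by (intro tendsto_intros partial) simp
    then show "(\<lambda>n. f y + (\<Sum>i<n. \<mu> i * \<theta> i (y - a i)) + e n) \<longlonglongrightarrow> f y + \<Phi> y" by simp
    have "f (a n) + (\<Sum>i<n. \<mu> i * \<theta> i (xb - a i)) - suminf \<mu> * p (xb - a n)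
        \<le> f y + (\<Sum>i<n. \<mu> i * \<theta> i (y - a i)) + e n" if n: "n \<ge> 1" for n
    proof -
      obtain k where k: "n = Suc k" using n by (cases n) auto
      have "(\<Sum>i<n. \<mu> i * \<theta> i (xb - a i)) \<le> (\<Sum>i<n. \<mu> i * \<theta> i (a n - a i) + \<mu> i * p (xb - a n))"
      proof (rule sum_mono)
        fix i
        have "\<theta> i (xb - a i) \<le> \<theta> i (a n - a i) + p (xb - a n)"
          using \<theta>(3)[of i "xb - a i" "a n - a i"] by simp
        then have "\<mu> i * \<theta> i (xb - a i) \<le> \<mu> i * (\<theta> i (a n - a i) + p (xb - a n))"
          using \<mu>(1)[of i] by (intro mult_left_mono) auto
        then show "\<mu> i * \<theta> i (xb - a i) \<le> \<mu> i * \<theta> i (a n - a i) + \<mu> i * p (xb - a n)"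
          by (simp add: distrib_left)
      qed
      also have "\<dots> = (\<Sum>i<n. \<mu> i * \<theta> i (a n - a i)) + (\<Sum>i<n. \<mu> i) * p (xb - a n)"
        by (simp add: sum.distrib sum_distrib_right)
      also have "(\<Sum>i<n. \<mu> i) * p (xb - a n) \<le> suminf \<mu> * p (xb - a n)"
        using \<mu> by (intro mult_right_mono sum_le_suminf p_nonneg) (auto intro: less_imp_le)
      finally show ?thesis using near_min[OF y, of k] unfolding k g_def by linarith
    qed
    then show "\<exists>N. \<forall>n\<ge>N. f (a n) + (\<Sum>i<n. \<mu> i * \<theta> i (xb - a i)) - suminf \<mu> * p (xb - a n)
        \<le> f y + (\<Sum>i<n. \<mu> i * \<theta> i (y - a i)) + e n" by blast
  qed
  have "(2 * \<mu> 0 - suminf \<mu>) * p (xb - x0) \<le> f x0 - f xb + \<mu> 0 * \<kappa> 0"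
  proof -
    define P where "P = p (xb - x0)"
    define T where "T x = (\<Sum>i. \<mu> (Suc i) * \<theta> (Suc i) (x - a (Suc i)))" for x
    have split: "\<Phi> x = \<mu> 0 * \<theta> 0 (x - x0) + T x" for x
      using suminf_split_head[OF summ[of x]] by (simp add: \<Phi>_def T_def a0)
    have summT: "summable (\<lambda>i. \<mu> (Suc i) * \<theta> (Suc i) (x - a (Suc i)))" for x
      using summ[of x] by (subst (asm) summable_Suc_iff[symmetric])
    have summ\<mu>: "summable (\<lambda>i. \<mu> (Suc i))" using \<mu>(2) by (simp add: summable_Suc_iff)
    have "T x0 \<le> (\<Sum>i. \<mu> (Suc i) * \<theta> (Suc i) (xb - a (Suc i)) + \<mu> (Suc i) * P)"
      unfolding T_def
    proof (rule suminf_le[OF _ summT summable_add[OF summT summable_mult2[OF summ\<mu>]]])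
      fix i
      have "p (x0 - xb) = P" using sym[of "xb - x0"] by (simp add: P_def)
      then have "\<theta> (Suc i) (x0 - a (Suc i)) \<le> \<theta> (Suc i) (xb - a (Suc i)) + P"
        using \<theta>(3)[of "Suc i" "x0 - a (Suc i)" "xb - a (Suc i)"] by simp
      then have "\<mu> (Suc i) * \<theta> (Suc i) (x0 - a (Suc i)) \<le> \<mu> (Suc i) * (\<theta> (Suc i) (xb - a (Suc i)) + P)"
        using \<mu>(1)[of "Suc i"] by (intro mult_left_mono) auto
      then show "\<mu> (Suc i) * \<theta> (Suc i) (x0 - a (Suc i))
          \<le> \<mu> (Suc i) * \<theta> (Suc i) (xb - a (Suc i)) + \<mu> (Suc i) * P" by (simp add: distrib_left)
    qed
    also have "\<dots> = T xb + (suminf \<mu> - \<mu> 0) * P"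
      unfolding T_def suminf_add[OF summT summable_mult2[OF summ\<mu>], symmetric]
        suminf_mult2[OF summ\<mu>, symmetric] using suminf_split_head[OF \<mu>(2)] by simp
    finally have 1: "T x0 \<le> T xb + (suminf \<mu> - \<mu> 0) * P" .
    have 2: "f xb + \<mu> 0 * \<theta> 0 (xb - x0) + T xb \<le> f x0 + \<mu> 0 * \<theta> 0 0 + T x0"
      using minimal[OF S(2)] by (simp add: split)
    have 3: "\<mu> 0 * \<theta> 0 0 \<le> 0" using \<theta>(2)[of 0 0] p0 \<mu>(1)[of 0] by (simp add: mult_le_0_iff)
    have "\<mu> 0 * (P - \<kappa> 0) \<le> \<mu> 0 * \<theta> 0 (xb - x0)"
      using \<theta>(1)[of "xb - x0" 0] \<mu>(1)[of 0] by (intro mult_left_mono) (auto simp: P_def)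
    then have "f xb + \<mu> 0 * (P - \<kappa> 0) \<le> f x0 + (suminf \<mu> - \<mu> 0) * P" using 1 2 3 by linarith
    then show ?thesis unfolding P_def[symmetric] by (simp add: algebra_simps)
  qed
  then show ?thesis using a0 xbS summ minimal unfolding \<Phi>_def by (intro exI[of _ a] exI[of _ xb]) blast
qed

section \<open>Extension of normal functionals from a separable subspace\<close>

text \<open>
  A functional bounded by \<open>R\<close> that satisfies \<open>f h \<le> \<parallel>h\<parallel> / (n + 1)\<close> for all \<open>h\<close> in some set with
  \<open>\<parallel>h\<parallel> < 1 / (k + 1)\<close> lies below \<open>penalty R (n, k)\<close> on the whole set. This replaces a bound on a ball by one
  that is Lipschitz in \<open>h\<close> and therefore stable when the base point moves, and only countably many
  penalties occur.
\<close>

definition penalty :: "real \<Rightarrow> nat \<times> nat \<Rightarrow> 'z::real_normed_vector \<Rightarrow> real" where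
  "penalty R j h = norm h / real (Suc (fst j)) + R * max 0 (2 * norm h - 1 / real (Suc (snd j)))"

text \<open>
  An entry \<open>(l, j, v)\<close> of the list stands for the weight \<open>l\<close> of the inequality
  \<open>f (v - w) \<le> penalty R j (v - w)\<close>.
\<close>

definition total_penalty :: "real \<Rightarrow> 'z::real_normed_vector \<Rightarrow> (real \<times> (nat \<times> nat) \<times> 'z) list \<Rightarrow> real" where
  "total_penalty R w xs = (\<Sum>z\<leftarrow>xs. fst z * penalty R (fst (snd z)) (snd (snd z) - w))"

definition weighted_steps :: "'z::real_normed_vector \<Rightarrow> (real \<times> (nat \<times> nat) \<times> 'z) list \<Rightarrow> 'z" where
  "weighted_steps w xs = (\<Sum>z\<leftarrow>xs. fst z *\<^sub>R (snd (snd z) - w))"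

definition admissible :: "'z set \<Rightarrow> nat \<Rightarrow> (real \<times> (nat \<times> nat) \<times> 'z) list \<Rightarrow> bool" where
  "admissible \<Omega> N xs \<longleftrightarrow> (\<forall>z\<in>set xs. 0 \<le> fst z \<and> fst z \<le> real N \<and> snd (snd z) \<in> \<Omega>)"

text \<open>
  A positive combination of the normality inequalities contradicts \<open>f P \<ge> \<tau>\<close>, for a functional \<open>f\<close> below
  \<open>q\<close>, as soon as the sum in this definition is below \<open>\<tau>\<close>. The set \<open>D\<close> reflects such contradictions:
  if one exists for parameters in \<open>D\<close>, then one exists with the same indices \<open>j\<close> and points in \<open>D\<close>.
  The weights are existential but bounded by the parameter \<open>N\<close>, which makes the left side
  uniformly Lipschitz in \<open>w\<close> and \<open>P\<close>.
\<close>

definition reflecting ::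
    "'z::real_normed_vector set \<Rightarrow> ('z \<Rightarrow> real) \<Rightarrow> real \<Rightarrow> 'z set \<Rightarrow> bool" where
  "reflecting \<Omega> q R D \<longleftrightarrow> (\<forall>xs N \<tau> w P. w \<in> D \<and> P \<in> D \<and> \<tau> \<in> \<rat> \<and> admissible \<Omega> N xs \<and>
     total_penalty R w xs + q (P - weighted_steps w xs) < \<tau> \<longrightarrow>
     (\<exists>xs'. admissible (\<Omega> \<inter> D) N xs' \<and> map (fst \<circ> snd) xs' = map (fst \<circ> snd) xs \<and>
        total_penalty R w xs' + q (P - weighted_steps w xs') < \<tau>))"

lemma penalty_lipschitz:
  assumes "R \<ge> 0"
  shows "penalty R j h \<le> penalty R j h' + (1 + 2 * R) * norm (h - h')"
proof -
  have n: "norm h \<le> norm h' + norm (h - h')" by (metis add.commute norm_triangle_sub)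
  have "norm h / real (Suc (fst j)) \<le> (norm h' + norm (h - h')) / real (Suc (fst j))"
    by (rule divide_right_mono[OF n]) simp
  moreover have "norm (h - h') / real (Suc (fst j)) \<le> norm (h - h')"
    by (simp add: divide_le_eq distrib_left)
  moreover have "max 0 (2 * norm h - 1 / real (Suc (snd j)))
      \<le> max 0 (2 * norm h' - 1 / real (Suc (snd j))) + 2 * norm (h - h')"
    using n by (auto simp: max_def)
  then have "R * max 0 (2 * norm h - 1 / real (Suc (snd j)))
      \<le> R * (max 0 (2 * norm h' - 1 / real (Suc (snd j))) + 2 * norm (h - h'))"
    using assms by (rule mult_left_mono)
  ultimately show ?thesis unfolding penalty_def by (simp add: add_divide_distrib algebra_simps)
qed

lemma total_penalty_lipschitz:
  assumes R: "R \<ge> 0" and xs: "admissible \<Omega> N xs"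
  shows "total_penalty R w xs \<le> total_penalty R w' xs + real (length xs) * real N * (1 + 2 * R) * norm (w - w')"
  using xs
proof (induction xs)
  case (Cons z xs)
  have z: "0 \<le> fst z" "fst z \<le> real N" and xs: "admissible \<Omega> N xs" using Cons.prems by (auto simp: admissible_def)
  have "fst z * penalty R (fst (snd z)) (snd (snd z) - w)
      \<le> fst z * (penalty R (fst (snd z)) (snd (snd z) - w') + (1 + 2 * R) * norm (w - w'))"
    using penalty_lipschitz[OF R, of "fst (snd z)" "snd (snd z) - w" "snd (snd z) - w'"] z
    by (intro mult_left_mono) (simp_all add: norm_minus_commute)
  also have "\<dots> \<le> fst z * penalty R (fst (snd z)) (snd (snd z) - w') + real N * ((1 + 2 * R) * norm (w - w'))"
    using mult_right_mono[OF z(2), of "(1 + 2 * R) * norm (w - w')"] R by (simp add: distrib_left)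
  finally show ?case using Cons.IH[OF xs] by (simp add: total_penalty_def algebra_simps)
qed (simp add: total_penalty_def)

lemma weighted_steps_lipschitz:
  assumes xs: "admissible \<Omega> N xs"
  shows "norm (weighted_steps w xs - weighted_steps w' xs) \<le> real (length xs) * real N * norm (w - w')"
  using xs
proof (induction xs)
  case (Cons z xs)
  have z: "0 \<le> fst z" "fst z \<le> real N" and xs: "admissible \<Omega> N xs" using Cons.prems by (auto simp: admissible_def)
  have "weighted_steps w (z # xs) - weighted_steps w' (z # xs)
      = fst z *\<^sub>R (w' - w) + (weighted_steps w xs - weighted_steps w' xs)"
    by (simp add: weighted_steps_def scaleR_diff_right)
  also have "norm \<dots> \<le> fst z * norm (w - w') + real (length xs) * real N * norm (w - w')"
    using Cons.IH[OF xs] z by (intro norm_triangle_le) (simp add: norm_minus_commute)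
  also have "\<dots> \<le> real N * norm (w - w') + real (length xs) * real N * norm (w - w')"
    using z by (intro add_right_mono mult_right_mono) auto
  finally show ?case by (simp add: algebra_simps)
qed (simp add: weighted_steps_def)

lemma linear_functional_le_total_penalty:
  assumes lin: "linear \<phi>"
    and le: "\<And>z. z \<in> set xs \<Longrightarrow> 0 \<le> fst z \<and> \<phi> (snd (snd z) - w) \<le> penalty R (fst (snd z)) (snd (snd z) - w)"
  shows "\<phi> (weighted_steps w xs) \<le> total_penalty R w xs"
  using le
proof (induction xs)
  case Nil
  then show ?case by (simp add: weighted_steps_def total_penalty_def linear_0[OF lin])
next
  case (Cons z xs)
  have "fst z * \<phi> (snd (snd z) - w) \<le> fst z * penalty R (fst (snd z)) (snd (snd z) - w)"
    using Cons.prems[of z] by (intro mult_left_mono) auto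
  then show ?case using Cons
    by (simp add: weighted_steps_def total_penalty_def linear_add[OF lin] linear_scale[OF lin])
qed

text \<open>
  The cone \<open>\<Gamma>\<close> collects the requirements that \<open>L\<close> agrees with \<open>\<phi>\<close> on \<open>Y\<close> and lies below one
  penalty for each \<open>n\<close> on the set \<open>\<Omega> - w\<close>. If a combination of them were inconsistent with \<open>q\<close>, the same would hold, by the
  Lipschitz estimates, for parameters in \<open>D\<close> near \<open>w\<close> and \<open>y\<close>; by reflection it would then
  hold with points of \<open>\<Omega> \<inter> D\<close>, where \<open>\<phi>\<close> itself satisfies all the requirements.
\<close>

theorem extend_normal_functional:
  fixes \<Omega> D :: "'z::real_normed_vector set" and q \<phi> :: "'z \<Rightarrow> real"
  assumes q: "sublinear q" and qQ: "\<And>x. q x \<le> Q * norm x" and Q: "Q \<ge> 0" and R: "R \<ge> 0"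
    and D: "reflecting \<Omega> q R D" and Y: "Y = closure D" and sub: "subspace Y"
    and w: "w \<in> Y"
    and lin: "linear \<phi>" and \<phi>q: "\<And>y. y \<in> Y \<Longrightarrow> \<phi> y \<le> q y"
    and \<phi>R: "\<And>y. y \<in> Y \<Longrightarrow> \<phi> y \<le> R * norm y"
    and normal: "\<And>c. c > 0 \<Longrightarrow> \<exists>\<delta>>0. \<forall>v\<in>\<Omega> \<inter> Y. norm (v - w) < \<delta> \<longrightarrow> \<phi> (v - w) \<le> c * norm (v - w)"
  shows "\<exists>L. linear L \<and> (\<forall>x. L x \<le> q x) \<and> (\<forall>y\<in>Y. L y = \<phi> y) \<and>
    (\<forall>c>0. \<exists>\<delta>>0. \<forall>v\<in>\<Omega>. norm (v - w) < \<delta> \<longrightarrow> L (v - w) \<le> c * norm (v - w))"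
proof -
  have "\<forall>n. \<exists>k. \<forall>v\<in>\<Omega> \<inter> Y. norm (v - w) < 1 / real (Suc k) \<longrightarrow> \<phi> (v - w) \<le> norm (v - w) / real (Suc n)"
  proof
    fix n
    have "1 / real (Suc n) > 0" by simp
    from normal[OF this] obtain \<delta> where \<delta>: "\<delta> > 0"
      "\<forall>v\<in>\<Omega> \<inter> Y. norm (v - w) < \<delta> \<longrightarrow> \<phi> (v - w) \<le> 1 / real (Suc n) * norm (v - w)" by blast
    obtain k where "1 / real (Suc k) < \<delta>" using nat_approx_posE[OF \<delta>(1)] by auto
    then show "\<exists>k. \<forall>v\<in>\<Omega> \<inter> Y. norm (v - w) < 1 / real (Suc k) \<longrightarrow> \<phi> (v - w) \<le> norm (v - w) / real (Suc n)"
      using \<delta>(2) by (intro exI[of _ k]) auto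
  qed
  from choice[OF this] obtain k where k: "\<forall>n. \<forall>v\<in>\<Omega> \<inter> Y. norm (v - w) < 1 / real (Suc (k n)) \<longrightarrow>
      \<phi> (v - w) \<le> norm (v - w) / real (Suc n)" by (elim exE)
  have \<phi>_penalty: "\<phi> (v - w) \<le> penalty R (n, k n) (v - w)" if v: "v \<in> \<Omega>" "v \<in> Y" for v n
  proof (cases "norm (v - w) < 1 / real (Suc (k n))")
    case True
    then have "\<phi> (v - w) \<le> norm (v - w) / real (Suc n)" using k v by simp
    moreover have "0 \<le> R * max 0 (2 * norm (v - w) - 1 / real (Suc (k n)))" using R by simp
    ultimately show ?thesis by (simp add: penalty_def)
  next
    case False
    have "\<phi> (v - w) \<le> R * norm (v - w)" using \<phi>R subspace_diff[OF sub v(2) w] by blast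
    also have "\<dots> \<le> R * max 0 (2 * norm (v - w) - 1 / real (Suc (k n)))"
      using False R by (intro mult_left_mono) auto
    also have "\<dots> \<le> penalty R (n, k n) (v - w)" by (simp add: penalty_def)
    finally show ?thesis .
  qed
  \<comment> \<open>combinations that use, for each \<open>n\<close>, only the penalty with the radius at which \<open>\<phi>\<close> satisfies it\<close>
  define good where "good xs \<longleftrightarrow> (\<forall>z\<in>set xs. 0 \<le> fst z \<and> snd (fst (snd z)) = k (fst (fst (snd z))) \<and> snd (snd z) \<in> \<Omega>)"
    for xs :: "(real \<times> (nat \<times> nat) \<times> 'z) list"
  have dual: "\<phi> y \<le> total_penalty R w xs + q (y - weighted_steps w xs)" if y: "y \<in> Y" and xs: "good xs" for y xs
  proof (rule ccontr)
    define T where "T v P zs = total_penalty R v zs + q (P - weighted_steps v zs)" for v P zs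
    assume "\<not> \<phi> y \<le> total_penalty R w xs + q (y - weighted_steps w xs)"
    then have less: "T w y xs < \<phi> y" by (simp add: T_def)
    obtain \<tau> where \<tau>: "\<tau> \<in> \<rat>" "T w y xs < \<tau>" "\<tau> < \<phi> y" using Rats_dense_in_real[OF less] by blast
    have "\<exists>N::nat. \<forall>z\<in>set xs. fst z \<le> real N"
    proof -
      obtain N :: nat where "Max (insert 0 (fst ` set xs)) \<le> real N" using real_arch_simple by blast
      then have "\<forall>z\<in>set xs. fst z \<le> real N" by (auto simp: Max_le_iff)
      then show ?thesis ..
    qed
    then obtain N :: nat where N: "\<forall>z\<in>set xs. fst z \<le> real N" by blast
    have adm: "admissible \<Omega> N xs" using xs N by (auto simp: admissible_def good_def)
    define A where "A = real (length xs) * real N"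
    have A: "A \<ge> 0" by (simp add: A_def)
    have T_lip: "T v P zs \<le> T v' P' zs + (A * (1 + 2 * R) * norm (v - v') + Q * (norm (P - P') + A * norm (v - v')))"
      if zs: "admissible \<Omega>' N zs" "length zs = length xs" for v v' P P' zs \<Omega>'
    proof -
      have "q (P - weighted_steps v zs) - q (P' - weighted_steps v' zs)
          \<le> q ((P - weighted_steps v zs) - (P' - weighted_steps v' zs))" by (rule sublinear_diff[OF q])
      also have "\<dots> \<le> Q * norm ((P - P') - (weighted_steps v zs - weighted_steps v' zs))"
        using qQ by (simp add: algebra_simps)
      also have "\<dots> \<le> Q * (norm (P - P') + A * norm (v - v'))"
        using weighted_steps_lipschitz[OF zs(1), of v v'] Q zs(2)
        by (intro mult_left_mono norm_triangle_le_diff) (auto simp: A_def)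
      finally show ?thesis
        using total_penalty_lipschitz[OF R zs(1), of v v'] zs(2) by (simp add: T_def A_def)
    qed
    \<comment> \<open>a Lipschitz constant of \<open>T\<close> in the base point and the target; the summand \<open>1\<close> makes the estimate strict\<close>
    define C where "C = A * (1 + 2 * R) + Q * (1 + A) + 1"
    have C: "C > 0" using A R Q by (simp add: C_def add_nonneg_pos)
    define \<zeta> where "\<zeta> = min (\<tau> - T w y xs) (\<phi> y - \<tau>) / C"
    have \<zeta>: "\<zeta> > 0" "C * \<zeta> \<le> \<tau> - T w y xs" "C * \<zeta> \<le> \<phi> y - \<tau>" using \<tau> C by (auto simp: \<zeta>_def)
    obtain w' where w': "w' \<in> D" "dist w' w < \<zeta>" using w \<zeta>(1) unfolding Y closure_approachable by blast
    obtain y' where y': "y' \<in> D" "dist y' y < \<zeta>" using y \<zeta>(1) unfolding Y closure_approachable by blast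
    have small: "T v P zs < T v' P' zs + C * \<zeta>"
      if zs: "admissible \<Omega>' N zs" "length zs = length xs" and vP: "norm (v - v') < \<zeta>" "norm (P - P') < \<zeta>"
      for v v' P P' zs \<Omega>'
    proof -
      have "A * (1 + 2 * R) * norm (v - v') \<le> A * (1 + 2 * R) * \<zeta>"
        using vP A R by (intro mult_left_mono) auto
      moreover have "Q * (norm (P - P') + A * norm (v - v')) \<le> Q * (\<zeta> + A * \<zeta>)"
        using vP A Q by (intro mult_left_mono add_mono) auto
      moreover have "C * \<zeta> = A * (1 + 2 * R) * \<zeta> + Q * (\<zeta> + A * \<zeta>) + \<zeta>" by (simp add: C_def algebra_simps)
      ultimately show ?thesis using T_lip[OF zs, of v P v' P'] \<zeta>(1) by linarith
    qed
    have "T w' y' xs < T w y xs + C * \<zeta>"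
      by (rule small[OF adm refl]) (use w' y' in \<open>simp_all add: dist_norm\<close>)
    then have "T w' y' xs < \<tau>" using \<zeta> by linarith
    then obtain xs' where xs': "admissible (\<Omega> \<inter> D) N xs'" "map (fst \<circ> snd) xs' = map (fst \<circ> snd) xs" "T w' y' xs' < \<tau>"
      using D[unfolded reflecting_def, rule_format, of w' y' \<tau> N xs] w'(1) y'(1) \<tau>(1) adm unfolding T_def by blast
    have len: "length xs' = length xs" using xs'(2) map_eq_imp_length_eq by blast
    have "T w y xs' < T w' y' xs' + C * \<zeta>"
      by (rule small[OF xs'(1) len]) (use w' y' in \<open>simp_all add: dist_norm norm_minus_commute\<close>)
    then have "T w y xs' < \<phi> y" using xs'(3) \<zeta> by linarith
    moreover have "\<phi> y \<le> T w y xs'"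
    proof -
      have DY: "D \<subseteq> Y" unfolding Y by (rule closure_subset)
      have idx: "snd (fst (snd z)) = k (fst (fst (snd z)))" if "z \<in> set xs'" for z
      proof -
        have "fst (snd z) \<in> set (map (fst \<circ> snd) xs')" using that by auto
        then obtain z' where "z' \<in> set xs" "fst (snd z) = fst (snd z')" unfolding xs'(2) by auto
        then show ?thesis using xs by (auto simp: good_def)
      qed
      have "0 \<le> fst z \<and> \<phi> (snd (snd z) - w) \<le> penalty R (fst (snd z)) (snd (snd z) - w)" if z: "z \<in> set xs'" for z
      proof -
        have "fst (snd z) = (fst (fst (snd z)), k (fst (fst (snd z))))" using idx[OF z] by (metis prod.collapse)
        moreover have "snd (snd z) \<in> \<Omega>" "snd (snd z) \<in> Y" "0 \<le> fst z" using xs'(1) z DY by (auto simp: admissible_def)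
        ultimately show ?thesis using \<phi>_penalty by metis
      qed
      then have "\<phi> (weighted_steps w xs') \<le> total_penalty R w xs'"
        by (rule linear_functional_le_total_penalty[OF lin])
      moreover have "weighted_steps w xs' \<in> Y"
      proof -
        have "\<forall>z\<in>set xs'. snd (snd z) \<in> Y" using xs'(1) DY by (auto simp: admissible_def)
        then show ?thesis
          by (induction xs') (auto simp: weighted_steps_def subspace_0[OF sub]
              intro!: subspace_add[OF sub] subspace_scale[OF sub] subspace_diff[OF sub] w)
      qed
      then have "\<phi> (y - weighted_steps w xs') \<le> q (y - weighted_steps w xs')"
        by (intro \<phi>q subspace_diff[OF sub y])
      ultimately show ?thesis using linear_diff[OF lin, of y "weighted_steps w xs'"] by (simp add: T_def)
    qed
    ultimately show False by simp
  qed
  define \<Gamma> where "\<Gamma> = {(y - weighted_steps w xs, \<phi> y - total_penalty R w xs) | y xs. y \<in> Y \<and> good xs}"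
  have \<Gamma>I: "(y - weighted_steps w xs, \<phi> y - total_penalty R w xs) \<in> \<Gamma>" if "y \<in> Y" "good xs" for y xs
    using that by (auto simp: \<Gamma>_def)
  have empty: "good []" "weighted_steps w [] = 0" "total_penalty R w [] = 0"
    by (simp_all add: good_def weighted_steps_def total_penalty_def)
  have zero: "(0, 0) \<in> \<Gamma>" using \<Gamma>I[OF subspace_0[OF sub] empty(1)] empty linear_0[OF lin] by simp
  have add: "(v + v', c + c') \<in> \<Gamma>" if v: "(v, c) \<in> \<Gamma>" "(v', c') \<in> \<Gamma>" for v c v' c'
  proof -
    obtain y xs where 1: "v = y - weighted_steps w xs" "c = \<phi> y - total_penalty R w xs" "y \<in> Y" "good xs"
      using v(1) by (auto simp: \<Gamma>_def)
    obtain y' xs' where 2: "v' = y' - weighted_steps w xs'" "c' = \<phi> y' - total_penalty R w xs'" "y' \<in> Y" "good xs'"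
      using v(2) by (auto simp: \<Gamma>_def)
    have "good (xs @ xs')" using 1 2 by (auto simp: good_def)
    from \<Gamma>I[OF subspace_add[OF sub 1(3) 2(3)] this] show ?thesis
      by (simp add: 1 2 weighted_steps_def total_penalty_def linear_add[OF lin] algebra_simps)
  qed
  have scale: "(t *\<^sub>R v, t * c) \<in> \<Gamma>" if t: "t > 0" and v: "(v, c) \<in> \<Gamma>" for t v c
  proof -
    obtain y xs where 1: "v = y - weighted_steps w xs" "c = \<phi> y - total_penalty R w xs" "y \<in> Y" "good xs"
      using v by (auto simp: \<Gamma>_def)
    define zs where "zs = map (\<lambda>z. (t * fst z, snd z)) xs"
    have "good zs" using 1(4) t by (auto simp: good_def zs_def)
    moreover have "weighted_steps w zs = t *\<^sub>R weighted_steps w xs"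
      unfolding zs_def by (induction xs) (auto simp: weighted_steps_def scaleR_add_right)
    moreover have "total_penalty R w zs = t * total_penalty R w xs"
      unfolding zs_def by (induction xs) (auto simp: total_penalty_def distrib_left mult.assoc)
    ultimately show ?thesis using \<Gamma>I[OF subspace_scale[OF sub 1(3), of t], of zs]
      by (simp add: 1 linear_scale[OF lin] scaleR_diff_right right_diff_distrib)
  qed
  have le: "c \<le> q v" if v: "(v, c) \<in> \<Gamma>" for v c
  proof -
    obtain y xs where 1: "v = y - weighted_steps w xs" "c = \<phi> y - total_penalty R w xs" "y \<in> Y" "good xs"
      using v by (auto simp: \<Gamma>_def)
    show ?thesis using dual[OF 1(3,4)] by (simp add: 1)
  qed
  obtain L where L: "linear L" "\<And>x. L x \<le> q x" "\<And>v c. (v, c) \<in> \<Gamma> \<Longrightarrow> c \<le> L v"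
    using mazur_orlicz[OF q zero add scale le] by blast
  have L_ge: "\<phi> y \<le> L y" if "y \<in> Y" for y
    using L(3)[OF \<Gamma>I[OF that empty(1)]] by (simp add: empty)
  have "L y = \<phi> y" if "y \<in> Y" for y
    using L_ge[OF that] L_ge[OF subspace_neg[OF sub that]] linear_neg[OF L(1), of y] linear_neg[OF lin, of y] by simp
  moreover have L_pen: "L (v - w) \<le> penalty R (n, k n) (v - w)" if "v \<in> \<Omega>" for v n
  proof -
    have "good [(1, (n, k n), v)]" using that by (simp add: good_def)
    from L(3)[OF \<Gamma>I[OF subspace_0[OF sub] this]] show ?thesis
      using linear_neg[OF L(1), of "v - w"] linear_0[OF lin] by (simp add: weighted_steps_def total_penalty_def)
  qed
  have "\<exists>\<delta>>0. \<forall>v\<in>\<Omega>. norm (v - w) < \<delta> \<longrightarrow> L (v - w) \<le> c * norm (v - w)" if c: "c > 0" for c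
  proof -
    obtain n where n: "1 / real (Suc n) < c" using nat_approx_posE[OF c] by auto
    have "L (v - w) \<le> c * norm (v - w)" if v: "v \<in> \<Omega>" "norm (v - w) < 1 / (2 * real (Suc (k n)))" for v
    proof -
      have "2 * norm (v - w) < 1 / real (Suc (k n))" using v(2) by (simp add: field_simps)
      then have "penalty R (n, k n) (v - w) = 1 / real (Suc n) * norm (v - w)" by (simp add: penalty_def)
      also have "\<dots> \<le> c * norm (v - w)" using n by (intro mult_right_mono) auto
      finally show ?thesis using L_pen[OF v(1), of n] by linarith
    qed
    moreover have "1 / (2 * real (Suc (k n))) > 0" by simp
    ultimately show ?thesis by blast
  qed
  ultimately show ?thesis using L(1,2) by blast
qed

section \<open>Separable reflecting subspaces\<close>

lemma subspace_closure_rational: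
  fixes D :: "'a::real_normed_vector set"
  assumes zero: "0 \<in> D" and add: "\<And>x y. x \<in> D \<Longrightarrow> y \<in> D \<Longrightarrow> x + y \<in> D"
    and scale: "\<And>r x. r \<in> \<rat> \<Longrightarrow> x \<in> D \<Longrightarrow> r *\<^sub>R x \<in> D"
  shows "subspace (closure D)"
proof (rule subspaceI)
  show "0 \<in> closure D" using zero closure_subset by blast
  fix x assume "x \<in> closure D"
  then obtain f where f: "\<And>n. f n \<in> D" "f \<longlonglongrightarrow> x" unfolding closure_sequential by blast
  {
    fix y assume "y \<in> closure D"
    then obtain g where g: "\<And>n. g n \<in> D" "g \<longlonglongrightarrow> y" unfolding closure_sequential by blast
    have "\<forall>n. f n + g n \<in> D" using add f(1) g(1) by blast
    then show "x + y \<in> closure D"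
      using tendsto_add[OF f(2) g(2)] unfolding closure_sequential
      by (intro exI[of _ "\<lambda>n. f n + g n"] conjI)
  }
  fix c :: real
  have "c \<in> closure \<rat>" by (simp add: Rats_closure_real)
  then obtain r where r: "\<And>n. r n \<in> \<rat>" "r \<longlonglongrightarrow> c" unfolding closure_sequential by blast
  have "\<forall>n. r n *\<^sub>R f n \<in> D" using scale f(1) r(1) by blast
  then show "c *\<^sub>R x \<in> closure D"
    using tendsto_scaleR[OF r(2) f(2)] unfolding closure_sequential
    by (intro exI[of _ "\<lambda>n. r n *\<^sub>R f n"] conjI)
qed

text \<open>
  A witness to a contradiction is a list of pairs in \<open>\<Omega>\<close>; closing off adds both components of all its
  points to \<open>D\<close>.
\<close>

lemma ex_reflecting_subspace:
  fixes \<Omega> :: "('a::real_normed_vector \<times> 'a) set" and D0 :: "'a set"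
  assumes D0: "countable D0"
  shows "\<exists>D. countable D \<and> D0 \<subseteq> D \<and> subspace (closure D) \<and> reflecting \<Omega> q R (D \<times> D)"
proof -
  define W where "W js N \<tau> w P xs \<longleftrightarrow> admissible \<Omega> N xs \<and> map (fst \<circ> snd) xs = js \<and>
    total_penalty R w xs + q (P - weighted_steps w xs) < \<tau>" for js N \<tau> w P xs
  define comps where "comps xs = (\<lambda>z. fst (snd (snd z))) ` set xs \<union> (\<lambda>z. snd (snd (snd z))) ` set xs"
    for xs :: "(real \<times> (nat \<times> nat) \<times> 'a \<times> 'a) list"
  define pick where "pick = (\<lambda>(js, N, \<tau>, w, P). comps (SOME xs. W js N \<tau> w P xs))"
  define I where "I ps = (UNIV :: (nat \<times> nat) list set) \<times> (UNIV :: nat set) \<times> (\<rat> :: real set) \<times>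
     (set ps \<times> set ps) \<times> (set ps \<times> set ps)" for ps :: "'a list"
  define h where "h ps = insert 0 ((\<lambda>z. fst z + snd z) ` (set ps \<times> set ps) \<union>
     (\<lambda>z. fst z *\<^sub>R snd z) ` (\<rat> \<times> set ps) \<union> (\<Union>i\<in>I ps. pick i))" for ps
  have fin: "countable (set ps)" for ps :: "'a list" by (rule countable_finite) simp
  have cI: "countable (I ps)" for ps
    unfolding I_def by (intro countable_SIGMA fin countable_rat) auto
  have cpick: "countable (pick i)" for i
    unfolding pick_def comps_def by (rule countable_finite) (simp split: prod.split)
  have ch: "countable (h ps)" for ps
    unfolding h_def
    by (intro countable_insert countable_Un countable_image countable_SIGMA countable_UN cI cpick fin countable_rat)
  from countable_closing_off[of h, OF ch D0]
  obtain D where D: "countable D" "D0 \<subseteq> D" and closed_off: "\<forall>ps. set ps \<subseteq> D \<longrightarrow> h ps \<subseteq> D"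
    by (elim exE conjE)
  have cl: "h ps \<subseteq> D" if "set ps \<subseteq> D" for ps using closed_off that by simp
  have sub: "0 \<in> h ps" "(\<lambda>z. fst z + snd z) ` (set ps \<times> set ps) \<subseteq> h ps"
    "(\<lambda>z. fst z *\<^sub>R snd z) ` (\<rat> \<times> set ps) \<subseteq> h ps" "(\<Union>i\<in>I ps. pick i) \<subseteq> h ps" for ps
    unfolding h_def by (rule insertI1, simp_all only: subset_insertI2 Un_upper1 Un_upper2 le_supI1)
  have zero: "0 \<in> D" using cl[of "[]"] sub(1)[of "[]"] by auto
  have add: "x + y \<in> D" if "x \<in> D" "y \<in> D" for x y
  proof -
    have "x + y \<in> (\<lambda>z. fst z + snd z) ` (set [x, y] \<times> set [x, y])"
      by (rule image_eqI[of _ _ "(x, y)"]) simp_all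
    then have "x + y \<in> h [x, y]" by (rule subsetD[OF sub(2)])
    then show ?thesis using cl[of "[x, y]"] that by auto
  qed
  have scale: "r *\<^sub>R x \<in> D" if "r \<in> \<rat>" "x \<in> D" for r x
  proof -
    have "r *\<^sub>R x \<in> (\<lambda>z. fst z *\<^sub>R snd z) ` (\<rat> \<times> set [x])"
      by (rule image_eqI[of _ _ "(r, x)"]) (simp_all add: that(1))
    then have "r *\<^sub>R x \<in> h [x]" by (rule subsetD[OF sub(3)])
    then show ?thesis using cl[of "[x]"] that by auto
  qed
  have "reflecting \<Omega> q R (D \<times> D)"
    unfolding reflecting_def
  proof (intro allI impI, elim conjE)
    fix xs N \<tau> w P
    assume w: "w \<in> D \<times> D" and P: "P \<in> D \<times> D" and \<tau>: "\<tau> \<in> \<rat>" and adm: "admissible \<Omega> N xs"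
      and less: "total_penalty R w xs + q (P - weighted_steps w xs) < \<tau>"
    define js where "js = map (fst \<circ> snd) xs"
    define xs' where "xs' = (SOME xs. W js N \<tau> w P xs)"
    have "W js N \<tau> w P xs" using adm less by (simp add: W_def js_def)
    then have xs': "W js N \<tau> w P xs'" unfolding xs'_def by (rule someI)
    define ps where "ps = [fst w, snd w, fst P, snd P]"
    have psD: "set ps \<subseteq> D" using w P by (auto simp: ps_def)
    have "(js, N, \<tau>, w, P) \<in> I ps" using \<tau> by (cases w; cases P) (auto simp: I_def ps_def)
    then have "pick (js, N, \<tau>, w, P) \<subseteq> (\<Union>i\<in>I ps. pick i)" by (rule UN_upper)
    then have "comps xs' \<subseteq> h ps"
      using sub(4)[of ps] unfolding xs'_def by (simp add: pick_def)
    then have "comps xs' \<subseteq> D" using cl[OF psD] by blast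
    then have "snd (snd z) \<in> D \<times> D" if "z \<in> set xs'" for z
      using that by (cases z) (auto simp: comps_def)
    then show "\<exists>xs'. admissible (\<Omega> \<inter> (D \<times> D)) N xs' \<and> map (fst \<circ> snd) xs' = map (fst \<circ> snd) xs \<and>
        total_penalty R w xs' + q (P - weighted_steps w xs') < \<tau>"
      using xs' unfolding W_def js_def admissible_def by (intro exI[of _ xs']) blast
  qed
  then show ?thesis using D subspace_closure_rational[OF zero add scale] by blast
qed

section \<open>The threefold product of an Asplund space\<close>

lemma norm_triple_le: "norm (x, y, z) \<le> norm x + norm y + norm z"
  using norm_Pair_le[of x "(y, z)"] norm_Pair_le[of y z] by simp

lemma norm_le_triple: "norm x \<le> norm (x, y, z)" "norm y \<le> norm (x, y, z)" "norm z \<le> norm (x, y, z)"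
  using norm_fst_le[of x "(y, z)"] norm_snd_le[of "(y, z)" x] norm_fst_le[of y z] norm_snd_le[of z y] by simp_all

text \<open>
  Functionals on the product are sums of three functionals on the factor, and products of small covers are
  small covers.
\<close>

lemma asplund_product_separable:
  fixes D :: "'a::banach set" and p :: "'a \<times> 'a \<times> 'a \<Rightarrow> real"
  assumes asplund: "asplund_space TYPE('a)" and D: "countable D" and pR: "\<And>x. p x \<le> R * norm x" and R: "R \<ge> 0"
  shows "seminorm_separable (closure D \<times> closure D \<times> closure D) (linear_minorants p)"
  unfolding seminorm_separable_def
proof (intro allI impI)
  fix \<epsilon> :: real assume \<epsilon>: "\<epsilon> > 0"
  then have "\<epsilon> / 3 > 0" by simp
  from asplund_dual_cover[OF asplund D R this]
  obtain \<C> where \<C>: "countable \<C>" "{f. linear f \<and> (\<forall>x. \<bar>f x\<bar> \<le> R * norm x)} \<subseteq> \<Union>\<C>"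
    "\<forall>C\<in>\<C>. \<forall>f\<in>C. \<forall>g\<in>C. \<forall>d\<in>D. \<bar>f d - g d\<bar> \<le> \<epsilon> / 3 * norm d" by (elim exE conjE)
  define K where "K = linear_minorants p"
  define T where "T = (\<lambda>(C1, C2, C3). {f \<in> K. (\<lambda>x. f (x, 0, 0)) \<in> C1 \<and> (\<lambda>x. f (0, x, 0)) \<in> C2 \<and>
    (\<lambda>x. f (0, 0, x)) \<in> C3})"
  have split: "f (x, y, z) = f (x, 0, 0) + f (0, y, 0) + f (0, 0, z)" if "linear f" for f :: "'a \<times> 'a \<times> 'a \<Rightarrow> real" and x y z
    using linear_add[OF that, of "(x, 0, 0)" "(0, y, 0)"] linear_add[OF that, of "(x, y, 0)" "(0, 0, z)"] by simp
  have close: "\<bar>f x - g x\<bar> \<le> \<epsilon> / 3 * norm x"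
    if C: "C \<in> \<C>" "f \<in> C" "g \<in> C" and bl: "bounded_linear f" "bounded_linear g" and x: "x \<in> closure D" for C f g x
  proof -
    have cont: "continuous_on UNIV (\<lambda>x. \<bar>f x - g x\<bar>)"
      by (intro continuous_intros linear_continuous_on bl)
    have "closed {x. \<bar>f x - g x\<bar> \<le> \<epsilon> / 3 * norm x}"
      by (rule closed_Collect_le[OF cont]) (intro continuous_intros)
    then have "closure D \<subseteq> {x. \<bar>f x - g x\<bar> \<le> \<epsilon> / 3 * norm x}"
      using \<C>(3) C by (intro closure_minimal) auto
    then show ?thesis using x by blast
  qed
  have comp: "bounded_linear (\<lambda>x. f (x, 0, 0))" "bounded_linear (\<lambda>x. f (0, x, 0))" "bounded_linear (\<lambda>x. f (0, 0, x))"
    and comp_in: "(\<lambda>x. f (x, 0, 0)) \<in> \<Union>\<C>" "(\<lambda>x. f (0, x, 0)) \<in> \<Union>\<C>" "(\<lambda>x. f (0, 0, x)) \<in> \<Union>\<C>"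
    if f: "f \<in> K" for f
  proof -
    have lin: "linear f" using f by (simp add: K_def linear_minorants_def)
    have fR: "\<bar>f x\<bar> \<le> R * norm x" for x using linear_minorant_abs_le[OF f[unfolded K_def] pR] .
    have l: "linear (\<lambda>x. f (x, 0, 0))" "linear (\<lambda>x. f (0, x, 0))" "linear (\<lambda>x. f (0, 0, x))"
      by (rule linear_compose[OF _ lin, unfolded o_def], rule linearI, simp_all)+
    have b: "\<bar>f (x, 0, 0)\<bar> \<le> R * norm x" "\<bar>f (0, x, 0)\<bar> \<le> R * norm x" "\<bar>f (0, 0, x)\<bar> \<le> R * norm x" for x
      using fR[of "(x, 0, 0)"] fR[of "(0, x, 0)"] fR[of "(0, 0, x)"] by (simp_all add: norm_Pair)
    show "(\<lambda>x. f (x, 0, 0)) \<in> \<Union>\<C>" "(\<lambda>x. f (0, x, 0)) \<in> \<Union>\<C>" "(\<lambda>x. f (0, 0, x)) \<in> \<Union>\<C>"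
      using \<C>(2) l b by auto
    show "bounded_linear (\<lambda>x. f (x, 0, 0))" "bounded_linear (\<lambda>x. f (0, x, 0))" "bounded_linear (\<lambda>x. f (0, 0, x))"
      using l b by (auto intro!: bounded_linear.intro bounded_linear_axioms.intro exI[of _ R] simp: mult.commute)
  qed
  have "\<bar>f w - g w\<bar> \<le> \<epsilon> * norm w"
    if Cs: "C1 \<in> \<C>" "C2 \<in> \<C>" "C3 \<in> \<C>" and fg: "f \<in> T (C1, C2, C3)" "g \<in> T (C1, C2, C3)"
      and w: "w \<in> closure D \<times> closure D \<times> closure D" for C1 C2 C3 f g w
  proof -
    obtain x y z where xyz: "w = (x, y, z)" "x \<in> closure D" "y \<in> closure D" "z \<in> closure D" using w by auto
    have fK: "f \<in> K" "g \<in> K" using fg by (auto simp: T_def)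
    then have lin: "linear f" "linear g" by (auto simp: K_def linear_minorants_def)
    have "\<bar>f (x, 0, 0) - g (x, 0, 0)\<bar> \<le> \<epsilon> / 3 * norm x"
      using fg by (intro close[OF Cs(1) _ _ comp(1)[OF fK(1)] comp(1)[OF fK(2)] xyz(2)]) (auto simp: T_def)
    moreover have "\<bar>f (0, y, 0) - g (0, y, 0)\<bar> \<le> \<epsilon> / 3 * norm y"
      using fg by (intro close[OF Cs(2) _ _ comp(2)[OF fK(1)] comp(2)[OF fK(2)] xyz(3)]) (auto simp: T_def)
    moreover have "\<bar>f (0, 0, z) - g (0, 0, z)\<bar> \<le> \<epsilon> / 3 * norm z"
      using fg by (intro close[OF Cs(3) _ _ comp(3)[OF fK(1)] comp(3)[OF fK(2)] xyz(4)]) (auto simp: T_def)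
    ultimately have "\<bar>f w - g w\<bar> \<le> \<epsilon> / 3 * norm x + \<epsilon> / 3 * norm y + \<epsilon> / 3 * norm z"
      unfolding xyz(1) split[OF lin(1), of x y z] split[OF lin(2), of x y z] by linarith
    also have "\<dots> \<le> \<epsilon> / 3 * norm w + \<epsilon> / 3 * norm w + \<epsilon> / 3 * norm w"
      unfolding xyz(1) using \<epsilon> by (intro add_mono mult_left_mono norm_le_triple) auto
    finally show ?thesis by simp
  qed
  moreover have "K \<subseteq> \<Union>(T ` (\<C> \<times> \<C> \<times> \<C>))"
  proof
    fix f assume f: "f \<in> K"
    obtain C1 C2 C3 where "C1 \<in> \<C>" "(\<lambda>x. f (x, 0, 0)) \<in> C1" "C2 \<in> \<C>" "(\<lambda>x. f (0, x, 0)) \<in> C2"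
      "C3 \<in> \<C>" "(\<lambda>x. f (0, 0, x)) \<in> C3" using comp_in[OF f] unfolding Union_iff by (elim bexE)
    then show "f \<in> \<Union>(T ` (\<C> \<times> \<C> \<times> \<C>))"
      using f by (intro UN_I[of "(C1, C2, C3)"]) (auto simp: T_def)
  qed
  moreover have "countable (T ` (\<C> \<times> \<C> \<times> \<C>))" using \<C>(1) by (intro countable_image countable_SIGMA)
  ultimately have 1: "countable (T ` (\<C> \<times> \<C> \<times> \<C>))" "K \<subseteq> \<Union>(T ` (\<C> \<times> \<C> \<times> \<C>))"
    "\<forall>C\<in>T ` (\<C> \<times> \<C> \<times> \<C>). \<forall>f\<in>C. \<forall>g\<in>C. \<forall>y\<in>closure D \<times> closure D \<times> closure D. \<bar>f y - g y\<bar> \<le> \<epsilon> * norm y"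
    by (auto simp del: mem_Times_iff)
  show "\<exists>\<C>. countable \<C> \<and> linear_minorants p \<subseteq> \<Union>\<C> \<and>
      (\<forall>C\<in>\<C>. \<forall>f\<in>C. \<forall>g\<in>C. \<forall>y\<in>closure D \<times> closure D \<times> closure D. \<bar>f y - g y\<bar> \<le> \<epsilon> * norm y)"
    unfolding K_def[symmetric] by (rule exI[of _ "T ` (\<C> \<times> \<C> \<times> \<C>)"], intro conjI 1)
qed

section \<open>Ekeland points\<close>

text \<open>
  The zeroth perturbation has weight \<open>m\<close> and all others together have weight \<open>r\<close>. So the coefficient
  \<open>2 * \<mu> 0 - suminf \<mu>\<close> of the distance estimate is \<open>m - r\<close>, as close to the total weight as desired.
\<close>

lemma borwein_preiss_weights:
  fixes m r :: real
  assumes "0 < r" "r \<le> m"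
  shows "\<exists>\<mu>::nat \<Rightarrow> real. (\<forall>i. \<mu> i > 0) \<and> summable \<mu> \<and> decseq \<mu> \<and> \<mu> 0 = m \<and> suminf \<mu> = m + r"
proof -
  define \<mu> where "\<mu> = (\<lambda>i::nat. if i = 0 then m else r * (1 / 2) ^ i)"
  have 1: "\<forall>i. \<mu> i > 0" "\<mu> 0 = m" using assms by (simp_all add: \<mu>_def)
  have "(\<lambda>i. \<mu> (Suc i)) sums (r * 1)"
    using sums_mult[OF power_half_series, of r] by (simp add: \<mu>_def)
  then have "\<mu> sums (r + m)" using sums_Suc[of \<mu> "r * 1"] by (simp add: \<mu>_def)
  then have 2: "summable \<mu>" "suminf \<mu> = m + r" by (auto simp: sums_iff)
  have "decseq \<mu>"
  proof (rule decseq_SucI)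
    fix i
    show "\<mu> (Suc i) \<le> \<mu> i"
    proof (cases i)
      case 0
      then show ?thesis using assms by (simp add: \<mu>_def)
    next
      case (Suc j)
      have "(1 / 2 :: real) ^ Suc i \<le> (1 / 2) ^ i" by (rule power_decreasing) auto
      then show ?thesis using assms(1) Suc by (simp add: \<mu>_def)
    qed
  qed
  then show ?thesis using 1 2 by blast
qed

text \<open>
  Perturbing by \<open>p\<close> itself turns the sum of perturbations into a single cone at the minimizer, by the
  triangle inequality.
\<close>

corollary ekeland:
  fixes p f :: "'z::banach \<Rightarrow> real"
  assumes p: "sublinear p" and sym: "\<And>x. p (- x) = p x"
    and pR: "\<And>x. p x \<le> R * norm x" and pB: "\<And>x. norm x \<le> B * p x" and R: "R \<ge> 0" and B: "B \<ge> 0"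
    and S: "closed S" "x0 \<in> S" and f: "continuous_on S f" "\<And>y. y \<in> S \<Longrightarrow> m \<le> f y"
    and \<epsilon>: "0 < \<epsilon>0" "\<epsilon>0 < \<epsilon>1"
  shows "\<exists>x\<in>S. \<epsilon>0 * p (x - x0) \<le> f x0 - f x \<and> (\<forall>y\<in>S. f x \<le> f y + \<epsilon>1 * p (y - x))"
proof -
  have r: "0 < (\<epsilon>1 - \<epsilon>0) / 2" "(\<epsilon>1 - \<epsilon>0) / 2 \<le> (\<epsilon>0 + \<epsilon>1) / 2" using \<epsilon> by auto
  from borwein_preiss_weights[OF r] obtain \<mu> :: "nat \<Rightarrow> real"
    where \<mu>: "\<forall>i. \<mu> i > 0" "summable \<mu>" "decseq \<mu>" "\<mu> 0 = (\<epsilon>0 + \<epsilon>1) / 2"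
      "suminf \<mu> = (\<epsilon>0 + \<epsilon>1) / 2 + (\<epsilon>1 - \<epsilon>0) / 2" by (elim exE conjE)
  have \<mu>_pos: "\<mu> i > 0" for i using \<mu>(1) by simp
  have total: "suminf \<mu> = \<epsilon>1" unfolding \<mu>(5) by (simp add: field_simps)
  have gap: "2 * \<mu> 0 - suminf \<mu> = \<epsilon>0" unfolding total \<mu>(4) by (simp add: field_simps)
  have lip: "p x \<le> p y + p (x - y)" for x y using sublinear_diff[OF p, of x y] by simp
  have "\<exists>a xb. a 0 = x0 \<and> xb \<in> S \<and> (\<forall>x. summable (\<lambda>i. \<mu> i * p (x - a i))) \<and>
    (\<forall>y\<in>S. f xb + (\<Sum>i. \<mu> i * p (xb - a i)) \<le> f y + (\<Sum>i. \<mu> i * p (y - a i))) \<and>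
    (2 * \<mu> 0 - suminf \<mu>) * p (xb - x0) \<le> f x0 - f xb + \<mu> 0 * (\<lambda>_. 0) 0"
    by (rule borwein_preiss[where \<kappa> = "\<lambda>_. 0" and \<theta> = "\<lambda>_. p", OF p sym pR pB R B \<mu>_pos \<mu>(2,3)
          _ _ _ _ lip S f]) simp_all
  then obtain a xb where xb: "xb \<in> S" and summ: "\<And>x. summable (\<lambda>i. \<mu> i * p (x - a i))"
    and min: "\<And>y. y \<in> S \<Longrightarrow> f xb + (\<Sum>i. \<mu> i * p (xb - a i)) \<le> f y + (\<Sum>i. \<mu> i * p (y - a i))"
    and close: "\<epsilon>0 * p (xb - x0) \<le> f x0 - f xb"
    unfolding gap by auto
  have "f xb \<le> f y + \<epsilon>1 * p (y - xb)" if y: "y \<in> S" for y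
  proof -
    have "(\<Sum>i. \<mu> i * p (y - a i)) \<le> (\<Sum>i. \<mu> i * p (xb - a i) + \<mu> i * p (y - xb))"
    proof (rule suminf_le[OF _ summ summable_add[OF summ summable_mult2[OF \<mu>(2)]]])
      fix i
      have "p (y - a i) \<le> p (xb - a i) + p (y - xb)" using lip[of "y - a i" "xb - a i"] by simp
      then have "\<mu> i * p (y - a i) \<le> \<mu> i * (p (xb - a i) + p (y - xb))"
        using \<mu>_pos[of i] by (intro mult_left_mono) auto
      then show "\<mu> i * p (y - a i) \<le> \<mu> i * p (xb - a i) + \<mu> i * p (y - xb)" by (simp add: distrib_left)
    qed
    also have "\<dots> = (\<Sum>i. \<mu> i * p (xb - a i)) + \<epsilon>1 * p (y - xb)"
      using suminf_add[OF summ[of xb] summable_mult2[OF \<mu>(2), of "p (y - xb)"]]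
        suminf_mult2[OF \<mu>(2), of "p (y - xb)"] total by simp
    finally show ?thesis using min[OF y] by linarith
  qed
  then show ?thesis using xb close by blast
qed

section \<open>The gap function and its smooth perturbed minima\<close>

lemma sublinear_max: "sublinear p \<Longrightarrow> sublinear q \<Longrightarrow> sublinear (\<lambda>x. max (p x) (q x))"
proof (rule sublinearI)
  assume pq: "sublinear p" "sublinear q"
  fix x y
  show "max (p (x + y)) (q (x + y)) \<le> max (p x) (q x) + max (p y) (q y)"
    using sublinear_add[OF pq(1), of x y] sublinear_add[OF pq(2), of x y] by (simp add: max_def)
next
  assume pq: "sublinear p" "sublinear q"
  fix c :: real and x assume "c > 0"
  then show "max (p (c *\<^sub>R x)) (q (c *\<^sub>R x)) \<le> c * max (p x) (q x)"
    using sublinear_scale[OF pq(1), of c x] sublinear_scale[OF pq(2), of c x]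
    by (simp add: max_mult_distrib_left[symmetric] max_def)
qed

lemma sublinear_norm_linear: "linear T \<Longrightarrow> sublinear (\<lambda>x. norm (T x))"
  by (rule sublinearI) (simp_all add: linear_add linear_scale norm_triangle_ineq)

lemma sublinear_plus: "sublinear p \<Longrightarrow> sublinear q \<Longrightarrow> sublinear (\<lambda>x. p x + q x)"
proof (rule sublinearI)
  assume pq: "sublinear p" "sublinear q"
  show "p (x + y) + q (x + y) \<le> p x + q x + (p y + q y)" for x y
    using sublinear_add[OF pq(1), of x y] sublinear_add[OF pq(2), of x y] by simp
  show "p (t *\<^sub>R x) + q (t *\<^sub>R x) \<le> t * (p x + q x)" if "t > 0" for t x
    using sublinear_scale[OF pq(1), of t x] sublinear_scale[OF pq(2), of t x] that
    by (simp add: distrib_left)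
qed

lemma sublinear_times: "sublinear p \<Longrightarrow> c \<ge> 0 \<Longrightarrow> sublinear (\<lambda>x. c * p x)"
proof (rule sublinearI)
  assume p: "sublinear p" "c \<ge> 0"
  show "c * p (x + y) \<le> c * p x + c * p y" for x y
    using mult_left_mono[OF sublinear_add[OF p(1), of x y] p(2)] by (simp add: distrib_left)
  show "c * p (t *\<^sub>R x) \<le> t * (c * p x)" if "t > 0" for t x
    using sublinear_scale[OF p(1), of t x] that by simp
qed

text \<open>
  It vanishes exactly on the diagonal, and the dual norm on \<open>(x*, y*, - x* - y*)\<close> is \<open>\<parallel>x*\<parallel> + \<parallel>y*\<parallel>\<close>.
\<close>

definition gap :: "'a::real_normed_vector \<times> 'a \<times> 'a \<Rightarrow> real" where
  "gap w = max (norm (fst w - snd (snd w))) (norm (fst (snd w) - snd (snd w)))"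

definition box_norm :: "real \<Rightarrow> 'a::real_normed_vector \<times> 'a \<times> 'a \<Rightarrow> real" where
  "box_norm \<gamma> w = max (norm (snd (snd w))) (\<gamma> * max (norm (fst w)) (norm (fst (snd w))))"

text \<open>
  A functional below this norm satisfies \<open>f (x, x) \<le> \<sigma> \<parallel>x\<parallel>\<close>; that is, its two components have a sum of
  norm at most \<open>\<sigma>\<close>. Conversely, a functional bounded by \<open>\<sigma>\<close> on the diagonal and by \<open>R\<close> everywhere lies below it.
  The bound on the sum thus has a formula that does not refer to a subspace.
\<close>

definition diagonal_norm :: "real \<Rightarrow> real \<Rightarrow> 'a::real_normed_vector \<times> 'a \<Rightarrow> real" where
  "diagonal_norm \<sigma> R v = \<sigma> * norm ((1 / 2) *\<^sub>R (fst v + snd v)) + R * norm (fst v - snd v)"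

lemma gap_properties:
  shows sublinear_gap: "sublinear (gap :: 'a::real_normed_vector \<times> 'a \<times> 'a \<Rightarrow> real)" and gap_minus: "gap (- w) = gap w" and gap_le: "gap w \<le> 2 * norm w"
proof -
  show "sublinear gap"
    unfolding gap_def
    by (rule sublinear_max; rule sublinear_norm_linear; rule linearI)
      (simp_all add: scaleR_diff_right)
  show "gap (- w) = gap w" by (simp add: gap_def norm_minus_commute)
  obtain x y z where w: "w = (x, y, z)" by (cases w)
  show "gap w \<le> 2 * norm w"
    using norm_triangle_ineq4[of x z] norm_triangle_ineq4[of y z] norm_le_triple[where x = x and y = y and z = z]
    unfolding gap_def w by simp
qed

lemma box_norm_properties:
  assumes \<gamma>: "0 < \<gamma>" "\<gamma> \<le> 1"
  shows sublinear_box_norm: "sublinear (box_norm \<gamma>)" and box_norm_minus: "box_norm \<gamma> (- w) = box_norm \<gamma> w"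
    and box_norm_le: "box_norm \<gamma> w \<le> norm w" and norm_le_box_norm: "norm w \<le> (1 + 2 / \<gamma>) * box_norm \<gamma> w"
proof -
  show "sublinear (box_norm \<gamma>)"
    unfolding box_norm_def using \<gamma>
    by (intro sublinear_max sublinear_times sublinear_norm_linear linearI) simp_all
  show "box_norm \<gamma> (- w) = box_norm \<gamma> w" by (simp add: box_norm_def)
  obtain x y z where w: "w = (x, y, z)" by (cases w)
  note n = norm_le_triple[where x = x and y = y and z = z]
  have "\<gamma> * max (norm x) (norm y) \<le> 1 * norm w" unfolding w using \<gamma> n by (intro mult_mono) (auto simp: le_max_iff_disj)
  then show "box_norm \<gamma> w \<le> norm w" using n unfolding box_norm_def w by simp
  have b: "norm z \<le> box_norm \<gamma> w" "\<gamma> * max (norm x) (norm y) \<le> box_norm \<gamma> w" by (simp_all add: box_norm_def w)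
  have "max (norm x) (norm y) \<le> box_norm \<gamma> w / \<gamma>" unfolding pos_le_divide_eq[OF \<gamma>(1)] using b(2)
    by (simp only: mult.commute)
  then have "norm x + norm y + norm z \<le> box_norm \<gamma> w / \<gamma> + box_norm \<gamma> w / \<gamma> + box_norm \<gamma> w"
    using b(1) by (intro add_mono) auto
  then show "norm w \<le> (1 + 2 / \<gamma>) * box_norm \<gamma> w"
    using norm_triple_le[of x y z] unfolding w by (simp add: algebra_simps)
qed

lemma upper_frechet_add:
  assumes "upper_frechet Y F x f" "upper_frechet Y G x g"
  shows "upper_frechet Y (\<lambda>x. F x + G x) x (\<lambda>h. f h + g h)"
  unfolding upper_frechet_def
proof (intro conjI allI impI)
  show "linear (\<lambda>h. f h + g h)" using assms by (auto simp: upper_frechet_def intro: linear_compose_add)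
  fix \<eta> :: real assume "\<eta> > 0"
  then have "\<eta> / 2 > 0" by simp
  then have "\<forall>\<^sub>F h in nhds 0. h \<in> Y \<longrightarrow> F (x + h) \<le> F x + f h + \<eta> / 2 * norm h"
      "\<forall>\<^sub>F h in nhds 0. h \<in> Y \<longrightarrow> G (x + h) \<le> G x + g h + \<eta> / 2 * norm h"
    using assms unfolding upper_frechet_def by blast+
  then show "\<forall>\<^sub>F h in nhds 0. h \<in> Y \<longrightarrow> F (x + h) + G (x + h) \<le> F x + G x + (f h + g h) + \<eta> * norm h"
    by eventually_elim (auto simp: field_simps)
qed

lemma upper_frechet_times:
  assumes f: "upper_frechet Y F x f" and c: "c > 0"
  shows "upper_frechet Y (\<lambda>x. c * F x) x (\<lambda>h. c * f h)"
  unfolding upper_frechet_def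
proof (intro conjI allI impI)
  have "linear f" using f by (simp add: upper_frechet_def)
  then show "linear (\<lambda>h. c * f h)"
    by (intro linearI) (simp_all add: linear_add linear_scale distrib_left)
  fix \<eta> :: real assume "\<eta> > 0"
  then have "\<eta> / c > 0" using c by simp
  then have "\<forall>\<^sub>F h in nhds 0. h \<in> Y \<longrightarrow> F (x + h) \<le> F x + f h + \<eta> / c * norm h"
    using f unfolding upper_frechet_def by blast
  then show "\<forall>\<^sub>F h in nhds 0. h \<in> Y \<longrightarrow> c * F (x + h) \<le> c * F x + c * f h + \<eta> * norm h"
  proof eventually_elim
    case (elim h)
    show ?case
    proof
      assume "h \<in> Y"
      then have "c * F (x + h) \<le> c * (F x + f h + \<eta> / c * norm h)"
        using elim c by (intro mult_left_mono) auto
      then show "c * F (x + h) \<le> c * F x + c * f h + \<eta> * norm h" using c by (simp add: distrib_left)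
    qed
  qed
qed

lemma upper_frechet_shift:
  "upper_frechet Y F (x - c) f \<Longrightarrow> upper_frechet Y (\<lambda>x. F (x - c)) x f"
  by (simp add: upper_frechet_def algebra_simps)

lemma upper_frechet_minimum:
  assumes f: "upper_frechet Y F x f" and min: "\<And>y. y \<in> S \<Longrightarrow> F x \<le> F y" and c: "c > 0"
  shows "\<exists>\<delta>>0. \<forall>y\<in>S. y - x \<in> Y \<longrightarrow> norm (y - x) < \<delta> \<longrightarrow> - c * norm (y - x) \<le> f (y - x)"
proof -
  have "\<forall>\<^sub>F h in nhds 0. h \<in> Y \<longrightarrow> F (x + h) \<le> F x + f h + c * norm h"
    using f c unfolding upper_frechet_def by blast
  then obtain \<delta> where \<delta>: "\<delta> > 0" "\<And>h. norm h < \<delta> \<Longrightarrow> h \<in> Y \<Longrightarrow> F (x + h) \<le> F x + f h + c * norm h"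
    unfolding eventually_nhds_metric by (auto simp: dist_norm)
  have "- c * norm (y - x) \<le> f (y - x)" if "y \<in> S" "y - x \<in> Y" "norm (y - x) < \<delta>" for y
    using \<delta>(2)[OF that(3,2)] min[OF that(1)] by simp
  then show ?thesis using \<delta>(1) by blast
qed

text \<open>
  At \<open>pt\<close> the function \<open>gap (w - c0) + \<epsilon>1 * box_norm \<gamma> (w - pt)\<close> is minimal on \<open>S\<close>. Replacing both terms
  by smooth approximants at distance \<open>\<kappa>\<close>, and adding a smooth perturbation of slope at most \<open>\<eta>\<close>, moves the
  minimizer within \<open>Y\<close> by a distance of order \<open>\<kappa> / \<eta>\<close>. As \<open>gap (pt - c0)\<close> is positive, \<open>\<kappa>\<close> can be taken so small that \<open>gap\<close>
  stays positive and its approximate derivative \<open>\<Lambda>1\<close> is almost norming there.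
\<close>

lemma smooth_perturbed_minimum:
  fixes Y :: "'a::banach set" and c0 pt :: "'a \<times> 'a \<times> 'a"
  assumes S: "closed S" and Y: "closed Y" "subspace Y"
    and sep: "\<And>p R. (\<And>x. p x \<le> R * norm x) \<Longrightarrow> R \<ge> 0 \<Longrightarrow>
        seminorm_separable (Y \<times> Y \<times> Y) (linear_minorants p)"
    and \<gamma>: "0 < \<gamma>" "\<gamma> \<le> 1" and \<epsilon>1: "\<epsilon>1 > 0"
    and pt: "pt \<in> S" "pt \<in> Y \<times> Y \<times> Y"
    and pos: "gap (pt - c0) > 0"
    and ekeland: "\<And>w. w \<in> S \<Longrightarrow> gap (pt - c0) \<le> gap (w - c0) + \<epsilon>1 * box_norm \<gamma> (w - pt)"
    and r: "r > 0" and \<eta>: "0 < \<eta>" "\<eta> \<le> 1"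
  shows "\<exists>w \<in> S \<inter> Y \<times> Y \<times> Y. \<exists>\<Lambda>1 \<in> linear_minorants gap. \<exists>\<Lambda>2 \<in> linear_minorants (box_norm \<gamma>).
    \<exists>\<Lambda>3 \<in> linear_minorants (\<lambda>x. \<eta> * norm x).
    norm (w - pt) < r \<and> gap (w - c0) > 0 \<and> \<Lambda>1 (w - c0) \<ge> (1 - \<eta>) * gap (w - c0) \<and>
    (\<forall>c>0. \<exists>\<delta>>0. \<forall>v \<in> S \<inter> Y \<times> Y \<times> Y. norm (v - w) < \<delta> \<longrightarrow>
        - c * norm (v - w) \<le> \<Lambda>1 (v - w) + \<epsilon>1 * \<Lambda>2 (v - w) + \<Lambda>3 (v - w))"
proof -
  define YZ where "YZ = Y \<times> Y \<times> Y"
  have YZ: "closed YZ" unfolding YZ_def by (intro closed_Times Y)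
  have YZ_sub: "subspace YZ" unfolding YZ_def by (intro subspace_Times Y)
  define m where "m = gap (pt - c0)"
  have m: "m > 0" using pos by (simp add: m_def)
  define r' where "r' = min r (m / 4)"
  have r': "r' > 0" "r' \<le> r" "r' \<le> m / 4" using r m by (auto simp: r'_def)
  \<comment> \<open>the first bound keeps \<open>\<Lambda>1\<close> almost norming, the second keeps the minimizer within \<open>r'\<close> of \<open>pt\<close>\<close>
  define \<kappa> where "\<kappa> = min (\<eta> * m / 2) (\<eta> * r' / (4 * (2 + \<epsilon>1)))"
  have "\<kappa> > 0" using \<eta> m r' \<epsilon>1 by (simp add: \<kappa>_def)
  moreover have "\<kappa> \<le> \<eta> * m / 2" unfolding \<kappa>_def by (rule min.cobounded1)
  ultimately have \<kappa>: "\<kappa> > 0" "\<kappa> \<le> \<eta> * m / 2" by this+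
  have "\<kappa> \<le> \<eta> * r' / (4 * (2 + \<epsilon>1))" by (simp add: \<kappa>_def)
  then have \<kappa>r: "\<kappa> * (4 * (2 + \<epsilon>1)) \<le> \<eta> * r'" using \<epsilon>1 by (simp add: pos_le_divide_eq)
  have gap: "sublinear (gap :: 'a \<times> 'a \<times> 'a \<Rightarrow> real)" "gap x \<le> 2 * norm x" for x :: "'a \<times> 'a \<times> 'a"
    by (rule sublinear_gap, rule gap_le)
  have box: "sublinear (box_norm \<gamma> :: 'a \<times> 'a \<times> 'a \<Rightarrow> real)" "box_norm \<gamma> x \<le> norm x"
    for x :: "'a \<times> 'a \<times> 'a"
    by (rule sublinear_box_norm[OF \<gamma>], rule box_norm_le[OF \<gamma>])
  have sepZ: "seminorm_separable YZ (linear_minorants gap)" "seminorm_separable YZ (linear_minorants (box_norm \<gamma>))"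
      "seminorm_separable YZ (linear_minorants norm)"
    unfolding YZ_def
    using sep[of gap 2] gap(2) sep[of "box_norm \<gamma>" 1] box(2) sep[of norm 1] by simp_all
  from smooth_approximation[OF gap(1) gap(2) _ YZ_sub sepZ(1) \<kappa>(1)]
  obtain G where G: "smooth_approximant YZ gap \<kappa> G" by auto
  have box1: "box_norm \<gamma> x \<le> 1 * norm x" for x :: "'a \<times> 'a \<times> 'a" using box(2)[of x] by simp
  from smooth_approximation[OF box(1) box1 _ YZ_sub sepZ(2) \<kappa>(1)]
  obtain H where H: "smooth_approximant YZ (box_norm \<gamma>) \<kappa> H" by auto
  have G1: "gap x - \<kappa> \<le> G x" "G x \<le> gap x" "G x \<le> G y + gap (x - y)" for x y
    using G unfolding smooth_approximant_def by blast+
  have H1: "box_norm \<gamma> x - \<kappa> \<le> H x" "H x \<le> box_norm \<gamma> x" "H x \<le> H y + box_norm \<gamma> (x - y)" for x y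
    using H unfolding smooth_approximant_def by blast+
  define \<kappa>s where "\<kappa>s i = \<kappa> * (1 / 2) ^ i" for i :: nat
  have \<kappa>s: "\<kappa>s i > 0" for i using \<kappa>(1) by (simp add: \<kappa>s_def)
  have \<kappa>s_sum: "summable \<kappa>s" unfolding \<kappa>s_def by (intro summable_mult summable_geometric) simp
  have "\<forall>i. \<exists>\<theta>. smooth_approximant YZ (norm :: 'a \<times> 'a \<times> 'a \<Rightarrow> real) (\<kappa>s i) \<theta>"
  proof
    show "\<exists>\<theta>. smooth_approximant YZ (norm :: 'a \<times> 'a \<times> 'a \<Rightarrow> real) (\<kappa>s i) \<theta>" for i
      by (rule smooth_approximation[where R = 1, OF sublinear_norm _ _ YZ_sub sepZ(3) \<kappa>s]) simp_all
  qed
  from choice[OF this] obtain \<theta>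
    where \<theta>: "\<forall>i. smooth_approximant YZ (norm :: 'a \<times> 'a \<times> 'a \<Rightarrow> real) (\<kappa>s i) (\<theta> i)" by (elim exE)
  have \<theta>_bounds: "norm x - \<kappa>s i \<le> \<theta> i x" "\<theta> i x \<le> norm x" "\<theta> i x \<le> \<theta> i y + norm (x - y)" for i x y
    using \<theta> unfolding smooth_approximant_def by blast+
  have w: "0 < \<eta> / 4" "\<eta> / 4 \<le> 3 * \<eta> / 4" using \<eta> by auto
  from borwein_preiss_weights[OF w] obtain \<mu> :: "nat \<Rightarrow> real" where \<mu>: "\<forall>i. \<mu> i > 0" "summable \<mu>" "decseq \<mu>"
      "\<mu> 0 = 3 * \<eta> / 4" "suminf \<mu> = 3 * \<eta> / 4 + \<eta> / 4" by (elim exE conjE)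
  have \<mu>_pos: "\<mu> i > 0" for i using \<mu>(1) by simp
  have total: "suminf \<mu> = \<eta>" "2 * \<mu> 0 - suminf \<mu> = \<eta> / 2" using \<mu>(4,5) by simp_all
  define f where "f w = G (w - c0) + \<epsilon>1 * H (w - pt)" for w
  have f_lower: "f w \<ge> m - \<kappa> * (1 + \<epsilon>1)" if "w \<in> S" for w
  proof -
    have "\<epsilon>1 * (box_norm \<gamma> (w - pt) - \<kappa>) \<le> \<epsilon>1 * H (w - pt)" using H1(1) \<epsilon>1 by (intro mult_left_mono) auto
    moreover have "gap (w - c0) - \<kappa> \<le> G (w - c0)" by (rule G1)
    ultimately show ?thesis using ekeland[OF that] by (simp add: f_def m_def algebra_simps)
  qed
  have cont: "continuous_on UNIV F" if F: "\<And>x y. F x \<le> F y + p (x - y)" "\<And>x. p x \<le> R * norm x" "R \<ge> 0"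
    for F p :: "'a \<times> 'a \<times> 'a \<Rightarrow> real" and R
  proof -
    have "R-lipschitz_on UNIV F"
    proof (rule lipschitz_onI)
      fix x y
      show "dist (F x) (F y) \<le> R * dist x y"
        using F(1)[of x y] F(1)[of y x] F(2)[of "x - y"] F(2)[of "y - x"]
        by (simp add: dist_norm norm_minus_commute abs_le_iff)
    qed (rule F(3))
    then show ?thesis by (rule lipschitz_on_continuous_on)
  qed
  have G_cont: "continuous_on UNIV G" by (rule cont[of G gap 2, OF G1(3) gap(2)]) simp
  have H_cont: "continuous_on UNIV H" by (rule cont[of H "box_norm \<gamma>" 1, OF H1(3) box1]) simp
  have shift: "continuous_on (S \<inter> YZ) (\<lambda>w. w - c)" for c :: "'a \<times> 'a \<times> 'a"
    by (intro continuous_intros)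
  have f_cont: "continuous_on (S \<inter> YZ) f"
    unfolding f_def
    by (rule continuous_on_add[OF continuous_on_compose2[OF G_cont shift subset_UNIV]
          continuous_on_mult_left[OF continuous_on_compose2[OF H_cont shift subset_UNIV]]])
  have pt': "pt \<in> S \<inter> YZ" using pt by (simp add: YZ_def)
  have "\<exists>a xb. a 0 = pt \<and> xb \<in> S \<inter> YZ \<and> (\<forall>x. summable (\<lambda>i. \<mu> i * \<theta> i (x - a i))) \<and>
    (\<forall>y\<in>S \<inter> YZ. f xb + (\<Sum>i. \<mu> i * \<theta> i (xb - a i)) \<le> f y + (\<Sum>i. \<mu> i * \<theta> i (y - a i))) \<and>
    (2 * \<mu> 0 - suminf \<mu>) * norm (xb - pt) \<le> f pt - f xb + \<mu> 0 * \<kappa>s 0"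
    by (rule borwein_preiss[where p = norm and R = 1 and B = 1 and m = "m - \<kappa> * (1 + \<epsilon>1)" and \<kappa> = \<kappa>s,
          OF sublinear_norm _ _ _ _ _ \<mu>_pos \<mu>(2,3) less_imp_le[OF \<kappa>s] \<kappa>s_sum \<theta>_bounds closed_Int[OF S YZ] pt' f_cont])
      (use f_lower in simp_all)
  then obtain a w where w: "w \<in> S \<inter> YZ" and summ_all: "\<forall>x. summable (\<lambda>i. \<mu> i * \<theta> i (x - a i))"
    and min_all: "\<forall>y\<in>S \<inter> YZ. f w + (\<Sum>i. \<mu> i * \<theta> i (w - a i)) \<le> f y + (\<Sum>i. \<mu> i * \<theta> i (y - a i))"
    and close0: "(2 * \<mu> 0 - suminf \<mu>) * norm (w - pt) \<le> f pt - f w + \<mu> 0 * \<kappa>s 0"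
    by (elim exE conjE)
  have summ: "summable (\<lambda>i. \<mu> i * \<theta> i (x - a i))" for x using summ_all by (rule spec)
  have min: "f w + (\<Sum>i. \<mu> i * \<theta> i (w - a i)) \<le> f y + (\<Sum>i. \<mu> i * \<theta> i (y - a i))"
    if "y \<in> S \<inter> YZ" for y using min_all that by (rule bspec)
  have close: "\<eta> / 2 * norm (w - pt) \<le> f pt - f w + 3 * \<eta> / 4 * \<kappa>"
    using close0[unfolded total(2), unfolded \<mu>(4)] by (simp add: \<kappa>s_def)
  have "H 0 \<le> 0" using H1(2)[of 0] by (simp add: box_norm_def)
  then have "\<epsilon>1 * H 0 \<le> 0" using \<epsilon>1 by (simp add: mult_le_0_iff)
  then have "f pt \<le> m" using G1(2)[of "pt - c0"] by (simp add: f_def m_def)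
  moreover have "f w \<ge> m - \<kappa> * (1 + \<epsilon>1)" using f_lower w by simp
  moreover have "3 * \<eta> / 4 * \<kappa> \<le> 1 * \<kappa>" using \<eta> \<kappa>(1) by (intro mult_right_mono) auto
  ultimately have "\<eta> / 2 * norm (w - pt) \<le> \<kappa> * (2 + \<epsilon>1)" using close by (simp add: algebra_simps)
  then have "\<eta> * norm (w - pt) \<le> \<eta> * (r' / 2)" using \<kappa>r by (simp add: algebra_simps)
  then have "norm (w - pt) \<le> r' / 2" using \<eta> by simp
  then have near: "norm (w - pt) < r'" using r'(1) by simp
  have "gap (pt - c0) \<le> gap (w - c0) + gap (pt - w)"
    using sublinear_add[OF gap(1), of "w - c0" "pt - w"] by simp
  moreover have "gap (pt - w) \<le> 2 * norm (w - pt)" using gap(2)[of "pt - w"] by (simp add: norm_minus_commute)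
  ultimately have gap_w: "gap (w - c0) \<ge> m / 2" using near r'(3) by (simp add: m_def)
  have "\<kappa> \<le> \<eta> * gap (w - c0)" 
  proof -
    have "\<eta> * (m / 2) \<le> \<eta> * gap (w - c0)" using gap_w \<eta> by (intro mult_left_mono) auto
    then show ?thesis using \<kappa>(2) by simp
  qed
  obtain \<Lambda>1 where \<Lambda>1: "\<Lambda>1 \<in> linear_minorants gap" "upper_frechet YZ G (w - c0) \<Lambda>1" "\<Lambda>1 (w - c0) \<ge> gap (w - c0) - \<kappa>"
    using G unfolding smooth_approximant_def by blast
  obtain \<Lambda>2 where \<Lambda>2: "\<Lambda>2 \<in> linear_minorants (box_norm \<gamma>)" "upper_frechet YZ H (w - pt) \<Lambda>2"
    using H unfolding smooth_approximant_def by blast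
  have "\<forall>i. \<exists>f. f \<in> linear_minorants norm \<and> upper_frechet YZ (\<theta> i) (w - a i) f"
    using \<theta> unfolding smooth_approximant_def by blast
  from choice[OF this] obtain fs where fs: "\<forall>i. fs i \<in> linear_minorants norm \<and> upper_frechet YZ (\<theta> i) (w - a i) (fs i)"
    by (elim exE)
  define \<Lambda>3 where "\<Lambda>3 z = (\<Sum>i. \<mu> i * fs i z)" for z
  have \<Lambda>3: "upper_frechet YZ (\<lambda>x. \<Sum>i. \<mu> i * \<theta> i (x - a i)) w \<Lambda>3" "\<Lambda>3 z \<le> \<eta> * norm z" for z
  proof -
    have fs1: "fs i \<in> linear_minorants norm" and fs2: "upper_frechet YZ (\<theta> i) (w - a i) (fs i)" for i
      using fs by blast+
    have n1: "norm x \<le> 1 * norm x" for x :: "'a \<times> 'a \<times> 'a" by simp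
    note sum = upper_frechet_sum[where \<theta> = \<theta> and a = a and x = w and f = fs,
        OF n1 zero_le_one less_imp_le[OF \<mu>_pos] \<mu>(2) \<theta>_bounds(3) summ fs1 fs2]
    show "upper_frechet YZ (\<lambda>x. \<Sum>i. \<mu> i * \<theta> i (x - a i)) w \<Lambda>3"
      unfolding \<Lambda>3_def[abs_def] by (rule sum(1))
    show "\<Lambda>3 z \<le> \<eta> * norm z" for z
      using sum(2)[of z] unfolding \<Lambda>3_def total(1) .
  qed
  then have \<Lambda>3_lm: "\<Lambda>3 \<in> linear_minorants (\<lambda>x. \<eta> * norm x)"
    by (simp add: linear_minorants_def upper_frechet_def)
  have uf: "upper_frechet YZ (\<lambda>x. f x + (\<Sum>i. \<mu> i * \<theta> i (x - a i))) w (\<lambda>h. \<Lambda>1 h + \<epsilon>1 * \<Lambda>2 h + \<Lambda>3 h)"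
    unfolding f_def
    by (intro upper_frechet_add upper_frechet_times upper_frechet_shift \<Lambda>1(2) \<Lambda>2(2) \<Lambda>3(1) \<epsilon>1)
  have "\<exists>\<delta>>0. \<forall>v \<in> S \<inter> YZ. norm (v - w) < \<delta> \<longrightarrow>
        - c * norm (v - w) \<le> \<Lambda>1 (v - w) + \<epsilon>1 * \<Lambda>2 (v - w) + \<Lambda>3 (v - w)" if c: "c > 0" for c
  proof -
    from upper_frechet_minimum[OF uf min c] obtain \<delta> where "\<delta> > 0" "\<forall>v\<in>S \<inter> YZ. v - w \<in> YZ \<longrightarrow> norm (v - w) < \<delta> \<longrightarrow>
        - c * norm (v - w) \<le> \<Lambda>1 (v - w) + \<epsilon>1 * \<Lambda>2 (v - w) + \<Lambda>3 (v - w)" by blast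
    moreover have "v - w \<in> YZ" if "v \<in> S \<inter> YZ" for v using subspace_diff[OF YZ_sub] that w by blast
    ultimately show ?thesis by blast
  qed
  moreover have "\<Lambda>1 (w - c0) \<ge> (1 - \<eta>) * gap (w - c0)"
    using \<Lambda>1(3) \<open>\<kappa> \<le> \<eta> * gap (w - c0)\<close> by (simp add: algebra_simps)
  moreover have "gap (w - c0) > 0" using gap_w m by simp
  moreover have "norm (w - pt) < r" using near r'(2) by simp
  ultimately show ?thesis
    using w \<Lambda>1(1) \<Lambda>2(1) \<Lambda>3_lm unfolding YZ_def by blast
qed

section \<open>From stationarity on the product to a pair of opposite functionals\<close>

lemma linear_combination3:
  fixes f g h :: "'z::real_vector \<Rightarrow> real"
  assumes f: "linear f" and g: "linear g" and h: "linear h"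
  shows "linear (\<lambda>z. f z + c * g z + h z)"
  by (rule linearI)
    (simp_all add: linear_add[OF f] linear_add[OF g] linear_add[OF h] linear_scale[OF f]
      linear_scale[OF g] linear_scale[OF h] algebra_simps)

lemma linear_on_first_two:
  fixes f :: "'a::real_vector \<times> 'a \<times> 'a \<Rightarrow> real"
  assumes f: "linear f"
  shows "linear (\<lambda>v. - f (fst v, snd v, 0) / t)"
  by (rule linearI)
    (use linear_add[OF f, of "(_, _, 0)" "(_, _, 0)"] linear_scale[OF f, of _ "(_, _, 0)"]
     in \<open>simp_all add: add_divide_distrib diff_divide_distrib\<close>)

text \<open>
  Write \<open>\<Lambda>\<close> for the sum of the three functionals, and \<open>g\<close> for the value of \<open>gap\<close> at \<open>d = (d1, d2, d3)\<close>. On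
  the diagonal, \<open>\<Lambda>1\<close> vanishes and only \<open>\<epsilon>1 * \<Lambda>2\<close> counts. At \<open>u = d - (d3, d3, d3)\<close>, the value of \<open>\<Lambda>1\<close> is about
  \<open>g\<close>, and \<open>\<Lambda>2\<close> may destroy a fraction \<open>\<epsilon>1 * s\<close> of it. The box norm of \<open>(x, x, x) + k *\<^sub>R u\<close> does not exceed \<open>\<parallel>x\<parallel>\<close>
  as long as \<open>\<bar>k\<bar> * g \<le> \<epsilon> * \<parallel>x\<parallel>\<close>. Hence what \<open>\<Lambda>2\<close> spends on \<open>u\<close> it loses on the
  diagonal: there it is at most \<open>1 - \<epsilon> * s\<close>. So dividing by \<open>t\<close>, which restores the value at \<open>u\<close>, leaves a
  diagonal bound of about \<open>\<epsilon>1 * (1 - \<epsilon> * s) / (1 - \<epsilon>1 * s)\<close>, which is at most \<open>\<epsilon>1\<close>; the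
  margin from \<open>\<epsilon>1\<close> to \<open>\<sigma>\<close> absorbs the errors of order \<open>\<eta>\<close>.
\<close>

lemma balanced_pair_functional:
  fixes \<Lambda>1 \<Lambda>2 \<Lambda>3 :: "'a::real_normed_vector \<times> 'a \<times> 'a \<Rightarrow> real"
  assumes \<Lambda>1: "\<Lambda>1 \<in> linear_minorants gap" and \<Lambda>2: "\<Lambda>2 \<in> linear_minorants (box_norm (1 / (1 + \<epsilon>)))"
    and \<Lambda>3: "\<Lambda>3 \<in> linear_minorants (\<lambda>x. \<eta> * norm x)"
    and \<epsilon>: "0 < \<epsilon>1" "\<epsilon>1 < \<sigma>" "\<sigma> \<le> \<epsilon>" and \<eta>: "0 < \<eta>" "\<eta> \<le> 1"
    and \<eta>_small: "3 * (1 + \<epsilon>) * \<eta> \<le> \<sigma> - \<epsilon>1" "6 * (1 + \<epsilon>) * \<eta> \<le> 1"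
    and pos: "gap (d1, d2, d3) > 0" and steep: "\<Lambda>1 (d1, d2, d3) \<ge> (1 - \<eta>) * gap (d1, d2, d3)"
    and Y: "subspace Y"
    and stationary: "\<And>h. h \<in> Y \<Longrightarrow> \<Lambda>1 (0, 0, h) + \<epsilon>1 * \<Lambda>2 (0, 0, h) + \<Lambda>3 (0, 0, h) = 0"
  shows "\<exists>t>0. (\<forall>v \<in> Y \<times> Y. - (\<Lambda>1 (fst v, snd v, 0) + \<epsilon>1 * \<Lambda>2 (fst v, snd v, 0) + \<Lambda>3 (fst v, snd v, 0)) / t
        \<le> diagonal_norm \<sigma> (2 * (1 + \<epsilon>) * (3 + \<epsilon>)) v) \<and>
     (\<forall>v. - (\<Lambda>1 (fst v, snd v, 0) + \<epsilon>1 * \<Lambda>2 (fst v, snd v, 0) + \<Lambda>3 (fst v, snd v, 0)) / t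
        \<le> 2 * (1 + \<epsilon>) * (3 + \<epsilon>) * norm v) \<and>
     gap (d1, d2, d3) \<le> (\<Lambda>1 (d1 - d3, d2 - d3, 0) + \<epsilon>1 * \<Lambda>2 (d1 - d3, d2 - d3, 0) + \<Lambda>3 (d1 - d3, d2 - d3, 0)) / t"
proof -
  define \<gamma> where "\<gamma> = 1 / (1 + \<epsilon>)"
  have \<epsilon>_pos: "\<epsilon> > 0" "\<sigma> > 0" using \<epsilon> by auto
  have \<gamma>: "0 < \<gamma>" "\<gamma> \<le> 1" "\<gamma> * (1 + \<epsilon>) = 1" using \<epsilon>_pos by (auto simp: \<gamma>_def)
  have lin: "linear \<Lambda>1" "linear \<Lambda>2" "linear \<Lambda>3" using \<Lambda>1 \<Lambda>2 \<Lambda>3 by (simp_all add: linear_minorants_def)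
  have le1: "\<Lambda>1 w \<le> gap w" and le2: "\<Lambda>2 w \<le> box_norm \<gamma> w" and le3: "\<Lambda>3 w \<le> \<eta> * norm w" for w
    using \<Lambda>1 \<Lambda>2 \<Lambda>3 unfolding linear_minorants_def \<gamma>_def by blast+
  have abs1: "\<bar>\<Lambda>1 w\<bar> \<le> 2 * norm w" for w by (rule linear_minorant_abs_le[OF \<Lambda>1 gap_le])
  have abs2: "\<bar>\<Lambda>2 w\<bar> \<le> 1 * norm w" for w
    by (rule linear_minorant_abs_le[OF \<Lambda>2[folded \<gamma>_def]]) (use box_norm_le[OF \<gamma>(1,2)] in simp)
  have abs3: "\<bar>\<Lambda>3 w\<bar> \<le> \<eta> * norm w" for w by (rule linear_minorant_abs_le[OF \<Lambda>3]) simp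
  define \<Lambda> where "\<Lambda> w = \<Lambda>1 w + \<epsilon>1 * \<Lambda>2 w + \<Lambda>3 w" for w
  have \<Lambda>_lin: "linear \<Lambda>" unfolding \<Lambda>_def by (rule linear_combination3[OF lin])
  define g where "g = gap (d1, d2, d3)"
  define p where "p = d1 - d3"
  define q where "q = d2 - d3"
  define u where "u = (p, q, 0::'a)"
  have g: "g > 0" "g = max (norm p) (norm q)" using pos by (simp_all add: g_def gap_def p_def q_def)
  have u_norm: "norm u \<le> 2 * g"
    using norm_triple_le[of p q "0::'a"] g(2) by (simp add: u_def)
  have diag1: "\<Lambda>1 (x, x, x) = 0" for x
    using le1[of "(x, x, x)"] le1[of "- (x, x, x)"] linear_neg[OF lin(1), of "(x, x, x)"]
    by (simp add: gap_def)
  have "(d1, d2, d3) = u + (d3, d3, d3)" by (simp add: u_def p_def q_def)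
  then have steep_u: "\<Lambda>1 u \<ge> (1 - \<eta>) * g"
    using steep linear_add[OF lin(1), of u "(d3, d3, d3)"] diag1[of d3] by (simp add: g_def)
  define s where "s = \<bar>\<Lambda>2 u\<bar> / g"
  have s0: "s \<ge> 0" using g by (simp add: s_def)
  have sg: "s * g = \<bar>\<Lambda>2 u\<bar>" using g by (simp add: s_def)
  have "box_norm \<gamma> u = \<gamma> * g" "box_norm \<gamma> (- u) = \<gamma> * g"
    using \<gamma> g by (simp_all add: box_norm_def u_def)
  then have "\<bar>\<Lambda>2 u\<bar> \<le> \<gamma> * g"
    using le2[of u] le2[of "- u"] linear_neg[OF lin(2), of u] by (simp add: abs_le_iff)
  then have s_le: "s \<le> \<gamma>" using g by (simp add: s_def divide_le_eq)
  define t where "t = 1 - \<epsilon>1 * s - 3 * \<eta>"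
  have "\<epsilon>1 * s \<le> \<epsilon> * \<gamma>" using \<epsilon> s_le s0 by (intro mult_mono) auto
  moreover have "\<epsilon> * \<gamma> = 1 - \<gamma>" using \<gamma>(3) by (simp add: algebra_simps)
  moreover have "3 * \<eta> \<le> \<gamma> / 2"
  proof -
    have "\<gamma> * (6 * (1 + \<epsilon>) * \<eta>) \<le> \<gamma> * 1" using \<eta>_small(2) \<gamma> by (intro mult_left_mono) auto
    moreover have "\<gamma> * (6 * (1 + \<epsilon>) * \<eta>) = (\<gamma> * (1 + \<epsilon>)) * (6 * \<eta>)" by (simp only: mult_ac)
    ultimately have "6 * \<eta> \<le> \<gamma>" by (simp only: \<gamma>(3) mult_1 mult_1_right)
    then show ?thesis by simp
  qed
  ultimately have t_ge: "t \<ge> \<gamma> / 2" unfolding t_def by linarith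
  then have t: "t > 0" using \<gamma>(1) by linarith
  have diag2: "\<Lambda>2 (x, x, x) \<le> (1 - \<epsilon> * s) * norm x" for x
  proof -
    \<comment> \<open>the longest step along \<open>u\<close> that does not increase the box norm, in the direction that increases \<open>\<Lambda>2\<close>\<close>
    define k where "k = (if \<Lambda>2 u \<ge> 0 then 1 else - 1) * (\<epsilon> * norm x / g)"
    have k: "\<bar>k\<bar> = \<epsilon> * norm x / g" using \<epsilon>_pos g by (simp add: k_def abs_mult)
    have kle: "\<bar>k\<bar> * norm p \<le> \<epsilon> * norm x" "\<bar>k\<bar> * norm q \<le> \<epsilon> * norm x"
    proof -
      have "\<bar>k\<bar> * norm p \<le> \<bar>k\<bar> * g" "\<bar>k\<bar> * norm q \<le> \<bar>k\<bar> * g" using g(2) by (auto intro!: mult_left_mono)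
      moreover have "\<bar>k\<bar> * g = \<epsilon> * norm x" using g unfolding k by simp
      ultimately show "\<bar>k\<bar> * norm p \<le> \<epsilon> * norm x" "\<bar>k\<bar> * norm q \<le> \<epsilon> * norm x" by simp_all
    qed
    have "norm (x + k *\<^sub>R p) \<le> (1 + \<epsilon>) * norm x" "norm (x + k *\<^sub>R q) \<le> (1 + \<epsilon>) * norm x"
      using norm_triangle_ineq[of x "k *\<^sub>R p"] norm_triangle_ineq[of x "k *\<^sub>R q"] kle
      by (simp_all add: distrib_right)
    then have "\<gamma> * max (norm (x + k *\<^sub>R p)) (norm (x + k *\<^sub>R q)) \<le> \<gamma> * ((1 + \<epsilon>) * norm x)"
      using \<gamma> by (intro mult_left_mono) auto
    also have "\<dots> = norm x" using \<gamma>(3) by (simp add: mult.assoc[symmetric])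
    finally have "box_norm \<gamma> ((x, x, x) + k *\<^sub>R u) \<le> norm x" by (simp add: box_norm_def u_def)
    moreover have "\<Lambda>2 ((x, x, x) + k *\<^sub>R u) = \<Lambda>2 (x, x, x) + k * \<Lambda>2 u"
      by (simp only: linear_add[OF lin(2)] linear_scale[OF lin(2)] real_scaleR_def)
    moreover have "k * \<Lambda>2 u = \<epsilon> * norm x * s" by (simp add: k_def s_def)
    ultimately show ?thesis using le2[of "(x, x, x) + k *\<^sub>R u"] by (simp add: algebra_simps)
  qed
  have diag: "\<Lambda> (x, x, x) \<le> \<sigma> * t * norm x" for x
  proof -
    have "\<epsilon>1 * \<Lambda>2 (x, x, x) \<le> \<epsilon>1 * ((1 - \<epsilon> * s) * norm x)" using diag2 \<epsilon>(1) by (intro mult_left_mono) auto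
    moreover have "\<Lambda>3 (x, x, x) \<le> \<eta> * (3 * norm x)"
    proof -
      have "norm (x, x, x) \<le> 3 * norm x" using norm_triple_le[of x x x] by simp
      then have "\<eta> * norm (x, x, x) \<le> \<eta> * (3 * norm x)" using \<eta> by (intro mult_left_mono) auto
      then show ?thesis using le3[of "(x, x, x)"] by linarith
    qed
    moreover have "\<epsilon>1 * (1 - \<epsilon> * s) + 3 * \<eta> \<le> \<sigma> * t"
    proof -
      have "\<sigma> * (\<epsilon>1 * s) \<le> \<epsilon> * (\<epsilon>1 * s)" using \<epsilon> s0 by (intro mult_right_mono) auto
      moreover have "\<sigma> * \<eta> \<le> \<epsilon> * \<eta>" using \<epsilon> \<eta> by (intro mult_right_mono) auto
      ultimately show ?thesis using \<eta>_small(1) unfolding t_def by (simp add: algebra_simps)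
    qed
    then have "(\<epsilon>1 * (1 - \<epsilon> * s) + 3 * \<eta>) * norm x \<le> \<sigma> * t * norm x" by (rule mult_right_mono) simp
    ultimately show ?thesis unfolding \<Lambda>_def diag1 by (simp add: algebra_simps)
  qed
  define R where "R = 2 * (1 + \<epsilon>) * (3 + \<epsilon>)"
  have R: "R \<ge> 0" using \<epsilon>_pos by (simp add: R_def)
  define \<phi> where "\<phi> v = - \<Lambda> (fst v, snd v, 0) / t" for v
  have \<phi>_lin: "linear \<phi>"
    unfolding \<phi>_def by (rule linear_on_first_two[OF \<Lambda>_lin])
  have \<phi>_R: "\<phi> v \<le> R * norm v" for v
  proof -
    have n: "norm (fst v, snd v, 0::'a) = norm v" by (cases v) (simp add: norm_Pair)
    have "- (\<epsilon>1 * \<Lambda>2 (fst v, snd v, 0)) \<le> \<epsilon>1 * norm v"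
      using mult_left_mono[of "- \<Lambda>2 (fst v, snd v, 0)" "norm v" \<epsilon>1] abs2[of "(fst v, snd v, 0)"] \<epsilon>(1) n by simp
    moreover have "\<epsilon>1 * norm v \<le> \<epsilon> * norm v" "\<eta> * norm v \<le> 1 * norm v"
      using mult_right_mono[of \<epsilon>1 \<epsilon> "norm v"] mult_right_mono[OF \<eta>(2), of "norm v"] \<epsilon> by simp_all
    ultimately have "- \<Lambda> (fst v, snd v, 0) \<le> (3 + \<epsilon>) * norm v"
      using abs1[of "(fst v, snd v, 0)"] abs3[of "(fst v, snd v, 0)"] n by (simp add: \<Lambda>_def algebra_simps abs_le_iff)
    moreover have "(3 + \<epsilon>) * norm v \<le> (R * t) * norm v"
    proof (rule mult_right_mono)
      have "R * (\<gamma> / 2) \<le> R * t" using t_ge R by (rule mult_left_mono)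
      moreover have "R * (\<gamma> / 2) = (\<gamma> * (1 + \<epsilon>)) * (3 + \<epsilon>)" by (simp add: R_def)
      ultimately show "3 + \<epsilon> \<le> R * t" unfolding \<gamma>(3) by simp
    qed simp
    ultimately have "- \<Lambda> (fst v, snd v, 0) \<le> (R * norm v) * t" by (simp add: mult_ac)
    then show ?thesis unfolding \<phi>_def pos_divide_le_eq[OF t] .
  qed
  have "\<phi> v \<le> diagonal_norm \<sigma> R v" if v: "v \<in> Y \<times> Y" for v
  proof -
    define x where "x = (1 / 2) *\<^sub>R (fst v + snd v)"
    \<comment> \<open>diagonal part \<open>(x, x)\<close> and antidiagonal part \<open>(k, - k)\<close> of \<open>v\<close>\<close>
    define k where "k = (1 / 2) *\<^sub>R (fst v - snd v)"
    have half: "(1 / 2) *\<^sub>R z + (1 / 2) *\<^sub>R z = z" for z :: 'a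
      by (simp add: scaleR_add_left[symmetric])
    have v_eq: "v = (x, x) + (k, - k)"
      using half[of "fst v"] half[of "snd v"]
      by (cases v) (simp add: x_def k_def scaleR_add_right scaleR_diff_right algebra_simps)
    have xY: "x \<in> Y" using v unfolding x_def by (intro subspace_scale[OF Y] subspace_add[OF Y]) auto
    have "\<Lambda> (x, x, 0) + \<Lambda> (0, 0, x) = \<Lambda> (x, x, x)"
      using linear_add[OF \<Lambda>_lin, of "(x, x, 0)" "(0, 0, x)"] by simp
    moreover have "\<Lambda> (0, 0, x) = 0" using stationary[OF xY] by (simp add: \<Lambda>_def)
    moreover have "- \<Lambda> (x, x, x) \<le> \<sigma> * t * norm x"
      using diag[of "- x"] linear_neg[OF \<Lambda>_lin, of "(x, x, x)"] by simp
    ultimately have "- \<Lambda> (x, x, 0) \<le> (\<sigma> * norm x) * t" by (simp add: mult_ac)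
    then have "\<phi> (x, x) \<le> \<sigma> * norm x" unfolding \<phi>_def fst_conv snd_conv pos_divide_le_eq[OF t] .
    moreover have "\<phi> (k, - k) \<le> R * norm (fst v - snd v)"
    proof -
      have "norm (k, - k) \<le> norm k + norm k" using norm_Pair_le[of k "- k"] by simp
      also have "\<dots> = norm (fst v - snd v)" by (simp add: k_def)
      finally have "R * norm (k, - k) \<le> R * norm (fst v - snd v)" using R by (rule mult_left_mono)
      then show ?thesis using \<phi>_R[of "(k, - k)"] by linarith
    qed
    moreover have "\<phi> v = \<phi> (x, x) + \<phi> (k, - k)" unfolding v_eq by (rule linear_add[OF \<phi>_lin])
    ultimately show ?thesis by (simp add: diagonal_norm_def x_def)
  qed
  moreover have "g \<le> \<Lambda> u / t"
  proof -
    have "\<epsilon>1 * (- (s * g)) \<le> \<epsilon>1 * \<Lambda>2 u" unfolding sg using \<epsilon>(1) by (intro mult_left_mono) auto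
    moreover have "- (\<eta> * (2 * g)) \<le> \<Lambda>3 u"
      using abs3[of u] mult_left_mono[OF u_norm, of \<eta>] \<eta> by linarith
    ultimately have "g * t \<le> \<Lambda> u" using steep_u unfolding \<Lambda>_def t_def by (simp add: algebra_simps)
    then show ?thesis unfolding pos_le_divide_eq[OF t] .
  qed
  ultimately show ?thesis
    using t \<phi>_R unfolding \<phi>_def \<Lambda>_def R_def g_def u_def p_def q_def by blast
qed

section \<open>The extremal principle\<close>

lemma sublinear_diagonal_norm:
  assumes "\<sigma> \<ge> 0" "R \<ge> 0"
  shows "sublinear (diagonal_norm \<sigma> R :: 'a::real_normed_vector \<times> 'a \<Rightarrow> real)"
proof -
  have "linear (\<lambda>v::'a \<times> 'a. (1 / 2) *\<^sub>R (fst v + snd v))"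
    by (rule linearI) (simp_all add: scaleR_add_right)
  moreover have "linear (\<lambda>v::'a \<times> 'a. fst v - snd v)"
    by (rule linearI) (simp_all add: scaleR_diff_right)
  ultimately show ?thesis
    unfolding diagonal_norm_def
    by (rule sublinear_plus[OF sublinear_times[OF sublinear_norm_linear assms(1)]
          sublinear_times[OF sublinear_norm_linear assms(2)]])
qed

lemma diagonal_norm_le:
  assumes "\<sigma> \<ge> 0" "R \<ge> 0"
  shows "diagonal_norm \<sigma> R v \<le> (\<sigma> + 2 * R) * norm v"
proof -
  obtain x y where v: "v = (x, y)" by (cases v)
  have n: "norm x \<le> norm v" "norm y \<le> norm v"
    unfolding v using norm_fst_le[of x y] norm_snd_le[of y x] by simp_all
  have "norm ((1 / 2) *\<^sub>R (x + y)) = norm (x + y) / 2" by simp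
  moreover have "norm (x + y) \<le> norm x + norm y" "norm (x - y) \<le> norm x + norm y"
    by (rule norm_triangle_ineq, rule norm_triangle_ineq4)
  ultimately have "norm ((1 / 2) *\<^sub>R (x + y)) \<le> norm v" "norm (x - y) \<le> 2 * norm v" using n by linarith+
  then have "\<sigma> * norm ((1 / 2) *\<^sub>R (x + y)) \<le> \<sigma> * norm v" "R * norm (x - y) \<le> R * (2 * norm v)"
    using assms by (intro mult_left_mono; simp)+
  then show ?thesis unfolding diagonal_norm_def v by (simp add: algebra_simps)
qed

lemma frechet_normal_cone_scaleR:
  assumes f: "f \<in> frechet_normal_cone A a" and c: "c > 0"
  shows "c *\<^sub>R f \<in> frechet_normal_cone A a"
  unfolding mem_frechet_normal_cone_iff
proof (intro allI impI)
  fix \<eta> :: real assume "\<eta> > 0"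
  then have "\<eta> / c > 0" using c by simp
  then obtain \<delta> where \<delta>: "\<delta> > 0" "\<forall>x\<in>A \<inter> ball a \<delta>. f (x - a) \<le> \<eta> / c * norm (x - a)"
    using f unfolding mem_frechet_normal_cone_iff by blast
  have "(c *\<^sub>R f) (x - a) \<le> \<eta> * norm (x - a)" if "x \<in> A \<inter> ball a \<delta>" for x
  proof -
    have "c * f (x - a) \<le> c * (\<eta> / c * norm (x - a))" using \<delta>(2) that c by (intro mult_left_mono) auto
    then show ?thesis using c by (simp add: scaleR_blinfun.rep_eq)
  qed
  then show "\<exists>\<delta>>0. \<forall>x\<in>A \<inter> ball a \<delta>. (c *\<^sub>R f) (x - a) \<le> \<eta> * norm (x - a)" using \<delta>(1) by blast
qed

lemma ex_almost_norming:
  fixes f :: "'a::real_normed_vector \<Rightarrow>\<^sub>L real"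
  assumes "0 < \<alpha>" "\<alpha> < \<beta>"
  shows "\<exists>u. norm u \<le> \<beta> \<and> \<alpha> * norm f \<le> f u"
proof (cases "f = 0")
  case True
  then show ?thesis using assms by (intro exI[of _ 0]) simp
next
  case False
  then have "\<alpha> / \<beta> * norm f < 1 * norm f" using assms by (intro mult_strict_right_mono) auto
  then have "\<not> (\<forall>x. norm (f x) \<le> \<alpha> / \<beta> * norm f * norm x)"
    using norm_blinfun_bound[of "\<alpha> / \<beta> * norm f" f] assms by auto
  then obtain x where "\<not> norm (f x) \<le> \<alpha> / \<beta> * norm f * norm x" by blast
  then have x: "\<bar>f x\<bar> > \<alpha> / \<beta> * norm f * norm x" unfolding not_le by (simp only: real_norm_def)
  have x0: "x \<noteq> 0" using x by auto
  define u where "u = (if f x \<ge> 0 then 1 else - 1) *\<^sub>R (\<beta> / norm x) *\<^sub>R x"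
  have "f u = \<beta> / norm x * \<bar>f x\<bar>" by (simp add: u_def blinfun.scaleR_right blinfun.minus_right)
  moreover have "\<beta> / norm x * (\<alpha> / \<beta> * norm f * norm x) \<le> \<beta> / norm x * \<bar>f x\<bar>"
    using x assms by (intro mult_left_mono) auto
  moreover have "\<beta> / norm x * (\<alpha> / \<beta> * norm f * norm x) = \<alpha> * norm f" using x0 assms by simp
  moreover have "norm u = \<beta>" using x0 assms by (simp add: u_def)
  ultimately show ?thesis by (intro exI[of _ u]) simp
qed

text \<open>
  The order of choices matters. The Ekeland point \<open>pt\<close> is found in the whole space, before any subspace
  is fixed, because the infimum of \<open>gap\<close> may be \<open>0\<close> and only its positive value at \<open>pt\<close> determines how
  fine the smooth approximation must be. Then \<open>Y\<close> is built around \<open>pt\<close>, for constants \<open>\<sigma>\<close> and \<open>R\<close> that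
  bound the functionals obtained at any smooth minimizer.
\<close>

theorem approximate_normals:
  fixes A B :: "'a::banach set" and ah bh u v :: 'a
  assumes asplund: "asplund_space TYPE('a)" and AB: "closed A" "closed B" and ab: "ah \<in> A" "bh \<in> B"
    and \<epsilon>: "\<epsilon> > 0" and \<rho>: "\<rho> > 0"
    and disjoint: "\<And>x y. x \<in> A \<Longrightarrow> y \<in> B \<Longrightarrow> x - ah - u = y - bh - v \<Longrightarrow> norm (x - ah - u) > \<rho>"
    and uv: "norm u < \<epsilon> * \<rho>" "norm v < \<epsilon> * \<rho>"
  shows "\<exists>a' \<in> A. \<exists>b' \<in> B. \<exists>as \<in> frechet_normal_cone A a'. \<exists>bs \<in> frechet_normal_cone B b'.
    norm (a' - ah) < \<rho> * (\<epsilon> + 1) \<and> norm (b' - bh) < \<rho> * (\<epsilon> + 1) \<and>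
    norm as + norm bs = 1 \<and> norm (as + bs) < \<epsilon>"
proof -
  define \<gamma> where "\<gamma> = 1 / (1 + \<epsilon>)"
  have \<gamma>: "0 < \<gamma>" "\<gamma> \<le> 1" using \<epsilon> by (auto simp: \<gamma>_def)
  define c0 where "c0 = (ah + u, bh + v, 0::'a)"
  define w0 where "w0 = (ah, bh, 0::'a)"
  define S where "S = A \<times> B \<times> cball (0::'a) \<rho>"
  have S: "closed S" "w0 \<in> S" using AB ab \<rho> by (auto simp: S_def w0_def intro!: closed_Times)
  have f0: "gap (w0 - c0) = max (norm u) (norm v)" by (simp add: gap_def w0_def c0_def)
  then have "gap (w0 - c0) / \<rho> < \<epsilon>" using uv \<rho> by (simp add: divide_less_eq)
  moreover have gap_nonneg: "0 \<le> gap (y - c0)" for y by (simp add: gap_def le_max_iff_disj)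
  then have "0 \<le> gap (w0 - c0) / \<rho>" using \<rho> by simp
  ultimately obtain \<epsilon>0 where \<epsilon>0: "gap (w0 - c0) / \<rho> < \<epsilon>0" "\<epsilon>0 < \<epsilon>" "0 < \<epsilon>0"
    by (meson dense order_le_less_trans)
  define \<epsilon>1 where "\<epsilon>1 = (\<epsilon>0 + \<epsilon>) / 2"
  define \<sigma> where "\<sigma> = (\<epsilon>1 + \<epsilon>) / 2"
  have \<epsilon>s: "\<epsilon>0 < \<epsilon>1" "0 < \<epsilon>1" "\<epsilon>1 < \<sigma>" "\<sigma> < \<epsilon>" "\<sigma> \<le> \<epsilon>" "\<sigma> \<ge> 0" using \<epsilon>0 by (auto simp: \<epsilon>1_def \<sigma>_def)
  have gap_cont: "continuous_on S (\<lambda>w. gap (w - c0))" unfolding gap_def by (intro continuous_intros)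
  have box1: "box_norm \<gamma> x \<le> 1 * norm x" for x :: "'a \<times> 'a \<times> 'a" using box_norm_le[OF \<gamma>, of x] by simp
  have "\<exists>x\<in>S. \<epsilon>0 * box_norm \<gamma> (x - w0) \<le> gap (w0 - c0) - gap (x - c0) \<and>
      (\<forall>y\<in>S. gap (x - c0) \<le> gap (y - c0) + \<epsilon>1 * box_norm \<gamma> (y - x))"
    by (rule ekeland[where m = 0, OF sublinear_box_norm[OF \<gamma>] box_norm_minus[OF \<gamma>] box1 norm_le_box_norm[OF \<gamma>]
          _ _ S gap_cont gap_nonneg \<epsilon>0(3) \<epsilon>s(1)]) (use \<gamma> in simp_all)
  then obtain pt where pt: "pt \<in> S" and pt_close: "\<epsilon>0 * box_norm \<gamma> (pt - w0) \<le> gap (w0 - c0) - gap (pt - c0)"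
    and pt_min: "\<And>y. y \<in> S \<Longrightarrow> gap (pt - c0) \<le> gap (y - c0) + \<epsilon>1 * box_norm \<gamma> (y - pt)"
    by blast
  have "gap (w0 - c0) < \<epsilon>0 * \<rho>" using \<epsilon>0(1) \<rho> by (simp add: divide_less_eq)
  then have "\<epsilon>0 * box_norm \<gamma> (pt - w0) < \<epsilon>0 * \<rho>"
    using pt_close gap_nonneg[of pt] by linarith
  then have pt_box: "box_norm \<gamma> (pt - w0) < \<rho>" using \<epsilon>0(3) by simp
  have gap_pos: "gap (pt - c0) > 0"
  proof (rule ccontr)
    assume "\<not> gap (pt - c0) > 0"
    obtain x y z where xyz: "pt = (x, y, z)" "x \<in> A" "y \<in> B" "norm z \<le> \<rho>" using pt by (auto simp: S_def)
    have "gap (pt - c0) = max (norm (x - (ah + u) - z)) (norm (y - (bh + v) - z))"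
      by (simp add: gap_def xyz(1) c0_def)
    then have "max (norm (x - (ah + u) - z)) (norm (y - (bh + v) - z)) \<le> 0"
      using \<open>\<not> gap (pt - c0) > 0\<close> by linarith
    then have "norm (x - (ah + u) - z) \<le> 0" "norm (y - (bh + v) - z) \<le> 0"
      by (rule order_trans[rotated], simp)+
    then have "x - ah - u = z" "y - bh - v = z" by (simp_all add: algebra_simps)
    then show False using disjoint[OF xyz(2,3)] xyz(4) by simp
  qed
  define R where "R = 2 * (1 + \<epsilon>) * (3 + \<epsilon>)"
  have R: "R \<ge> 0" using \<epsilon> by (simp add: R_def)
  define D0 where "D0 = {fst pt, fst (snd pt), snd (snd pt), ah + u, bh + v}"
  have "countable D0" by (simp add: D0_def)
  from ex_reflecting_subspace[OF this, of "A \<times> B" "diagonal_norm \<sigma> R" R]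
  obtain D where D: "countable D" "D0 \<subseteq> D" "subspace (closure D)"
    "reflecting (A \<times> B) (diagonal_norm \<sigma> R) R (D \<times> D)" by (elim exE conjE)
  define Y where "Y = closure D"
  have Y: "closed Y" "subspace Y" using D(3) by (simp_all add: Y_def)
  have "D0 \<subseteq> Y" using D(2) closure_subset[of D] unfolding Y_def by blast
  then have ptY: "pt \<in> Y \<times> Y \<times> Y" and cY: "ah + u \<in> Y" "bh + v \<in> Y" by (auto simp: D0_def mem_Times_iff)
  define \<eta> where "\<eta> = min 1 (min ((\<sigma> - \<epsilon>1) / (3 * (1 + \<epsilon>))) (1 / (6 * (1 + \<epsilon>))))"
  have \<eta>: "0 < \<eta>" "\<eta> \<le> 1" using \<epsilon> \<epsilon>s by (auto simp: \<eta>_def)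
  have "\<eta> \<le> (\<sigma> - \<epsilon>1) / (3 * (1 + \<epsilon>))" "\<eta> \<le> 1 / (6 * (1 + \<epsilon>))" by (simp_all add: \<eta>_def)
  then have \<eta>_small: "3 * (1 + \<epsilon>) * \<eta> \<le> \<sigma> - \<epsilon>1" "6 * (1 + \<epsilon>) * \<eta> \<le> 1"
    using \<epsilon> by (simp_all add: pos_le_divide_eq mult.commute)
  have r: "\<rho> - box_norm \<gamma> (pt - w0) > 0" using pt_box by simp
  have sep: "seminorm_separable (Y \<times> Y \<times> Y) (linear_minorants p)"
    if "\<And>x. p x \<le> K * norm x" "K \<ge> 0" for p K
    unfolding Y_def by (rule asplund_product_separable[OF asplund D(1) that])
  have "\<exists>w \<in> S \<inter> Y \<times> Y \<times> Y. \<exists>\<Lambda>1 \<in> linear_minorants gap. \<exists>\<Lambda>2 \<in> linear_minorants (box_norm \<gamma>).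
    \<exists>\<Lambda>3 \<in> linear_minorants (\<lambda>x. \<eta> * norm x).
    norm (w - pt) < \<rho> - box_norm \<gamma> (pt - w0) \<and> gap (w - c0) > 0 \<and> \<Lambda>1 (w - c0) \<ge> (1 - \<eta>) * gap (w - c0) \<and>
    (\<forall>c>0. \<exists>\<delta>>0. \<forall>v \<in> S \<inter> Y \<times> Y \<times> Y. norm (v - w) < \<delta> \<longrightarrow>
        - c * norm (v - w) \<le> \<Lambda>1 (v - w) + \<epsilon>1 * \<Lambda>2 (v - w) + \<Lambda>3 (v - w))"
  proof (rule smooth_perturbed_minimum[OF S(1) Y _ \<gamma> \<epsilon>s(2) pt ptY gap_pos _ r \<eta>])
    show "seminorm_separable (Y \<times> Y \<times> Y) (linear_minorants p)"
      if "\<And>x. p x \<le> K * norm x" "K \<ge> 0" for p K by (rule sep[OF that])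
  qed (rule pt_min)
  then obtain w \<Lambda>1 \<Lambda>2 \<Lambda>3 where w: "w \<in> S \<inter> Y \<times> Y \<times> Y" "norm (w - pt) < \<rho> - box_norm \<gamma> (pt - w0)"
    and \<Lambda>s: "\<Lambda>1 \<in> linear_minorants gap" "\<Lambda>2 \<in> linear_minorants (box_norm \<gamma>)" "\<Lambda>3 \<in> linear_minorants (\<lambda>x. \<eta> * norm x)"
    and gap_w: "gap (w - c0) > 0" and steep: "\<Lambda>1 (w - c0) \<ge> (1 - \<eta>) * gap (w - c0)"
    and opt: "\<forall>c>0. \<exists>\<delta>>0. \<forall>v \<in> S \<inter> Y \<times> Y \<times> Y. norm (v - w) < \<delta> \<longrightarrow>
        - c * norm (v - w) \<le> \<Lambda>1 (v - w) + \<epsilon>1 * \<Lambda>2 (v - w) + \<Lambda>3 (v - w)" by (elim bexE conjE)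
  define \<Lambda> where "\<Lambda> z = \<Lambda>1 z + \<epsilon>1 * \<Lambda>2 z + \<Lambda>3 z" for z
  have lin: "linear \<Lambda>1" "linear \<Lambda>2" "linear \<Lambda>3" using \<Lambda>s by (simp_all add: linear_minorants_def)
  have \<Lambda>_lin: "linear \<Lambda>" unfolding \<Lambda>_def by (rule linear_combination3[OF lin])
  obtain a' b' z' where w_eq: "w = (a', b', z')" by (cases w)
  have mem: "a' \<in> A" "b' \<in> B" "a' \<in> Y" "b' \<in> Y" "z' \<in> Y" using w(1) by (auto simp: w_eq S_def)
  have "box_norm \<gamma> (w - w0) \<le> box_norm \<gamma> (pt - w0) + box_norm \<gamma> (w - pt)"
    using sublinear_add[OF sublinear_box_norm[OF \<gamma>], of "pt - w0" "w - pt"] by simp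
  also have "\<dots> < \<rho>" using box_norm_le[OF \<gamma>, of "w - pt"] w(2) by linarith
  finally have w_box: "box_norm \<gamma> (w - w0) < \<rho>" .
  then have z'_small: "norm z' < \<rho>" and "\<gamma> * norm (a' - ah) < \<rho>" "\<gamma> * norm (b' - bh) < \<rho>"
    using \<gamma> by (simp_all add: box_norm_def w_eq w0_def max_mult_distrib_left)
  then have near: "norm (a' - ah) < \<rho> * (\<epsilon> + 1)" "norm (b' - bh) < \<rho> * (\<epsilon> + 1)"
    using \<epsilon> by (simp_all add: \<gamma>_def divide_less_eq add.commute)
  have opt_A_B: "\<exists>\<delta>>0. \<forall>v\<in>S \<inter> Y \<times> Y \<times> Y. norm (v - w) < \<delta> \<longrightarrow> - c * norm (v - w) \<le> \<Lambda> (v - w)" if "c > 0" for c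
    using opt that unfolding \<Lambda>_def by blast
  have stationary_ge: "0 \<le> \<Lambda> (0, 0, h)" if h: "h \<in> Y" for h
  proof (cases "h = 0")
    case True
    then show ?thesis using linear_0[OF \<Lambda>_lin] by (simp add: zero_prod_def)
  next
    case False
    have "- c * norm h \<le> \<Lambda> (0, 0, h)" if c: "c > 0" for c
    proof -
      obtain \<delta> where \<delta>: "\<delta> > 0" "\<forall>v\<in>S \<inter> Y \<times> Y \<times> Y. norm (v - w) < \<delta> \<longrightarrow> - c * norm (v - w) \<le> \<Lambda> (v - w)"
        using opt_A_B[OF c] by blast
      \<comment> \<open>a step in the third variable short enough to stay in the ball, where \<open>norm z' < \<rho>\<close> leaves room\<close>
      define s where "s = min (\<delta> / 2) (\<rho> - norm z') / norm h"
      have sh: "s * norm h = min (\<delta> / 2) (\<rho> - norm z')" using False by (simp add: s_def)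
      have "s > 0" using \<delta>(1) z'_small False by (simp add: s_def)
      moreover have "s * norm h \<le> \<delta> / 2" "s * norm h \<le> \<rho> - norm z'"
        unfolding sh by (rule min.cobounded1, rule min.cobounded2)
      ultimately have s: "s > 0" "s * norm h \<le> \<delta> / 2" "s * norm h \<le> \<rho> - norm z'" by this+
      have diff: "(a', b', z' + s *\<^sub>R h) - w = (0, 0, s *\<^sub>R h)" by (simp add: w_eq)
      have n: "norm (0::'a, 0::'a, s *\<^sub>R h) = s * norm h" using s(1) by (simp add: norm_Pair)
      have "norm (z' + s *\<^sub>R h) \<le> \<rho>" using norm_triangle_ineq[of z' "s *\<^sub>R h"] s by simp
      then have "(a', b', z' + s *\<^sub>R h) \<in> S \<inter> Y \<times> Y \<times> Y"
        using mem h by (auto simp: S_def intro!: subspace_add[OF Y(2)] subspace_scale[OF Y(2)])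
      moreover have "norm (0::'a, 0::'a, s *\<^sub>R h) < \<delta>" unfolding n using s(2) \<delta>(1) by linarith
      ultimately have "- c * (s * norm h) \<le> \<Lambda> (0, 0, s *\<^sub>R h)" using \<delta>(2) diff n by metis
      moreover have "\<Lambda> (0, 0, s *\<^sub>R h) = s * \<Lambda> (0, 0, h)" using linear_scale[OF \<Lambda>_lin, of s "(0, 0, h)"] by simp
      ultimately have "s * (- c * norm h) \<le> s * \<Lambda> (0, 0, h)" by (simp add: mult_ac)
      then show ?thesis using s(1) by (rule mult_left_le_imp_le)
    qed
    note low = this
    have "- e \<le> \<Lambda> (0, 0, h)" if "e > 0" for e
      using low[of "e / norm h"] that False by simp
    then show ?thesis using field_le_epsilon[of "0" "\<Lambda> (0, 0, h)"] by force
  qed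
  have stationary: "\<Lambda>1 (0, 0, h) + \<epsilon>1 * \<Lambda>2 (0, 0, h) + \<Lambda>3 (0, 0, h) = 0" if h: "h \<in> Y" for h
    using stationary_ge[OF h] stationary_ge[OF subspace_neg[OF Y(2) h]] linear_neg[OF \<Lambda>_lin, of "(0, 0, h)"]
    by (simp add: \<Lambda>_def)
  define d1 where "d1 = a' - (ah + u)"
  define d2 where "d2 = b' - (bh + v)"
  have d: "w - c0 = (d1, d2, z')" by (simp add: w_eq c0_def d1_def d2_def)
  have "\<exists>t>0. (\<forall>v \<in> Y \<times> Y. - \<Lambda> (fst v, snd v, 0) / t \<le> diagonal_norm \<sigma> R v) \<and>
      (\<forall>v. - \<Lambda> (fst v, snd v, 0) / t \<le> R * norm v) \<and>
      gap (d1, d2, z') \<le> \<Lambda> (d1 - z', d2 - z', 0) / t"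
    unfolding \<Lambda>_def R_def
    by (rule balanced_pair_functional[OF \<Lambda>s(1) \<Lambda>s(2)[unfolded \<gamma>_def] \<Lambda>s(3) \<epsilon>s(2,3,5) \<eta> \<eta>_small
          gap_w[unfolded d] steep[unfolded d] Y(2) stationary])
  then obtain t where t: "t > 0"
    and \<phi>q: "\<forall>v \<in> Y \<times> Y. - \<Lambda> (fst v, snd v, 0) / t \<le> diagonal_norm \<sigma> R v"
    and \<phi>R: "\<forall>v. - \<Lambda> (fst v, snd v, 0) / t \<le> R * norm v"
    and \<phi>_large: "gap (d1, d2, z') \<le> \<Lambda> (d1 - z', d2 - z', 0) / t"
    by (elim exE conjE)
  define \<phi> where "\<phi> v = - \<Lambda> (fst v, snd v, 0) / t" for v
  have \<phi>_lin: "linear \<phi>"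
    unfolding \<phi>_def by (rule linear_on_first_two[OF \<Lambda>_lin])
  have \<phi>_normal: "\<exists>\<delta>>0. \<forall>v\<in>A \<times> B \<inter> Y \<times> Y. norm (v - (a', b')) < \<delta> \<longrightarrow> \<phi> (v - (a', b')) \<le> c * norm (v - (a', b'))"
    if c: "c > 0" for c
  proof -
    have "c * t > 0" using c t by simp
    from opt_A_B[OF this] obtain \<delta> where \<delta>: "\<delta> > 0"
      "\<forall>v\<in>S \<inter> Y \<times> Y \<times> Y. norm (v - w) < \<delta> \<longrightarrow> - (c * t) * norm (v - w) \<le> \<Lambda> (v - w)" by blast
    have "\<phi> (v - (a', b')) \<le> c * norm (v - (a', b'))"
      if v: "v \<in> A \<times> B \<inter> Y \<times> Y" "norm (v - (a', b')) < \<delta>" for v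
    proof -
      define vv where "vv = (fst v, snd v, z')"
      have "vv \<in> S \<inter> Y \<times> Y \<times> Y" using v(1) mem z'_small by (auto simp: vv_def S_def)
      moreover have diff: "vv - w = (fst (v - (a', b')), snd (v - (a', b')), 0)" by (simp add: vv_def w_eq)
      moreover have n: "norm (vv - w) = norm (v - (a', b'))"
        unfolding diff by (cases "v - (a', b')") (simp add: norm_Pair)
      ultimately have "- (c * t) * norm (v - (a', b')) \<le> \<Lambda> (vv - w)" using \<delta>(2) v(2) by metis
      then have "- \<Lambda> (vv - w) \<le> (c * norm (v - (a', b'))) * t" by (simp add: mult_ac)
      then show ?thesis unfolding \<phi>_def diff[symmetric] pos_divide_le_eq[OF t] .
    qed
    then show ?thesis using \<delta>(1) by blast
  qed
  define Q where "Q = \<sigma> + 2 * R"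
  have Q: "Q \<ge> 0" using \<epsilon>s R by (simp add: Q_def)
  have qQ: "diagonal_norm \<sigma> R v \<le> Q * norm v" for v :: "'a \<times> 'a"
    unfolding Q_def by (rule diagonal_norm_le[OF \<epsilon>s(6) R])
  have YY: "Y \<times> Y = closure (D \<times> D)" by (simp add: Y_def closure_Times)
  have abY: "(a', b') \<in> Y \<times> Y" using mem by simp
  have \<phi>q': "\<phi> v \<le> diagonal_norm \<sigma> R v" if "v \<in> Y \<times> Y" for v using \<phi>q that unfolding \<phi>_def by blast
  have \<phi>R': "\<phi> v \<le> R * norm v" if "v \<in> Y \<times> Y" for v using \<phi>R unfolding \<phi>_def by blast
  have "\<exists>L. linear L \<and> (\<forall>x. L x \<le> diagonal_norm \<sigma> R x) \<and> (\<forall>y\<in>Y \<times> Y. L y = \<phi> y) \<and>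
    (\<forall>c>0. \<exists>\<delta>>0. \<forall>v\<in>A \<times> B. norm (v - (a', b')) < \<delta> \<longrightarrow> L (v - (a', b')) \<le> c * norm (v - (a', b')))"
    by (rule extend_normal_functional[OF sublinear_diagonal_norm[OF \<epsilon>s(6) R] qQ Q R D(4) YY
          subspace_Times[OF Y(2) Y(2)] abY \<phi>_lin \<phi>q' \<phi>R' \<phi>_normal])
  then obtain L where L: "linear L" "\<forall>x. L x \<le> diagonal_norm \<sigma> R x" "\<forall>y\<in>Y \<times> Y. L y = \<phi> y"
    and L_normal: "\<forall>c>0. \<exists>\<delta>>0. \<forall>v\<in>A \<times> B. norm (v - (a', b')) < \<delta> \<longrightarrow> L (v - (a', b')) \<le> c * norm (v - (a', b'))"
    by (elim exE conjE)
  have L_abs: "\<bar>L x\<bar> \<le> Q * norm x" for x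
    using L(2)[rule_format, of x] L(2)[rule_format, of "- x"] qQ[of x] qQ[of "- x"] linear_neg[OF L(1), of x]
    by (simp add: abs_le_iff)
  \<comment> \<open>the two components of \<open>L\<close> are normals, not yet normalized\<close>
  define f where "f = Blinfun (\<lambda>x. L (x, 0))"
  define g where "g = Blinfun (\<lambda>x. L (0, x))"
  have "bounded_linear (\<lambda>x. L (x, 0))" "bounded_linear (\<lambda>x. L (0, x))"
  proof -
    have "linear (\<lambda>x. L (x, 0))" "linear (\<lambda>x. L (0, x))"
      by (rule linear_compose[OF _ L(1), unfolded o_def], rule linearI, simp_all)+
    moreover have "\<bar>L (x, 0)\<bar> \<le> norm x * Q" "\<bar>L (0, x)\<bar> \<le> norm x * Q" for x
      using L_abs[of "(x, 0)"] L_abs[of "(0, x)"] by (simp_all add: norm_Pair mult.commute)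
    ultimately show "bounded_linear (\<lambda>x. L (x, 0))" "bounded_linear (\<lambda>x. L (0, x))"
      by (auto intro!: bounded_linear.intro bounded_linear_axioms.intro exI[of _ Q])
  qed
  then have fx: "blinfun_apply f x = L (x, 0)" and gx: "blinfun_apply g x = L (0, x)" for x
    by (simp_all add: f_def g_def bounded_linear_Blinfun_apply)
  have f_cone: "f \<in> frechet_normal_cone A a'"
    unfolding mem_frechet_normal_cone_iff
  proof (intro allI impI)
    fix e :: real assume "e > 0"
    with L_normal obtain \<delta> where \<delta>: "\<delta> > 0"
      "\<forall>v\<in>A \<times> B. norm (v - (a', b')) < \<delta> \<longrightarrow> L (v - (a', b')) \<le> e * norm (v - (a', b'))" by blast
    have "f (x - a') \<le> e * norm (x - a')" if "x \<in> A \<inter> ball a' \<delta>" for x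
      using \<delta>(2)[rule_format, of "(x, b')"] that mem by (simp add: fx norm_Pair dist_norm norm_minus_commute)
    then show "\<exists>\<delta>>0. \<forall>x\<in>A \<inter> ball a' \<delta>. f (x - a') \<le> e * norm (x - a')" using \<delta>(1) by blast
  qed
  have g_cone: "g \<in> frechet_normal_cone B b'"
    unfolding mem_frechet_normal_cone_iff
  proof (intro allI impI)
    fix e :: real assume "e > 0"
    with L_normal obtain \<delta> where \<delta>: "\<delta> > 0"
      "\<forall>v\<in>A \<times> B. norm (v - (a', b')) < \<delta> \<longrightarrow> L (v - (a', b')) \<le> e * norm (v - (a', b'))" by blast
    have "g (x - b') \<le> e * norm (x - b')" if "x \<in> B \<inter> ball b' \<delta>" for x
      using \<delta>(2)[rule_format, of "(a', x)"] that mem by (simp add: gx norm_Pair dist_norm norm_minus_commute)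
    then show "\<exists>\<delta>>0. \<forall>x\<in>B \<inter> ball b' \<delta>. g (x - b') \<le> e * norm (x - b')" using \<delta>(1) by blast
  qed
  have sum_le: "norm (f + g) \<le> \<sigma>"
  proof (rule norm_blinfun_bound[OF \<epsilon>s(6)])
    fix x
    have fg: "(f + g) y = L (y, y)" for y
      using linear_add[OF L(1), of "(y, 0)" "(0, y)"] by (simp add: fx gx plus_blinfun.rep_eq)
    have half: "(1 / 2) *\<^sub>R (y + y) = y" for y :: 'a
      by (simp add: scaleR_add_right scaleR_add_left[symmetric])
    have "L (y, y) \<le> \<sigma> * norm y" for y
      using L(2)[rule_format, of "(y, y)"] half[of y] by (simp add: diagonal_norm_def)
    from this[of x] this[of "- x"] show "norm ((f + g) x) \<le> \<sigma> * norm x"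
      unfolding fg using linear_neg[OF L(1), of "(x, x)"] by (simp add: abs_le_iff)
  qed
  define T where "T = norm f + norm g"
  have T: "T \<ge> 1"
  proof -
    define p where "p = d1 - z'"
    define q where "q = d2 - z'"
    define M where "M = gap (d1, d2, z')"
    have M: "M > 0" "norm p \<le> M" "norm q \<le> M"
      using gap_w by (simp_all add: M_def gap_def p_def q_def d)
    \<comment> \<open>\<open>L\<close> is known only on \<open>Y\<close>, and the direction on which it is large lies there\<close>
    have "p \<in> Y" "q \<in> Y"
      unfolding p_def q_def d1_def d2_def by (intro subspace_diff[OF Y(2)] mem cY)+
    then have "L (- p, - q) = \<phi> (- p, - q)" using L(3) subspace_neg[OF Y(2)] by blast
    also have "\<dots> = \<Lambda> (p, q, 0) / t" using linear_neg[OF \<Lambda>_lin, of "(p, q, 0)"] by (simp add: \<phi>_def)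
    finally have "M \<le> L (- p, - q)" using \<phi>_large by (simp add: M_def p_def q_def)
    also have "L (- p, - q) = f (- p) + g (- q)"
      using linear_add[OF L(1), of "(- p, 0)" "(0, - q)"] by (simp add: fx gx)
    also have "\<dots> \<le> norm f * norm p + norm g * norm q"
      using norm_blinfun[of f "- p"] norm_blinfun[of g "- q"] by simp
    also have "\<dots> \<le> norm f * M + norm g * M" using M by (intro add_mono mult_left_mono) auto
    also have "\<dots> = T * M" by (simp add: T_def distrib_right)
    finally show ?thesis using M(1) by simp
  qed
  define as where "as = (1 / T) *\<^sub>R f"
  define bs where "bs = (1 / T) *\<^sub>R g"
  have "as \<in> frechet_normal_cone A a'" "bs \<in> frechet_normal_cone B b'"
    unfolding as_def bs_def using T by (intro frechet_normal_cone_scaleR f_cone g_cone; simp)+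
  moreover have "norm as + norm bs = 1"
  proof -
    have "norm as = norm f / T" "norm bs = norm g / T" using T by (simp_all add: as_def bs_def)
    then have "norm as + norm bs = T / T" by (simp only: T_def add_divide_distrib)
    then show ?thesis using T by simp
  qed
  moreover have "norm (as + bs) < \<epsilon>"
  proof -
    have "norm (as + bs) = norm (f + g) / T"
      using T by (simp add: as_def bs_def scaleR_add_right[symmetric])
    also have "\<dots> \<le> norm (f + g)" using T by (simp add: divide_le_eq mult_left_le mult_le_cancel_left1)
    finally show ?thesis using sum_le \<epsilon>s(4) by linarith
  qed
  ultimately show ?thesis using mem(1,2) near by blast
qed

section \<open>From normals to separation and the main theorem\<close>

text \<open>
  Take \<open>u\<close> and \<open>v\<close> of norm just below \<open>\<epsilon>\<rho>\<close> and almost norming for the two normals. A common point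
  \<open>z\<close> of the translates would give \<open>(as + bs) z + as u + bs v \<le> o(\<rho>)\<close>, while the left side is at least
  \<open>(\<alpha> - \<parallel>as + bs\<parallel>) \<rho>\<close>.
\<close>

theorem normals_imp_separation:
  fixes A B :: "'a::real_normed_vector set" and as bs :: "'a \<Rightarrow>\<^sub>L real"
  assumes as: "as \<in> frechet_normal_cone A a" and bs: "bs \<in> frechet_normal_cone B b"
    and one: "norm as + norm bs = 1" and small: "norm (as + bs) < \<epsilon>" and \<delta>: "\<delta> > 0"
  shows "\<exists>\<rho>\<in>{0<..<\<delta>}. \<exists>u v. (\<lambda>x. x - a - u) ` A \<inter> (\<lambda>x. x - b - v) ` B \<inter> cball 0 \<rho> = {} \<and>
      max (norm u) (norm v) < \<epsilon> * \<rho>"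
proof -
  define N where "N = norm (as + bs)"
  have N0: "N \<ge> 0" by (simp add: N_def)
  obtain \<alpha> where \<alpha>: "N < \<alpha>" "\<alpha> < \<epsilon>" using dense[OF small[folded N_def]] by blast
  obtain \<beta> where \<beta>: "\<alpha> < \<beta>" "\<beta> < \<epsilon>" using dense[OF \<alpha>(2)] by blast
  have pos: "0 < \<alpha>" "0 < \<epsilon>" using \<alpha> N0 by auto
  obtain u0 where u0: "norm u0 \<le> \<beta>" "\<alpha> * norm as \<le> as u0" using ex_almost_norming[OF pos(1) \<beta>(1)] by blast
  obtain v0 where v0: "norm v0 \<le> \<beta>" "\<alpha> * norm bs \<le> bs v0" using ex_almost_norming[OF pos(1) \<beta>(1)] by blast
  define \<eta> where "\<eta> = (\<alpha> - N) / (4 * (1 + \<epsilon>))"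
  have \<eta>: "\<eta> > 0" using \<alpha> pos by (simp add: \<eta>_def)
  obtain \<delta>1 where \<delta>1: "\<delta>1 > 0" "\<And>x. x \<in> A \<inter> ball a \<delta>1 \<Longrightarrow> as (x - a) \<le> \<eta> * norm (x - a)"
    using as \<eta> unfolding mem_frechet_normal_cone_iff by blast
  obtain \<delta>2 where \<delta>2: "\<delta>2 > 0" "\<And>x. x \<in> B \<inter> ball b \<delta>2 \<Longrightarrow> bs (x - b) \<le> \<eta> * norm (x - b)"
    using bs \<eta> unfolding mem_frechet_normal_cone_iff by blast
  define \<rho> where "\<rho> = min \<delta> (min \<delta>1 \<delta>2) / (2 * (1 + \<epsilon>))"
  have \<rho>: "\<rho> > 0" using \<delta> \<delta>1(1) \<delta>2(1) pos by (simp add: \<rho>_def)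
  have "2 * (1 + \<epsilon>) \<noteq> 0" using pos by simp
  then have "\<rho> * (2 * (1 + \<epsilon>)) = min \<delta> (min \<delta>1 \<delta>2)" using iffD1[OF nonzero_eq_divide_eq \<rho>_def] by simp
  then have "2 * ((1 + \<epsilon>) * \<rho>) = min \<delta> (min \<delta>1 \<delta>2)" by (simp only: mult_ac)
  then have "2 * ((1 + \<epsilon>) * \<rho>) \<le> \<delta>" "2 * ((1 + \<epsilon>) * \<rho>) \<le> \<delta>1" "2 * ((1 + \<epsilon>) * \<rho>) \<le> \<delta>2" by linarith+
  moreover have \<rho>\<epsilon>: "\<rho> \<le> (1 + \<epsilon>) * \<rho>" "0 < (1 + \<epsilon>) * \<rho>" using \<rho> pos by (simp_all add: distrib_right add_pos_pos)
  ultimately have bounds: "\<rho> < \<delta>" "(1 + \<epsilon>) * \<rho> < \<delta>1" "(1 + \<epsilon>) * \<rho> < \<delta>2" using \<rho> by linarith+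
  define u where "u = \<rho> *\<^sub>R u0"
  define v where "v = \<rho> *\<^sub>R v0"
  have "norm u0 < \<epsilon>" "norm v0 < \<epsilon>" using u0 v0 \<beta> by auto
  then have uv: "norm u < \<epsilon> * \<rho>" "norm v < \<epsilon> * \<rho>" using \<rho> by (simp_all add: u_def v_def mult.commute)
  have "(\<lambda>x. x - a - u) ` A \<inter> (\<lambda>x. x - b - v) ` B \<inter> cball 0 \<rho> = {}"
  proof (rule ccontr)
    assume "(\<lambda>x. x - a - u) ` A \<inter> (\<lambda>x. x - b - v) ` B \<inter> cball 0 \<rho> \<noteq> {}"
    then obtain z where z: "z \<in> (\<lambda>x. x - a - u) ` A" "z \<in> (\<lambda>x. x - b - v) ` B" "z \<in> cball 0 \<rho>" by blast
    then obtain x y where "x \<in> A" "z = x - a - u" "y \<in> B" "z = y - b - v" by (elim imageE)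
    with z(3) have xyz: "x \<in> A" "y \<in> B" "z = x - a - u" "z = y - b - v" "norm z \<le> \<rho>" by simp_all
    have xa: "x - a = z + u" by (simp add: xyz(3))
    have yb: "y - b = z + v" by (simp add: xyz(4))
    have n: "norm (x - a) \<le> (1 + \<epsilon>) * \<rho>" "norm (y - b) \<le> (1 + \<epsilon>) * \<rho>"
      unfolding xa yb distrib_right using norm_triangle_ineq[of z u] norm_triangle_ineq[of z v] xyz(5) uv by linarith+
    have "norm (a - x) < \<delta>1" "norm (b - y) < \<delta>2"
      using n bounds(2,3) norm_minus_commute[of a x] norm_minus_commute[of b y] by linarith+
    then have in_balls: "x \<in> A \<inter> ball a \<delta>1" "y \<in> B \<inter> ball b \<delta>2"
      using xyz(1,2) by (simp_all add: dist_norm)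
    have "as (z + u) \<le> \<eta> * norm (x - a)" "bs (z + v) \<le> \<eta> * norm (y - b)"
      unfolding xa[symmetric] yb[symmetric] by (rule \<delta>1(2)[OF in_balls(1)], rule \<delta>2(2)[OF in_balls(2)])
    moreover have "\<eta> * norm (x - a) \<le> \<eta> * ((1 + \<epsilon>) * \<rho>)" "\<eta> * norm (y - b) \<le> \<eta> * ((1 + \<epsilon>) * \<rho>)"
      using n \<eta> by (intro mult_left_mono; simp)+
    moreover have "4 * (\<eta> * ((1 + \<epsilon>) * \<rho>)) = (\<alpha> - N) * \<rho>"
    proof -
      have "\<eta> * (4 * (1 + \<epsilon>)) = \<alpha> - N" using iffD1[OF nonzero_eq_divide_eq \<eta>_def] pos by simp
      moreover have "4 * (\<eta> * ((1 + \<epsilon>) * \<rho>)) = (\<eta> * (4 * (1 + \<epsilon>))) * \<rho>" by (simp only: mult_ac)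
      ultimately show ?thesis by (simp only:)
    qed
    ultimately have "as (z + u) + bs (z + v) \<le> (\<alpha> - N) * \<rho> / 2" by linarith
    moreover have "as (z + u) + bs (z + v) = (as + bs) z + \<rho> * (as u0 + bs v0)"
      by (simp add: u_def v_def blinfun.add_right blinfun.add_left blinfun.scaleR_right distrib_left)
    moreover have "- (N * \<rho>) \<le> (as + bs) z"
    proof -
      have "\<bar>(as + bs) z\<bar> \<le> N * norm z" using norm_blinfun[of "as + bs" z] by (simp add: N_def)
      also have "\<dots> \<le> N * \<rho>" using xyz(5) N0 by (rule mult_left_mono)
      finally show ?thesis by linarith
    qed
    moreover have "\<rho> * \<alpha> \<le> \<rho> * (as u0 + bs v0)"
    proof (rule mult_left_mono)
      have "\<alpha> = \<alpha> * norm as + \<alpha> * norm bs" using one by (simp add: distrib_left[symmetric])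
      then show "\<alpha> \<le> as u0 + bs v0" using u0(2) v0(2) by linarith
    qed (use \<rho> in simp)
    ultimately have "(\<alpha> - N) * \<rho> \<le> (\<alpha> - N) * \<rho> / 2" by (simp add: algebra_simps)
    moreover have "(\<alpha> - N) * \<rho> > 0" using \<alpha>(1) \<rho> by simp
    ultimately show False by linarith
  qed
  then show ?thesis using \<rho> bounds(1) uv by (intro bexI[of _ \<rho>] exI[of _ u] exI[of _ v]) auto
qed

theorem theorem6:
  fixes A B :: "'a::banach set" and a b :: 'a
  assumes "asplund_space TYPE('a)"
    and "closed A" and "closed B"
    and "a \<in> A" and "b \<in> B"
  shows
    "(\<forall>ahat bhat u v :: 'a. \<forall>\<epsilon> \<rho> :: real.
        ahat \<in> A \<and> bhat \<in> B \<and> \<epsilon> > 0 \<and> \<rho> > 0 \<and>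
        (\<lambda>x. x - ahat - u) ` A \<inter> (\<lambda>x. x - bhat - v) ` B \<inter> cball 0 \<rho> = {} \<and>
        max (norm u) (norm v) < \<epsilon> * \<rho> \<longrightarrow>
        (\<forall>\<delta> > max (norm (ahat - a)) (norm (bhat - b)) + \<rho> * (\<epsilon> + 1).
           \<exists>a' \<in> A \<inter> ball a \<delta>. \<exists>b' \<in> B \<inter> ball b \<delta>.
           \<exists>as \<in> frechet_normal_cone A a'. \<exists>bs \<in> frechet_normal_cone B b'.
             norm as + norm bs = 1 \<and> norm (as + bs) < \<epsilon>))
     \<and>
     (\<forall>as \<in> frechet_normal_cone A a. \<forall>bs \<in> frechet_normal_cone B b. \<forall>\<epsilon> > 0 :: real.
        norm as + norm bs = 1 \<and> norm (as + bs) < \<epsilon> \<longrightarrow>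
        (\<forall>\<delta> > 0 :: real. \<exists>\<rho> \<in> {0<..<\<delta>}. \<exists>u v :: 'a.
           (\<lambda>x. x - a - u) ` A \<inter> (\<lambda>x. x - b - v) ` B \<inter> cball 0 \<rho> = {} \<and>
           max (norm u) (norm v) < \<epsilon> * \<rho>))"
proof (intro conjI allI impI ballI)
  fix ahat bhat u v :: 'a and \<epsilon> \<rho> \<delta> :: real
  assume h: "ahat \<in> A \<and> bhat \<in> B \<and> \<epsilon> > 0 \<and> \<rho> > 0 \<and>
        (\<lambda>x. x - ahat - u) ` A \<inter> (\<lambda>x. x - bhat - v) ` B \<inter> cball 0 \<rho> = {} \<and>
        max (norm u) (norm v) < \<epsilon> * \<rho>"
    and \<delta>: "max (norm (ahat - a)) (norm (bhat - b)) + \<rho> * (\<epsilon> + 1) < \<delta>"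
  have disj: "norm (x - ahat - u) > \<rho>" if xy: "x \<in> A" "y \<in> B" "x - ahat - u = y - bhat - v" for x y
  proof (rule ccontr)
    assume "\<not> norm (x - ahat - u) > \<rho>"
    then have "x - ahat - u \<in> cball 0 \<rho>" by simp
    moreover have "x - ahat - u \<in> (\<lambda>x. x - ahat - u) ` A" using xy(1) by blast
    moreover have "x - ahat - u \<in> (\<lambda>x. x - bhat - v) ` B" unfolding xy(3) using xy(2) by blast
    ultimately show False using h by blast
  qed
  have "\<exists>a' \<in> A. \<exists>b' \<in> B. \<exists>as \<in> frechet_normal_cone A a'. \<exists>bs \<in> frechet_normal_cone B b'.
    norm (a' - ahat) < \<rho> * (\<epsilon> + 1) \<and> norm (b' - bhat) < \<rho> * (\<epsilon> + 1) \<and>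
    norm as + norm bs = 1 \<and> norm (as + bs) < \<epsilon>"
    by (rule approximate_normals[OF assms(1,2,3), where u = u and v = v and \<rho> = \<rho>])
      (use h disj in \<open>simp_all\<close>)
  then obtain a' b' as bs where ab: "a' \<in> A" "b' \<in> B" "as \<in> frechet_normal_cone A a'"
    "bs \<in> frechet_normal_cone B b'" "norm (a' - ahat) < \<rho> * (\<epsilon> + 1)" "norm (b' - bhat) < \<rho> * (\<epsilon> + 1)"
    "norm as + norm bs = 1" "norm (as + bs) < \<epsilon>" by (elim bexE conjE)
  have "norm (a - a') \<le> norm (ahat - a) + norm (a' - ahat)"
    using norm_triangle_ineq[of "ahat - a" "a' - ahat"] by (simp add: norm_minus_commute)
  then have "a' \<in> A \<inter> ball a \<delta>" using ab(1,5) \<delta> by (simp add: dist_norm)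
  moreover have "norm (b - b') \<le> norm (bhat - b) + norm (b' - bhat)"
    using norm_triangle_ineq[of "bhat - b" "b' - bhat"] by (simp add: norm_minus_commute)
  then have "b' \<in> B \<inter> ball b \<delta>" using ab(2,6) \<delta> by (simp add: dist_norm)
  ultimately show "\<exists>a' \<in> A \<inter> ball a \<delta>. \<exists>b' \<in> B \<inter> ball b \<delta>.
           \<exists>as \<in> frechet_normal_cone A a'. \<exists>bs \<in> frechet_normal_cone B b'.
             norm as + norm bs = 1 \<and> norm (as + bs) < \<epsilon>"
    using ab(3,4,7,8) by blast
next
  fix as bs and \<epsilon> \<delta> :: real
  assume "as \<in> frechet_normal_cone A a" "bs \<in> frechet_normal_cone B b"
    "norm as + norm bs = 1 \<and> norm (as + bs) < \<epsilon>" "\<delta> > 0"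
  then show "\<exists>\<rho> \<in> {0<..<\<delta>}. \<exists>u v :: 'a.
           (\<lambda>x. x - a - u) ` A \<inter> (\<lambda>x. x - b - v) ` B \<inter> cball 0 \<rho> = {} \<and>
           max (norm u) (norm v) < \<epsilon> * \<rho>"
    using normals_imp_separation by blast
qed

end
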